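(* Let $p>1$, $q=\frac{2p}{p+1}$, $K=\frac{(N-2)p-N}{p-1}$, $\lambda_k=k(k+N-2)$ for $k\ge1$, and consider on the sphere $S^{N-1}$ the equation $$-\Delta'\omega+\frac{2K}{p-1}\omega=\omega^p+M\left(\Big(\frac{2}{p-1}\Big)^2\omega^2+|\nabla'\omega|^2\right)^{\frac{p}{p+1}} ,\qquad(\ast)$$ whose positive constant solutions $X$ are the positive roots of $$X^{p-1}+M\Big(\frac{2}{p-1}\Big)^{\frac{2p}{p+1}}X^{\frac{p-1}{p+1}}-\frac{2K}{p-1}=0 .\qquad(\ast\ast)$$ Bifurcation curves are curves of positive solutions $(M,\omega_M)$ of $(\ast)$, nonconstant away from the bifurcation point; a bifurcation from a constant solution $(M_0,X)$ is associated with the integer $k\ge 1$ if $M_0\big(\frac{2}{p-1}\big)^{\frac{2p}{p+1}}X^{\frac{p-1}{p+1}}=\frac{p+1}{p(p-1)}(2K-\lambda_k)$. 1. Let $N\ge3$ and $p\ge\frac{N}{N-2}$. 1-(i) There exists a continuous curve of bifurcation $(M,\omega_M)$ issued from $(M_0,X_{M_0})$, for some $M_0=M_0(p)\ge0$, associated with an integer $k\ge 1$, if and only if $p\ge\frac{N+1}{N-3}$ and $k=1$. Furthermore $M_0\big(\frac{N+1}{N-3}\big)=0$. 1-(ii) The bifurcation curve $s\mapsto(M(s),\omega_{M(s)})$ is defined on $(-\epsilon_0,\epsilon_0)$ for some $\epsilon_0>0$ and satisfies $(M(0),\omega_{M(0)})=(M_0,X_{M_0})$. 2. Let $N\ge3$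 and $p\ge\frac{N}{N-2}$. 2-(i) For any $k\ge1$ there exist $M_k<0$ and a continuous branch of bifurcation $(M,\omega_M)$ issued from $(M_k,X_{M_k})$ (associated with $k$), with the restriction that $p<\frac{N+1}{N-3}$ if $k=1$. 2-(ii) The bifurcation curve $s\mapsto(M(s),\omega_{M(s)})$ is defined on $(-\epsilon_0,\epsilon_0)$ for some $\epsilon_0>0$ and satisfies $(M(0),\omega_{M(0)})=(M_k,X_{M_k})$. Finally $M_k\to-\infty$ when $k\to\infty$. 3. Let $N=1,2$ and $p>1$, or $N\ge3$ and $1<p<\frac{N}{N-2}$. For $M\le-\mu^*$ and $j=1,2$ put $\Phi_j(M)=M\big(\frac{2}{p-1}\big)^{\frac{2p}{p+1}}X_{j,M}^{\frac{p-1}{p+1}}$. 3-(i) There exists no $M<0$ such that $\frac{2K}{p-1}<\Phi_1(M)<0$, and there is a countable set of $M_k<0$, $k\ge1$, such that $\Phi_2(M_k)=\frac{p+1}{p(p-1)}(2K-\lambda_k)$. 3-(ii) There exist countably many branches of bifurcation of solutions $(M_k(s),\omega_{M_k(s)})$ of $(\ast)$ issued from $(M_k,X_{2,M_k})$.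
   Context: $\Delta'$ is the Laplace–Beltrami operator on $S^{N-1}$ and $\nabla'$ the tangential gradient; $\lambda_k$ is the $k$-th nonzero eigenvalue of $-\Delta'$ in $H^1(S^{N-1})$. Solutions of $(\ast)$ correspond to separable solutions $u(r,\sigma)=r^{-\frac{2}{p-1}}\omega(\sigma)$ of $-\Delta u=u^p+M|\nabla u|^q$ in $\mathbb{R}^N\setminus\{0\}$. Notation for constant solutions: if $N\ge3$ and $p>\frac N{N-2}$, then for every $M\in\mathbb{R}$ equation $(\ast\ast)$ has a unique positive root $X_M$; if $N\ge 3$ and $p=\frac{N}{N-2}$ this holds for every $M<0$ (and there is no positive root for $M\ge0$). If $N=1,2$ and $p>1$, or $N\ge3$ and $1<p<\frac N{N-2}$, put $\mu^*=(p+1)\big(\frac{N-(N-2)p}{2p}\big)^{\frac{p}{p+1}}$; for $M<-\mu^*$ equation $(\ast\ast)$ has exactly two positive roots $X_{1,M}<X_{2,M}$, and for $M=-\mu^*$ a unique one, denoted $X_{1,M}=X_{2,M}$. A continuous branch (curve) of bifurcation issued from $(M_0,X)$ is a continuous curve $s\mapsto(M(s),\omega_{M(s)})\in\mathbb{R}\times C^1(S^{N-1})$, defined for $s$ near $0$, of positive solutions of $(\ast)$ (with $M=M(s)$), equal to $(M_0,X)$ at $s=0$ and with $\omega_{M(s)}$ nonconstant for $s\ne0$. Convention: $\frac{N+1}{N-3}=\infty$ if $N=3$.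
   Formalization: In 3-(ii), for N=1 the branch is claimed only for k=1: on the two-point sphere S^0 equation ( * ) is ( ** ) at each point, and for k≥2 X_{2,M_k} is a simple root, so every solution near it is constant and no branch exists. *)

theory Defs
  imports "HOL-Analysis.Analysis"
begin

section \<open>Calculus on the unit sphere of a Euclidean space\<close>

text \<open>
  The sphere \<open>S\<^bsup>N-1\<^esup>\<close> is \<open>sphere 0 1\<close> in \<open>'a::euclidean_space\<close> with \<open>N = DIM('a)\<close>. A function on it
  is a function on \<open>'a\<close> of which only the values on the sphere are used. Everything is expressed
  through the extension that is homogeneous of degree 0. Since
  \<open>\<nabla>u = u\<^sub>r x/r + r\<^sup>-\<^sup>1 \<nabla>'u\<close> and \<open>\<Delta>u = u\<^sub>r\<^sub>r + (N-1)/r u\<^sub>r + r\<^sup>-\<^sup>2 \<Delta>'u\<close>, the gradient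
  and the Laplacian of this extension are, on the sphere, the tangential gradient and the
  Laplace-Beltrami operator. On \<open>S\<^sup>0\<close> (two points, \<open>N = 1\<close>) both are zero.
\<close>

definition radial_ext :: "('a::euclidean_space \<Rightarrow> real) \<Rightarrow> 'a \<Rightarrow> real" where
  "radial_ext \<omega> x = \<omega> (x /\<^sub>R norm x)"

definition partial :: "'a::euclidean_space \<Rightarrow> ('a \<Rightarrow> real) \<Rightarrow> 'a \<Rightarrow> real" where
  "partial b f x = frechet_derivative f (at x) b"

text \<open>These two are meant for open \<open>S\<close>.\<close>

definition C1_on :: "'a::euclidean_space set \<Rightarrow> ('a \<Rightarrow> real) \<Rightarrow> bool" where
  "C1_on S f \<longleftrightarrow>
     (\<forall>x\<in>S. f differentiable (at x)) \<and> (\<forall>b\<in>Basis. continuous_on S (partial b f))"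

definition C2_on :: "'a::euclidean_space set \<Rightarrow> ('a \<Rightarrow> real) \<Rightarrow> bool" where
  "C2_on S f \<longleftrightarrow> C1_on S f \<and> (\<forall>b\<in>Basis. C1_on S (partial b f))"

definition C2_sphere :: "('a::euclidean_space \<Rightarrow> real) \<Rightarrow> bool" where
  "C2_sphere \<omega> \<longleftrightarrow> C2_on (- {0}) (radial_ext \<omega>)"

definition sph_grad :: "('a::euclidean_space \<Rightarrow> real) \<Rightarrow> 'a \<Rightarrow> 'a" where
  "sph_grad \<omega> \<sigma> = (\<Sum>b\<in>Basis. partial b (radial_ext \<omega>) \<sigma> *\<^sub>R b)"

definition sph_laplacian :: "('a::euclidean_space \<Rightarrow> real) \<Rightarrow> 'a \<Rightarrow> real" where
  "sph_laplacian \<omega> \<sigma> = (\<Sum>b\<in>Basis. partial b (partial b (radial_ext \<omega>)) \<sigma>)"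

section \<open>The equation and its constant solutions\<close>

definition K_coeff :: "nat \<Rightarrow> real \<Rightarrow> real" where
  "K_coeff N p = ((real N - 2) * p - real N) / (p - 1)"

definition lam :: "nat \<Rightarrow> nat \<Rightarrow> real" where
  "lam N k = real k * (real k + real N - 2)"

text \<open>Positive classical solutions; for \<open>C\<^sup>1\<close> positive functions these are the same as weak solutions.\<close>

definition positive_solution :: "real \<Rightarrow> real \<Rightarrow> ('a::euclidean_space \<Rightarrow> real) \<Rightarrow> bool" where
  "positive_solution p M \<omega> \<longleftrightarrow>
     C2_sphere \<omega> \<and>
     (\<forall>\<sigma>\<in>sphere 0 1. \<omega> \<sigma> > 0) \<and>
     (\<forall>\<sigma>\<in>sphere 0 1.
        - sph_laplacian \<omega> \<sigma> + 2 * K_coeff DIM('a) p / (p - 1) * \<omega> \<sigma> =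
        \<omega> \<sigma> powr p +
        M * ((2 / (p - 1))\<^sup>2 * (\<omega> \<sigma>)\<^sup>2 + (norm (sph_grad \<omega> \<sigma>))\<^sup>2) powr (p / (p + 1)))"

definition Phi :: "real \<Rightarrow> real \<Rightarrow> real \<Rightarrow> real" where
  "Phi p M X = M * (2 / (p - 1)) powr (2 * p / (p + 1)) * X powr ((p - 1) / (p + 1))"

definition positive_root :: "nat \<Rightarrow> real \<Rightarrow> real \<Rightarrow> real \<Rightarrow> bool" where
  "positive_root N p M X \<longleftrightarrow>
     X > 0 \<and> X powr (p - 1) + Phi p M X - 2 * K_coeff N p / (p - 1) = 0"

text \<open>
  \<open>X_root\<close> is used where there is exactly one positive root. \<open>X1_root\<close> and \<open>X2_root\<close> are used for
  \<open>M \<le> - mu_star N p\<close>, where there are two positive roots, which coincide for \<open>M = - mu_star N p\<close>.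
\<close>

definition X_root :: "nat \<Rightarrow> real \<Rightarrow> real \<Rightarrow> real" where
  "X_root N p M = (THE X. positive_root N p M X)"

definition X1_root :: "nat \<Rightarrow> real \<Rightarrow> real \<Rightarrow> real" where
  "X1_root N p M = (LEAST X. positive_root N p M X)"

definition X2_root :: "nat \<Rightarrow> real \<Rightarrow> real \<Rightarrow> real" where
  "X2_root N p M = (GREATEST X. positive_root N p M X)"

definition mu_star :: "nat \<Rightarrow> real \<Rightarrow> real" where
  "mu_star N p = (p + 1) * ((real N - (real N - 2) * p) / (2 * p)) powr (p / (p + 1))"

definition Phi1 :: "nat \<Rightarrow> real \<Rightarrow> real \<Rightarrow> real" where
  "Phi1 N p M = Phi p M (X1_root N p M)"

definition Phi2 :: "nat \<Rightarrow> real \<Rightarrow> real \<Rightarrow> real" where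
  "Phi2 N p M = Phi p M (X2_root N p M)"

text \<open>\<open>(N+1)/(N-3)\<close>, for \<open>N \<ge> 3\<close>.\<close>

definition p_crit :: "nat \<Rightarrow> ereal" where
  "p_crit N = (if N = 3 then \<infinity> else ereal ((real N + 1) / (real N - 3)))"

section \<open>Bifurcation curves\<close>

text \<open>The two uniform limits express continuity of \<open>s \<mapsto> \<omega> s\<close> into \<open>C\<^sup>1(S\<^bsup>N-1\<^esup>)\<close>.\<close>

definition bifurcation_curve ::
  "real \<Rightarrow> real set \<Rightarrow> (real \<Rightarrow> real) \<Rightarrow> (real \<Rightarrow> 'a::euclidean_space \<Rightarrow> real) \<Rightarrow> real \<Rightarrow> real \<Rightarrow> bool"
where
  "bifurcation_curve p I M \<omega> M0 X \<longleftrightarrow>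
     open I \<and> connected I \<and> 0 \<in> I \<and>
     continuous_on I M \<and>
     (\<forall>s\<in>I. uniform_limit (sphere 0 1) \<omega> (\<omega> s) (at s within I) \<and>
            uniform_limit (sphere 0 1) (\<lambda>t. sph_grad (\<omega> t)) (sph_grad (\<omega> s)) (at s within I)) \<and>
     (\<forall>s\<in>I. positive_solution p (M s) (\<omega> s)) \<and>
     M 0 = M0 \<and> (\<forall>\<sigma>\<in>sphere 0 1. \<omega> 0 \<sigma> = X) \<and>
     (\<forall>s\<in>I - {0}. \<not> \<omega> s constant_on sphere 0 1)"

definition associated :: "nat \<Rightarrow> real \<Rightarrow> nat \<Rightarrow> real \<Rightarrow> real \<Rightarrow> bool" where
  "associated N p k M0 X \<longleftrightarrow>
     Phi p M0 X = (p + 1) / (p * (p - 1)) * (2 * K_coeff N p - lam N k)"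

end

(*
A zonal function \<sigma> \<mapsto> f (\<sigma> \<bullet> e) turns the equation into a singular second order equation for f on [-1,1], and
among zonal functions every eigenvalue lam N k is simple. Writing the solution as X (1 + s z (\<sigma> \<bullet> e))
with P = X powr (p - 1) as the parameter makes the equation affine in P with an explicit linear part
lam N k + \<zeta>, \<zeta> a multiple of P - P(0), so that transversality holds for free and no assumption on
the dependence of X on M is needed.

The linearised operator is inverted modulo its kernel by solving for polynomial right-hand sides
and passing to the limit with an a priori bound; the bound comes from a comparison function near a
pole and a weighted maximum. Solvability fixes \<zeta> = - \<beta>, where \<beta> is the kernel component of the
right-hand side, and what remains is a contraction for that right-hand side in the space of bounded
continuous functions, with a Lipschitz dependent fixed point. The fixed point is defined for s \<ge> 0; the curve uses
\<bar>s\<bar>. For N = 1 the sphere has two points, and the curve puts the two roots X1, X2 near the fold on them.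

The levels A = X powr (p - 1) at which bifurcation occurs are explicit, and M is an explicit function of A
that is strictly decreasing to the right of the fold.
*)
theory Submission
  imports Defs
begin

section \<open>Zonal functions: the linear equation\<close>

text \<open>Division by X turns the equation for g = 1 + s z into -\<Delta>' g + c g = P g^p + (c -
  P) (g^2 + e |grad g|^2)^\<sigma> with c = 2K/(p-1), e = ((p-1)/2)^2, \<sigma> = p/(p+1), because
  \<open>Phi\<close> equals c - P at a root. The linearisation at g = 1 is -\<Delta>' z = (c (q-1) +
  \<kappa> P) z with q = 2 \<sigma> and \<kappa> = p - q = p(p-1)/(p+1) > 0; that this factor is an
  eigenvalue is the condition \<open>associated\<close>. Raising P by \<zeta>/\<kappa> raises the
  factor by \<zeta>: this is the transversality. M is computed from P only at the end, so a critical
  point of M as a function of P does no harm. The gradient term costs a derivative and the equation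
  degenerates at the poles. The estimates are therefore made in the sup norm: the inverse bounds
  both w and its derivative by sup |h|, so that an iteration on the right-hand side closes. Second
  derivatives are read off the equation afterwards. A bifurcation curve need only be continuous and
  nonconstant away from 0, so one half-branch may be traversed twice. The pole estimates need d = N
  - 1 >= 1, which is why the two-point sphere is treated apart.\<close>

text \<open>
  \<open>\<Delta>'w + l w = - h\<close> for the function \<open>w\<close> of the height \<open>t\<close> on the sphere of dimension \<open>d\<close>, with \<open>y\<close> the
  derivative of \<open>w\<close>. This form has no singular coefficients, makes sense up to the poles \<open>t = \<plusminus>1\<close> and
  is preserved by uniform limits.
\<close>

definition zonal_sol :: "nat \<Rightarrow> real \<Rightarrow> (real \<Rightarrow> real) \<Rightarrow> (real \<Rightarrow> real) \<Rightarrow> (real \<Rightarrow> real) \<Rightarrow> bool" where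
  "zonal_sol d l h w y \<longleftrightarrow>
     continuous_on {-1..1} y \<and>
     (\<forall>t\<in>{-1..1}. (w has_real_derivative y t) (at t within {-1..1}) \<and>
        ((\<lambda>t. (1 - t\<^sup>2) * y t) has_real_derivative (real d - 2) * t * y t - l * w t - h t)
          (at t within {-1..1}))"

lemma zonal_solD:
  assumes "zonal_sol d l h w y"
  shows "continuous_on {-1..1} y" "continuous_on {-1..1} w"
    and "t \<in> {-1..1} \<Longrightarrow> (w has_real_derivative y t) (at t within {-1..1})"
    and "t \<in> {-1..1} \<Longrightarrow> ((\<lambda>t. (1 - t\<^sup>2) * y t) has_real_derivative
           (real d - 2) * t * y t - l * w t - h t) (at t within {-1..1})"
  using assms unfolding zonal_sol_def
  by (auto intro!: DERIV_continuous_on)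

section \<open>Linearity and reflection of the zonal equation\<close>

lemma zonal_sol_add:
  assumes "zonal_sol d l h1 w1 y1" "zonal_sol d l h2 w2 y2"
  shows "zonal_sol d l (\<lambda>t. h1 t + h2 t) (\<lambda>t. w1 t + w2 t) (\<lambda>t. y1 t + y2 t)"
  unfolding zonal_sol_def
proof (intro conjI ballI)
  show "continuous_on {-1..1} (\<lambda>t. y1 t + y2 t)"
    using zonal_solD(1)[OF assms(1)] zonal_solD(1)[OF assms(2)] by (intro continuous_intros)
  fix t :: real assume t: "t \<in> {-1..1}"
  show "((\<lambda>t. w1 t + w2 t) has_real_derivative y1 t + y2 t) (at t within {-1..1})"
    using zonal_solD(3)[OF assms(1) t] zonal_solD(3)[OF assms(2) t] by (rule DERIV_add)
  show "((\<lambda>t. (1 - t\<^sup>2) * (y1 t + y2 t)) has_real_derivative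
      (real d - 2) * t * (y1 t + y2 t) - l * (w1 t + w2 t) - (h1 t + h2 t)) (at t within {-1..1})"
    using DERIV_add[OF zonal_solD(4)[OF assms(1) t] zonal_solD(4)[OF assms(2) t]]
    by (simp add: algebra_simps)
qed

lemma zonal_sol_cmult:
  assumes "zonal_sol d l h w y"
  shows "zonal_sol d l (\<lambda>t. c * h t) (\<lambda>t. c * w t) (\<lambda>t. c * y t)"
  unfolding zonal_sol_def
proof (intro conjI ballI)
  show "continuous_on {-1..1} (\<lambda>t. c * y t)"
    using zonal_solD(1)[OF assms] by (intro continuous_intros)
  fix t :: real assume t: "t \<in> {-1..1}"
  show "((\<lambda>t. c * w t) has_real_derivative c * y t) (at t within {-1..1})"
    using zonal_solD(3)[OF assms t] by (rule DERIV_cmult)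
  show "((\<lambda>t. (1 - t\<^sup>2) * (c * y t)) has_real_derivative
      (real d - 2) * t * (c * y t) - l * (c * w t) - c * h t) (at t within {-1..1})"
    using DERIV_cmult[OF zonal_solD(4)[OF assms t], of c]
    by (simp add: algebra_simps)
qed

lemma zonal_sol_cong:
  assumes "zonal_sol d l h w y" "\<And>t. t \<in> {-1..1} \<Longrightarrow> h t = h' t"
  shows "zonal_sol d l h' w y"
  using assms unfolding zonal_sol_def by simp

lemma zonal_sol_minus:
  assumes "zonal_sol d l h1 w1 y1" "zonal_sol d l h2 w2 y2"
  shows "zonal_sol d l (\<lambda>t. h1 t - h2 t) (\<lambda>t. w1 t - w2 t) (\<lambda>t. y1 t - y2 t)"
  using zonal_sol_add[OF assms(1) zonal_sol_cmult[OF assms(2), of "-1"]] by simp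

lemma zonal_sol_0: "zonal_sol d l (\<lambda>t. 0) (\<lambda>t. 0) (\<lambda>t. 0)"
  by (simp add: zonal_sol_def)

lemma zonal_sol_sum:
  assumes "\<And>i. i \<in> S \<Longrightarrow> zonal_sol d l (h i) (w i) (y i)"
  shows "zonal_sol d l (\<lambda>t. \<Sum>i\<in>S. a i * h i t) (\<lambda>t. \<Sum>i\<in>S. a i * w i t) (\<lambda>t. \<Sum>i\<in>S. a i * y i t)"
proof (cases "finite S")
  case True
  then show ?thesis using assms
    by (induction S) (auto simp: zonal_sol_0 intro!: zonal_sol_add zonal_sol_cmult)
next
  case False
  then show ?thesis by (simp add: zonal_sol_0)
qed

lemma zonal_sol_reflect:
  assumes "zonal_sol d l h w y"
  shows "zonal_sol d l (\<lambda>t. h (- t)) (\<lambda>t. w (- t)) (\<lambda>t. - y (- t))"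
  unfolding zonal_sol_def
proof (intro conjI ballI)
  have img: "uminus ` {-1..1} = {-1..1::real}" by simp
  show "continuous_on {-1..1} (\<lambda>t. - y (- t))"
    using continuous_on_compose[of "{-1..1}" uminus y] zonal_solD(1)[OF assms]
    by (simp add: o_def continuous_on_minus)
  fix t :: real assume t: "t \<in> {-1..1}"
  then have t': "- t \<in> {-1..1}" by auto
  have m: "(uminus has_real_derivative -1) (at t within {-1..1})"
    by (auto intro!: derivative_eq_intros)
  show "((\<lambda>t. w (- t)) has_real_derivative - y (- t)) (at t within {-1..1})"
    using DERIV_image_chain[of w "y (- t)" uminus t "{-1..1}" "-1"] zonal_solD(3)[OF assms t'] m
    by (simp add: o_def)
  show "((\<lambda>t. (1 - t\<^sup>2) * - y (- t)) has_real_derivative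
      (real d - 2) * t * - y (- t) - l * w (- t) - h (- t)) (at t within {-1..1})"
    using DERIV_minus[OF DERIV_image_chain[of "\<lambda>t. (1 - t\<^sup>2) * y t" _ uminus t "{-1..1}" "-1"]]
      zonal_solD(4)[OF assms t'] m
    by (fastforce simp: o_def algebra_simps)
qed

section \<open>The equation between the poles, and sup-norm bounds starting from a pole\<close>

lemma zonal_sol_interior:
  assumes "zonal_sol d l h w y" and t: "t \<in> {-1<..<1}"
  shows "(w has_real_derivative y t) (at t)"
    and "(y has_real_derivative (d * t * y t - l * w t - h t) / (1 - t\<^sup>2)) (at t)"
proof -
  have t': "t \<in> {-1..1}" and at: "at t within {-1..1} = at t"
    using t by (auto intro!: at_within_interior)
  show "(w has_real_derivative y t) (at t)"
    using zonal_solD(3)[OF assms(1) t'] at by simp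
  have nz: "1 - s\<^sup>2 \<noteq> 0" if "s \<in> {-1<..<1}" for s :: real
    using that abs_square_less_1[of s] by auto
  have quot: "(u * A - A * v * (- 2 * t)) / (A * A) = (u + 2 * t * v) / A" if "A \<noteq> 0" for A u v :: real
    using that by (simp add: field_simps)
  have E: "((\<lambda>t. (1 - t\<^sup>2) * y t) has_real_derivative (real d - 2) * t * y t - l * w t - h t) (at t)"
    using zonal_solD(4)[OF assms(1) t'] at by simp
  have "((\<lambda>t. (1 - t\<^sup>2) * y t / (1 - t\<^sup>2)) has_real_derivative
     (((real d - 2) * t * y t - l * w t - h t) * (1 - t\<^sup>2) - (1 - t\<^sup>2) * y t * (- 2 * t))
       / ((1 - t\<^sup>2) * (1 - t\<^sup>2))) (at t)"
    by (rule DERIV_divide[OF E]) (use nz[OF t] in \<open>auto intro!: derivative_eq_intros\<close>)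
  also have "(((real d - 2) * t * y t - l * w t - h t) * (1 - t\<^sup>2) - (1 - t\<^sup>2) * y t * (- 2 * t))
       / ((1 - t\<^sup>2) * (1 - t\<^sup>2)) = (d * t * y t - l * w t - h t) / (1 - t\<^sup>2)"
    using quot[OF nz[OF t], of "(real d - 2) * t * y t - l * w t - h t" "y t"]
    by (simp add: algebra_simps)
  finally show "(y has_real_derivative (d * t * y t - l * w t - h t) / (1 - t\<^sup>2)) (at t)"
    by (rule has_field_derivative_transform_within_open[of _ _ _ "{-1<..<1}"])
      (use t nz in auto)
qed

text \<open>Divergence form in the polar angle: up to sign, sin \<theta> ^ d * y (cos \<theta>) is
  the flux sin \<theta> ^ (d - 1) times the \<theta>-derivative of w. It vanishes at both poles,
  which the pole estimate and the orthogonality relation exploit.\<close>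

lemma zonal_sol_flux_deriv:
  assumes "zonal_sol d l h w y" "d \<ge> 1" and th: "0 < \<theta>" "\<theta> < pi"
  shows "((\<lambda>\<theta>. sin \<theta> ^ d * y (cos \<theta>)) has_real_derivative
           sin \<theta> ^ (d - 1) * (l * w (cos \<theta>) + h (cos \<theta>))) (at \<theta>)"
proof -
  have s: "sin \<theta> > 0" using th by (simp add: sin_gt_zero)
  have "(cos \<theta>)\<^sup>2 < 1" using s by (simp add: cos_squared_eq)
  then have ct: "cos \<theta> \<in> {-1<..<1}"
    by (simp add: power2_eq_square abs_square_less_1[unfolded power2_eq_square] abs_less_iff)
  note y = DERIV_chain2[OF zonal_sol_interior(2)[OF assms(1) ct] DERIV_cos]
  have "((\<lambda>\<theta>. sin \<theta> ^ d * y (cos \<theta>)) has_real_derivative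
      (d * sin \<theta> ^ (d - 1) * cos \<theta>) * y (cos \<theta>) +
      ((d * cos \<theta> * y (cos \<theta>) - l * w (cos \<theta>) - h (cos \<theta>)) / (1 - (cos \<theta>)\<^sup>2) * - sin \<theta>) * sin \<theta> ^ d) (at \<theta>)"
    by (rule DERIV_mult[OF _ y]) (auto intro!: derivative_eq_intros)
  moreover have "(d * sin \<theta> ^ (d - 1) * cos \<theta>) * y (cos \<theta>) +
      ((d * cos \<theta> * y (cos \<theta>) - l * w (cos \<theta>) - h (cos \<theta>)) / (1 - (cos \<theta>)\<^sup>2) * - sin \<theta>) * sin \<theta> ^ d
     = sin \<theta> ^ (d - 1) * (l * w (cos \<theta>) + h (cos \<theta>))"
  proof -
    obtain n where d: "d = Suc n" using assms(2) by (cases d) auto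
    have *: "1 - (cos \<theta>)\<^sup>2 = sin \<theta> * sin \<theta>"
      using sin_cos_squared_add[of \<theta>] by (simp add: power2_eq_square)
    show ?thesis using s unfolding d * by (simp add: field_simps)
  qed
  ultimately show ?thesis by simp
qed

text \<open>The comparison function is \<open>sin \<theta> ^ d / (1 + cos \<theta>)\<close>, where \<open>t = cos \<theta>\<close>.\<close>

lemma zonal_sol_deriv_bound:
  assumes sol: "zonal_sol d l h w y" and d: "d \<ge> 1" and t0: "0 \<le> t0" "t0 < 1"
    and G: "\<And>t. t0 \<le> t \<Longrightarrow> t \<le> 1 \<Longrightarrow> \<bar>l * w t + h t\<bar> \<le> G"
  shows "\<bar>y t0\<bar> \<le> 2 * G"
proof -
  define a where "a = arccos t0"
  have a: "0 < a" "a \<le> pi / 2" "cos a = t0"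
    using t0 arccos_lt_bounded[of t0] arccos_le_pi2[of t0] unfolding a_def by auto
  have api: "a < pi" using a pi_gt_zero by linarith
  have cont: "continuous_on {0..a} (\<lambda>\<theta>. y (cos \<theta>))"
    by (rule continuous_on_compose2[OF zonal_solD(1)[OF sol]]) (auto intro!: continuous_intros)
  have cpos: "1 + cos \<theta> > 0" if "\<theta> \<in> {0..a}" for \<theta>
    using that a cos_ge_zero[of \<theta>] by auto
  \<comment> \<open>With c = 1 and c = -1 the two signs of y are treated at once. Since d >= 1, F
    vanishes at the pole \<theta> = 0; it is increasing up to the angle a of height t0, and F c a >=
    0 is the claim.\<close>
  define F where "F c \<theta> = 2 * G * (sin \<theta> ^ d / (1 + cos \<theta>)) + c * (sin \<theta> ^ d * y (cos \<theta>))" for c \<theta>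
  have mono: "F c 0 \<le> F c a"
    if c: "\<bar>c\<bar> = 1" for c
  proof (rule DERIV_nonneg_imp_increasing_open[where f = "F c"])
    show "0 \<le> a" using a by simp
    show "continuous_on {0..a} (F c)"
      unfolding F_def using cont cpos by (intro continuous_intros) (auto simp: less_imp_neq[symmetric] dest: cpos)
  next
    fix \<theta> assume th: "0 < \<theta>" "\<theta> < a"
    have s: "sin \<theta> > 0" using th api by (simp add: sin_gt_zero)
    have cg: "cos \<theta> \<ge> 0" using th a by (intro cos_ge_zero) auto
    have ct: "t0 \<le> cos \<theta>" using a th api cos_monotone_0_pi_le[of \<theta> a] by auto
    have d1: "((\<lambda>\<theta>. sin \<theta> ^ d / (1 + cos \<theta>)) has_real_derivative
       sin \<theta> ^ (d - 1) * (real d * cos \<theta> * (1 + cos \<theta>) + (sin \<theta>)\<^sup>2) / (1 + cos \<theta>)\<^sup>2) (at \<theta>)"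
    proof -
      have "((\<lambda>\<theta>. sin \<theta> ^ d) has_real_derivative d * (cos \<theta> * sin \<theta> ^ (d - 1))) (at \<theta>)"
        using DERIV_power[OF DERIV_sin, where n = d] by simp
      then have "((\<lambda>\<theta>. sin \<theta> ^ d / (1 + cos \<theta>)) has_real_derivative
          (d * (cos \<theta> * sin \<theta> ^ (d - 1)) * (1 + cos \<theta>) - sin \<theta> ^ d * - sin \<theta>)
            / ((1 + cos \<theta>) * (1 + cos \<theta>))) (at \<theta>)"
        by (rule DERIV_divide) (use cg in \<open>auto intro!: derivative_eq_intros\<close>)
      moreover have "sin \<theta> ^ d = sin \<theta> ^ (d - 1) * sin \<theta>"
        using d by (simp add: power_eq_if mult.commute)
      ultimately show ?thesis by (simp add: power2_eq_square algebra_simps)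
    qed
    \<comment> \<open>On the hemisphere cos \<theta> >= 0 the comparison function grows at least at
      the rate sin \<theta> ^ (d - 1) / 2, so 2 G times it outweighs the flux. The numerator is at
      least cos (1 + cos) + (1 - cos)(1 + cos) = 1 + cos.\<close>
    have half: "1/2 \<le> (real d * cos \<theta> * (1 + cos \<theta>) + (sin \<theta>)\<^sup>2) / (1 + cos \<theta>)\<^sup>2"
    proof -
      have "cos \<theta> * (1 + cos \<theta>) \<le> real d * cos \<theta> * (1 + cos \<theta>)"
        using d cg by (intro mult_right_mono) (auto simp: mult_le_cancel_right1)
      moreover have "(sin \<theta>)\<^sup>2 = (1 - cos \<theta>) * (1 + cos \<theta>)"
        by (simp add: sin_squared_eq power2_eq_square algebra_simps)
      ultimately have "1 + cos \<theta> \<le> real d * cos \<theta> * (1 + cos \<theta>) + (sin \<theta>)\<^sup>2"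
        by (simp add: algebra_simps)
      moreover have "(1 + cos \<theta>)\<^sup>2 \<le> 2 * (1 + cos \<theta>)"
        unfolding power2_eq_square using cg cos_le_one[of \<theta>] by (intro mult_right_mono) auto
      ultimately show ?thesis using cg by (simp add: field_simps)
    qed
    have d1': "sin \<theta> ^ (d - 1) / 2 \<le> sin \<theta> ^ (d - 1) * (real d * cos \<theta> * (1 + cos \<theta>) + (sin \<theta>)\<^sup>2) / (1 + cos \<theta>)\<^sup>2"
      using mult_left_mono[OF half, of "sin \<theta> ^ (d - 1)"] s
      by (simp only: times_divide_eq_right mult_1_right zero_le_power less_imp_le)
    have Gb: "\<bar>l * w (cos \<theta>) + h (cos \<theta>)\<bar> \<le> G" using G[OF ct] by simp
    have G0: "0 \<le> G" using Gb by linarith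
    have "c * (l * w (cos \<theta>) + h (cos \<theta>)) \<ge> - G"
      using Gb c by (auto simp: abs_if split: if_splits)
    then have "sin \<theta> ^ (d - 1) * (c * (l * w (cos \<theta>) + h (cos \<theta>))) \<ge> sin \<theta> ^ (d - 1) * (- G)"
      using s by (intro mult_left_mono) auto
    moreover have "2 * G * (sin \<theta> ^ (d - 1) / 2) \<le> 2 * G * (sin \<theta> ^ (d - 1) * (real d * cos \<theta> * (1 + cos \<theta>) + (sin \<theta>)\<^sup>2) / (1 + cos \<theta>)\<^sup>2)"
      using d1' G0 by (intro mult_left_mono) auto
    ultimately have nn: "0 \<le> 2 * G * (sin \<theta> ^ (d - 1) * (real d * cos \<theta> * (1 + cos \<theta>) + (sin \<theta>)\<^sup>2) / (1 + cos \<theta>)\<^sup>2)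
        + c * (sin \<theta> ^ (d - 1) * (l * w (cos \<theta>) + h (cos \<theta>)))"
      by (simp add: algebra_simps)
    show "\<exists>D. (F c has_real_derivative D) (at \<theta>) \<and> 0 \<le> D"
      unfolding F_def[abs_def] using DERIV_add[OF DERIV_cmult[OF d1, of "2*G"]
          DERIV_cmult[OF zonal_sol_flux_deriv[OF sol d th(1)], of c]] th api nn by auto
  qed
  have sa: "sin a > 0" using a api by (simp add: sin_gt_zero)
  have "0 \<le> 2 * G * (sin a ^ d / (1 + t0)) + c * (sin a ^ d * y t0)" if "\<bar>c\<bar> = 1" for c
    using mono[OF that] d a(3) by (simp add: F_def power_0_left)
  from this[of 1] this[of "-1"] have *: "0 \<le> sin a ^ d * (2 * G / (1 + t0) + y t0)" "0 \<le> sin a ^ d * (2 * G / (1 + t0) - y t0)"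
    by (simp_all add: algebra_simps)
  then have "\<bar>y t0\<bar> \<le> 2 * G / (1 + t0)"
    using sa by (simp add: zero_le_mult_iff abs_le_iff) (smt (verit) zero_less_power)
  also have "\<dots> \<le> 2 * G"
    using t0 G[of t0] by (simp add: divide_le_eq mult_le_cancel_left1)
  finally show ?thesis .
qed


text \<open>A Gronwall estimate, with the weight \<open>exp (- k (1 - t))\<close> for \<open>k = 4 l\<close>.\<close>

lemma zonal_sol_half_bound:
  assumes sol: "zonal_sol d l h w y" and d: "d \<ge> 1" and l: "l > 0" and w1: "w 1 = 0"
    and h: "\<And>t. t \<in> {0..1} \<Longrightarrow> \<bar>h t\<bar> \<le> \<eta>" and t: "t \<in> {0..1}"
  shows "\<bar>w t\<bar> \<le> (4 + 1 / l) * exp (4 * l) * \<eta>" "\<bar>y t\<bar> \<le> (4 + 1 / l) * exp (4 * l) * \<eta>"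
proof -
  \<comment> \<open>Integrating the bound for y divides it by k, and this leads to m <= 2 (l m +
    \<eta>) / k. With k = 4 l the term l m is absorbed, leaving l m <= \<eta>.\<close>
  define k where "k = 4 * l"
  have k: "k > 0" using l by (simp add: k_def)
  have sub: "{0..1::real} \<subseteq> {-1..1}" by auto
  note cw = continuous_on_subset[OF zonal_solD(2)[OF sol] sub]
  note cy = continuous_on_subset[OF zonal_solD(1)[OF sol] sub]
  have eta: "0 \<le> \<eta>" using h[of 0] by auto
  obtain t0 where t0: "t0 \<in> {0..1}" and mx: "\<And>s. s \<in> {0..1} \<Longrightarrow> \<bar>w s\<bar> * exp (- k * (1 - s)) \<le> \<bar>w t0\<bar> * exp (- k * (1 - t0))"
    using continuous_attains_sup[of "{0..1}" "\<lambda>s. \<bar>w s\<bar> * exp (- k * (1 - s))"] cw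
    by (force intro!: continuous_intros)
  define m where "m = \<bar>w t0\<bar> * exp (- k * (1 - t0))"
  have m0: "0 \<le> m" by (simp add: m_def)
  have wm: "\<bar>w s\<bar> \<le> m * exp (k * (1 - s))" if "s \<in> {0..1}" for s
  proof -
    have "\<bar>w s\<bar> * exp (- k * (1 - s)) * exp (k * (1 - s)) \<le> m * exp (k * (1 - s))"
      using mx[OF that] by (intro mult_right_mono) (auto simp: m_def)
    then show ?thesis by (simp add: mult.assoc flip: exp_add)
  qed
  have yb: "\<bar>y s\<bar> \<le> 2 * ((l * m + \<eta>) * exp (k * (1 - s)))" if s: "0 \<le> s" "s < 1" for s
  proof (rule zonal_sol_deriv_bound[OF sol d s])
    fix r assume r: "s \<le> r" "r \<le> 1"
    then have r': "r \<in> {0..1}" using s by auto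
    have e: "exp (k * (1 - r)) \<le> exp (k * (1 - s))" "1 \<le> exp (k * (1 - s))"
      using r s k by (auto intro!: mult_left_mono)
    have "\<bar>l * w r + h r\<bar> \<le> l * \<bar>w r\<bar> + \<bar>h r\<bar>"
      using l abs_triangle_ineq[of "l * w r" "h r"] by (simp add: abs_mult)
    also have "\<dots> \<le> l * (m * exp (k * (1 - s))) + \<eta> * exp (k * (1 - s))"
    proof (intro add_mono mult_left_mono)
      show "\<bar>w r\<bar> \<le> m * exp (k * (1 - s))"
        using wm[OF r'] mult_left_mono[OF e(1) m0] by linarith
      show "\<bar>h r\<bar> \<le> \<eta> * exp (k * (1 - s))"
        using h[OF r'] mult_left_mono[OF e(2) eta] by linarith
    qed (use l in auto)
    finally show "\<bar>l * w r + h r\<bar> \<le> (l * m + \<eta>) * exp (k * (1 - s))"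
      by (simp add: algebra_simps)
  qed
  define B where "B = 2 * (l * m + \<eta>) / k"
  have BK: "B * k = 2 * (l * m + \<eta>)" using k by (simp add: B_def)
  \<comment> \<open>The bound for y is integrated from the pole, where w vanishes, down to the point
    of the weighted maximum; c = 1 and c = -1 give the two sides.\<close>
  have V: "c * w t0 \<ge> - B * (exp (k * (1 - t0)) - 1)" if c: "\<bar>c\<bar> = 1" for c
  proof -
    have "B * exp (k * (1 - 1)) + c * w 1 \<le> B * exp (k * (1 - t0)) + c * w t0"
    proof (rule DERIV_nonpos_imp_decreasing_open[where f = "\<lambda>s. B * exp (k * (1 - s)) + c * w s"])
      show "t0 \<le> 1" using t0 by simp
      show "continuous_on {t0..1} (\<lambda>s. B * exp (k * (1 - s)) + c * w s)"
        using t0 by (intro continuous_intros continuous_on_subset[OF cw]) auto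
      fix s assume s: "t0 < s" "s < 1"
      have d1: "((\<lambda>s. B * exp (k * (1 - s))) has_real_derivative B * (exp (k * (1 - s)) * - k)) (at s)"
        by (auto intro!: derivative_eq_intros)
      have d2: "(w has_real_derivative y s) (at s)"
        using s t0 by (intro zonal_sol_interior(1)[OF sol]) auto
      have "c * y s \<le> \<bar>y s\<bar>" using c by (auto simp: abs_if split: if_splits)
      also have "\<dots> \<le> B * k * exp (k * (1 - s))"
        using yb[of s] s t0 unfolding BK by (simp only: mult.assoc atLeastAtMost_iff) simp
      finally have "B * (exp (k * (1 - s)) * - k) + c * y s \<le> 0" by (simp add: algebra_simps)
      then show "\<exists>D. ((\<lambda>s. B * exp (k * (1 - s)) + c * w s) has_real_derivative D) (at s) \<and> D \<le> 0"
        using DERIV_add[OF d1 DERIV_cmult[OF d2, of c]] by blast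
    qed
    then show ?thesis using w1 by (simp add: algebra_simps)
  qed
  have B0: "0 \<le> B" using l m0 eta k by (simp add: B_def)
  have "\<bar>w t0\<bar> \<le> B * (exp (k * (1 - t0)) - 1)"
    using V[of 1] V[of "-1"] by (simp add: abs_le_iff)
  also have "\<dots> \<le> B * exp (k * (1 - t0))" using B0 by (simp add: algebra_simps)
  finally have "m \<le> B * exp (k * (1 - t0)) * exp (- k * (1 - t0))"
    unfolding m_def by (intro mult_right_mono) auto
  then have "m \<le> B" by (simp add: mult.assoc flip: exp_add)
  then have "m * (4 * l) \<le> 2 * (l * m + \<eta>)"
    using l by (simp add: B_def k_def field_simps)
  then have lm: "l * m \<le> \<eta>" by (simp add: algebra_simps)
  then have meta: "m \<le> \<eta> / l" using l by (simp add: field_simps)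
  have ek: "exp (k * (1 - s)) \<le> exp (4 * l)" if "s \<in> {0..1}" for s
    using that l by (simp add: k_def)
  have il: "0 \<le> 1 / l" using l by simp
  have "\<bar>w t\<bar> \<le> m * exp (k * (1 - t))" by (rule wm[OF t])
  also have "\<dots> \<le> (\<eta> / l) * exp (4 * l)"
    using meta ek[OF t] m0 by (intro mult_mono) auto
  also have "\<dots> \<le> (4 + 1 / l) * exp (4 * l) * \<eta>"
    using eta by (simp add: algebra_simps)
  finally show "\<bar>w t\<bar> \<le> (4 + 1 / l) * exp (4 * l) * \<eta>" .
  have ys: "\<bar>y s\<bar> \<le> (4 + 1 / l) * exp (4 * l) * \<eta>" if s: "s \<in> {0..<1}" for s
  proof -
    have "\<bar>y s\<bar> \<le> 2 * ((l * m + \<eta>) * exp (k * (1 - s)))" using yb s by simp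
    also have "\<dots> \<le> 2 * ((2 * \<eta>) * exp (4 * l))"
      using lm ek[of s] s eta by (intro mult_left_mono mult_mono) auto
    also have "\<dots> \<le> (4 + 1 / l) * exp (4 * l) * \<eta>"
      using eta il by (simp add: algebra_simps)
    finally show ?thesis .
  qed
  \<comment> \<open>The comparison argument needs a positive angle, that is t < 1. The pole itself
    is reached by continuity of y.\<close>
  show "\<bar>y t\<bar> \<le> (4 + 1 / l) * exp (4 * l) * \<eta>"
  proof (rule continuous_le_on_closure[of "{0..<1}" "\<lambda>t. \<bar>y t\<bar>"])
    show "continuous_on (closure {0..<1}) (\<lambda>t. \<bar>y t\<bar>)"
      using cy by (auto intro!: continuous_intros)
    show "t \<in> closure {0..<1}" using t by simp
  qed (use ys in auto)
qed

section \<open>Gegenbauer polynomials\<close>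

text \<open>This is \<open>lam N k\<close> expressed by the dimension d = N - 1 of the
  sphere.\<close>

definition sph_eig :: "nat \<Rightarrow> nat \<Rightarrow> real" where
  "sph_eig d k = real k * (real k + real d - 1)"

lemma sph_eig_strict_mono: "d \<ge> 1 \<Longrightarrow> j < k \<Longrightarrow> sph_eig d j < sph_eig d k"
  unfolding sph_eig_def by (intro mult_strict_mono') auto

lemma sph_eig_pos: "d \<ge> 1 \<Longrightarrow> k \<ge> 1 \<Longrightarrow> 0 < sph_eig d k"
  using sph_eig_strict_mono[of d 0 k] by (simp add: sph_eig_def)

text \<open>The operator is triangular on monomials with diagonal entries
  \<open>sph_eig d n - l\<close>. Both the Gegenbauer recursion and the solvability for polynomials
  come from this. For n < 2 the truncated exponent n - 2 is multiplied by 0.\<close>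

lemma zonal_sol_monomial:
  "zonal_sol d l (\<lambda>t. (sph_eig d n - l) * t ^ n - real n * (real n - 1) * t ^ (n - 2))
     (\<lambda>t. t ^ n) (\<lambda>t. real n * t ^ (n - 1))"
  unfolding zonal_sol_def
proof (intro conjI ballI)
  fix t :: real
  show "((\<lambda>t. t ^ n) has_real_derivative real n * t ^ (n - 1)) (at t within {-1..1})"
    by (rule DERIV_power[OF DERIV_ident, THEN DERIV_cong]) simp
  consider "n = 0" | "n = 1" | m where "n = Suc (Suc m)"
    by (metis One_nat_def not0_implies_Suc)
  then show "((\<lambda>t. (1 - t\<^sup>2) * (real n * t ^ (n - 1))) has_real_derivative
      (real d - 2) * t * (real n * t ^ (n - 1)) - l * t ^ n -
      ((sph_eig d n - l) * t ^ n - real n * (real n - 1) * t ^ (n - 2))) (at t within {-1..1})"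
  proof cases
    case 3
    have "((\<lambda>t. t ^ Suc m) has_real_derivative (1 + real m) * t ^ m) (at t within {-1..1})"
      by (rule DERIV_power_Suc[OF DERIV_ident, THEN DERIV_cong]) simp
    then have "((\<lambda>t. (1 - t\<^sup>2) * (real n * t ^ Suc m)) has_real_derivative
        (- 2 * t) * (real n * t ^ Suc m) + (real n * ((1 + real m) * t ^ m)) * (1 - t\<^sup>2)) (at t within {-1..1})"
      by (intro DERIV_mult DERIV_cmult) (auto intro!: derivative_eq_intros)
    then show ?thesis
      using 3 by (simp add: sph_eig_def power2_eq_square algebra_simps)
  qed (auto intro!: derivative_eq_intros simp: sph_eig_def power2_eq_square algebra_simps)
qed (auto intro!: continuous_intros)

text \<open>Power series coefficients at \<open>0\<close> of the Gegenbauer polynomial of degree \<open>k\<close>, scaled so that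
  the polynomial or its derivative is \<open>1\<close> at \<open>0\<close>.\<close>

fun gegen_coeff :: "nat \<Rightarrow> nat \<Rightarrow> nat \<Rightarrow> real" where
  "gegen_coeff d k 0 = (if even k then 1 else 0)"
| "gegen_coeff d k (Suc 0) = (if odd k then 1 else 0)"
| "gegen_coeff d k (Suc (Suc j)) =
     (sph_eig d j - sph_eig d k) / ((real j + 2) * (real j + 1)) * gegen_coeff d k j"

definition gegen :: "nat \<Rightarrow> nat \<Rightarrow> real \<Rightarrow> real" where
  "gegen d k t = (\<Sum>j\<le>k. gegen_coeff d k j * t ^ j)"

definition gegen' :: "nat \<Rightarrow> nat \<Rightarrow> real \<Rightarrow> real" where
  "gegen' d k t = (\<Sum>j\<le>k. gegen_coeff d k j * (real j * t ^ (j - 1)))"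

lemma gegen_coeff_parity: "odd (j + k) \<Longrightarrow> gegen_coeff d k j = 0"
  by (induction d k j rule: gegen_coeff.induct) auto

text \<open>The recursion multiplies by eigenvalue differences that are nonzero below k. The case j
  = k, the leading coefficient, is what solving for t ^ k divides by.\<close>

lemma gegen_coeff_nz: "d \<ge> 1 \<Longrightarrow> even (j + k) \<Longrightarrow> j \<le> k \<Longrightarrow> gegen_coeff d k j \<noteq> 0"
proof (induction d k j rule: gegen_coeff.induct)
  case (3 d k j)
  then have "sph_eig d j \<noteq> sph_eig d k" using sph_eig_strict_mono[of d j k] by simp
  then show ?case using 3 by (simp add: add_nonneg_eq_0_iff)
qed auto

lemma gegen_coeff_rec:
  "gegen_coeff d k (Suc (Suc j)) * ((real j + 2) * (real j + 1)) =
     gegen_coeff d k j * (sph_eig d j - sph_eig d k)"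
  by (simp add: add_nonneg_eq_0_iff)

text \<open>Nontriviality is recorded at the equator t = 0 because the estimates on the two
  hemispheres are glued there.\<close>

lemma gegen_at_0: "gegen d k 0 \<noteq> 0 \<or> gegen' d k 0 \<noteq> 0"
proof (cases "even k")
  case True
  have "gegen d k 0 = gegen_coeff d k 0"
    unfolding gegen_def by (subst sum.atMost_shift) (simp add: power_0_left)
  then show ?thesis using True by simp
next
  case False
  then obtain m where k: "k = Suc m" by (cases k) auto
  have "gegen' d k 0 = gegen_coeff d k (Suc 0)"
    unfolding gegen'_def k by (subst sum.atMost_shift, subst lessThan_Suc_atMost, subst sum.atMost_shift) (simp add: power_0_left)
  then show ?thesis using False by simp
qed

lemma zonal_sol_gegen:
  "zonal_sol d (sph_eig d k) (\<lambda>t. 0) (gegen d k) (gegen' d k)"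
proof -
  let ?a = "gegen_coeff d k"
  have "zonal_sol d (sph_eig d k)
     (\<lambda>t. \<Sum>j\<le>k. ?a j * ((sph_eig d j - sph_eig d k) * t ^ j - real j * (real j - 1) * t ^ (j - 2)))
     (gegen d k) (gegen' d k)"
    unfolding gegen_def[abs_def] gegen'_def[abs_def] by (intro zonal_sol_sum zonal_sol_monomial)
  then show ?thesis
  proof (rule zonal_sol_cong)
    fix t :: real
    have "(\<Sum>j\<le>k. ?a j * ((sph_eig d j - sph_eig d k) * t ^ j))
        = (\<Sum>j\<le>k. ?a (Suc (Suc j)) * ((real j + 2) * (real j + 1)) * t ^ j)"
      by (intro sum.cong refl) (simp only: gegen_coeff_rec mult.assoc)
    also have "\<dots> = (\<Sum>j<Suc k. ?a (Suc (Suc j)) * (real (Suc (Suc j)) * (real (Suc (Suc j)) - 1)) * t ^ (Suc (Suc j) - 2))"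
      unfolding lessThan_Suc_atMost by (intro sum.cong refl) (simp del: gegen_coeff.simps add: algebra_simps)
    \<comment> \<open>The shift adds two initial terms with factor j (j - 1) = 0. Afterwards the
      terms k + 1 and k + 2 are dropped: the first coefficient vanishes by parity, the second by the
      factor \<open>sph_eig d k - sph_eig d k\<close>.\<close>
    also have "\<dots> = (\<Sum>j<Suc (Suc (Suc k)). ?a j * (real j * (real j - 1)) * t ^ (j - 2))"
      by (subst (2) sum.lessThan_Suc_shift, subst (2) sum.lessThan_Suc_shift) simp
    also have "\<dots> = (\<Sum>j\<le>k. ?a j * (real j * (real j - 1)) * t ^ (j - 2))"
      using gegen_coeff_parity[of "Suc k" k d]
      by (simp add: lessThan_Suc_atMost[symmetric] del: gegen_coeff.simps) simp
    finally have eq: "(\<Sum>j\<le>k. ?a j * ((sph_eig d j - sph_eig d k) * t ^ j))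
        = (\<Sum>j\<le>k. ?a j * (real j * (real j - 1)) * t ^ (j - 2))" .
    have "(\<Sum>j\<le>k. ?a j * ((sph_eig d j - sph_eig d k) * t ^ j - real j * (real j - 1) * t ^ (j - 2)))
        = (\<Sum>j\<le>k. ?a j * ((sph_eig d j - sph_eig d k) * t ^ j))
          - (\<Sum>j\<le>k. ?a j * (real j * (real j - 1)) * t ^ (j - 2))"
      unfolding sum_subtractf[symmetric] by (intro sum.cong refl) (simp add: algebra_simps)
    then show "(\<Sum>j\<le>k. ?a j * ((sph_eig d j - sph_eig d k) * t ^ j - real j * (real j - 1) * t ^ (j - 2))) = 0"
      using eq by simp
  qed
qed

section \<open>Inversion modulo the kernel\<close>

lemma continuous_interval_bound:
  fixes f :: "real \<Rightarrow> real"
  assumes "continuous_on {a..b} f"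
  obtains M where "M > 0" "\<And>t. t \<in> {a..b} \<Longrightarrow> \<bar>f t\<bar> \<le> M"
proof -
  have "bounded (f ` {a..b})"
    by (intro compact_imp_bounded compact_continuous_image assms) auto
  then show ?thesis using that by (auto simp: bounded_pos)
qed

lemma continuous_gegen: "continuous_on S (gegen d k)" "continuous_on S (gegen' d k)"
  unfolding gegen_def[abs_def] gegen'_def[abs_def] by (intro continuous_intros)+

text \<open>A homogeneous solution that is 0 at the pole vanishes on the whole hemisphere, by the
  half bound with \<eta> = 0, and so would be trivial at the equator. This permits the normalisation
  w 1 = 0.\<close>

lemma gegen_at_1:
  assumes "d \<ge> 1" "k \<ge> 1"
  shows "gegen d k 1 \<noteq> 0"
proof
  assume "gegen d k 1 = 0"
  then show False
    using zonal_sol_half_bound[OF zonal_sol_gegen assms(1) sph_eig_pos[OF assms], of 0 0]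
      gegen_at_0[of d k] by simp
qed

text \<open>The half bound covers the hemisphere at 1. On the other one it applies to the reflection
  of w minus the multiple c of \<open>gegen\<close> that makes it vanish at its pole. Both bounds
  hold at the equator, where \<open>gegen\<close> or its derivative is nonzero, and so they control
  c.\<close>

lemma zonal_sol_bound:
  assumes d: "d \<ge> 1" and k: "k \<ge> 1"
  shows "\<exists>C>0. \<forall>h w y \<eta> t. zonal_sol d (sph_eig d k) h w y \<longrightarrow> w 1 = 0 \<longrightarrow> (\<forall>t. t \<in> {-1..1} \<longrightarrow> \<bar>h t\<bar> \<le> \<eta>) \<longrightarrow>
      t \<in> {-1..1} \<longrightarrow> \<bar>w t\<bar> \<le> C * \<eta> \<and> \<bar>y t\<bar> \<le> C * \<eta>"
proof -
  let ?l = "sph_eig d k"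
  have l: "?l > 0" by (rule sph_eig_pos[OF d k])
  define A where "A = (4 + 1 / ?l) * exp (4 * ?l)"
  have A: "A > 0" unfolding A_def using l by (intro mult_pos_pos add_pos_pos) auto
  obtain B1 where B1: "B1 > 0" "\<And>t. t \<in> {0..1} \<Longrightarrow> \<bar>gegen d k t\<bar> \<le> B1"
    using continuous_interval_bound[OF continuous_gegen(1)] by metis
  obtain B2 where B2: "B2 > 0" "\<And>t. t \<in> {0..1} \<Longrightarrow> \<bar>gegen' d k t\<bar> \<le> B2"
    using continuous_interval_bound[OF continuous_gegen(2)] by metis
  define q where "q = max \<bar>gegen d k 0\<bar> \<bar>gegen' d k 0\<bar>"
  have q: "q > 0" using gegen_at_0[of d k] by (auto simp: q_def less_max_iff_disj)
  define C where "C = A + 2 * A / q * (B1 + B2)"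
  have CA: "A \<le> C" using A q B1(1) B2(1) by (simp add: C_def)
  have C0: "C > 0" using CA A by simp
  have main: "\<forall>h w y \<eta> t. zonal_sol d ?l h w y \<longrightarrow> w 1 = 0 \<longrightarrow> (\<forall>t. t \<in> {-1..1} \<longrightarrow> \<bar>h t\<bar> \<le> \<eta>) \<longrightarrow>
      t \<in> {-1..1} \<longrightarrow> \<bar>w t\<bar> \<le> C * \<eta> \<and> \<bar>y t\<bar> \<le> C * \<eta>"
  proof (intro allI impI)
    fix h w y \<eta> and t :: real
    assume sol: "zonal_sol d ?l h w y" and w1: "w 1 = 0" and h0: "\<forall>t. t \<in> {-1..1} \<longrightarrow> \<bar>h t\<bar> \<le> \<eta>"
      and t: "t \<in> {-1..1}"
    note h = h0[rule_format]
    have eta: "0 \<le> \<eta>" using h[of 0] by auto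
    have right: "\<bar>w s\<bar> \<le> A * \<eta>" "\<bar>y s\<bar> \<le> A * \<eta>" if "s \<in> {0..1}" for s
      using zonal_sol_half_bound[OF sol d l w1 _ that, of \<eta>] h by (auto simp: A_def)
    define c where "c = w (- 1) / gegen d k 1"
    define w' where "w' s = w (- s) - c * gegen d k s" for s
    define y' where "y' s = - y (- s) - c * gegen' d k s" for s
    have sol': "zonal_sol d ?l (\<lambda>t. h (- t) - c * 0) w' y'"
      unfolding w'_def[abs_def] y'_def[abs_def]
      by (intro zonal_sol_minus zonal_sol_reflect sol zonal_sol_cmult zonal_sol_gegen)
    have "w' 1 = 0" using gegen_at_1[OF d k] by (simp add: w'_def c_def)
    then have left: "\<bar>w' s\<bar> \<le> A * \<eta>" "\<bar>y' s\<bar> \<le> A * \<eta>" if "s \<in> {0..1}" for s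
      using zonal_sol_half_bound[OF sol' d l _ _ that, of \<eta>] h by (auto simp: A_def)
    have "\<bar>c * gegen d k 0\<bar> \<le> 2 * A * \<eta>" "\<bar>c * gegen' d k 0\<bar> \<le> 2 * A * \<eta>"
      using left[of 0] right[of 0] by (auto simp: w'_def y'_def)
    then have "\<bar>c\<bar> * q \<le> 2 * A * \<eta>" by (auto simp: q_def max_def abs_mult)
    then have c: "\<bar>c\<bar> \<le> 2 * A / q * \<eta>" using q by (simp add: field_simps)
    have cB: "\<bar>c * u\<bar> \<le> 2 * A / q * (B1 + B2) * \<eta>" if "\<bar>u\<bar> \<le> B1 \<or> \<bar>u\<bar> \<le> B2" for u
    proof -
      have "\<bar>u\<bar> \<le> B1 + B2" using that B1(1) B2(1) by auto
      then have "\<bar>c\<bar> * \<bar>u\<bar> \<le> 2 * A / q * \<eta> * (B1 + B2)"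
        using c A q eta by (intro mult_mono) auto
      then show ?thesis by (simp add: abs_mult algebra_simps)
    qed
    have Ce: "C * \<eta> = A * \<eta> + 2 * A / q * (B1 + B2) * \<eta>"
      by (simp add: C_def algebra_simps)
    consider "t \<in> {0..1}" | "- t \<in> {0..1}" using t by fastforce
    then show "\<bar>w t\<bar> \<le> C * \<eta> \<and> \<bar>y t\<bar> \<le> C * \<eta>"
    proof cases
      case 1
      have "A * \<eta> \<le> C * \<eta>" by (rule mult_right_mono[OF CA eta])
      then show ?thesis using right[OF 1] by linarith
    next
      case 2
      have "w t = w' (- t) + c * gegen d k (- t)" "y t = - y' (- t) - c * gegen' d k (- t)"
        by (auto simp: w'_def y'_def)
      moreover have "\<bar>c * gegen d k (- t)\<bar> \<le> 2 * A / q * (B1 + B2) * \<eta>"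
        "\<bar>c * gegen' d k (- t)\<bar> \<le> 2 * A / q * (B1 + B2) * \<eta>"
        by (rule cB, use B1(2)[OF 2] B2(2)[OF 2] in simp)+
      ultimately show ?thesis
        using left[OF 2] unfolding Ce by linarith
    qed
  qed
  show ?thesis by (rule exI[of _ C], rule conjI[OF C0 main])
qed

text \<open>Green's identity: F is the weighted Wronskian of the two solutions. Its boundary values
  are 0 because the weight sin \<theta> ^ d vanishes at both poles.\<close>

lemma zonal_sol_orthogonal:
  assumes s1: "zonal_sol d l h w y" and s2: "zonal_sol d l (\<lambda>t. 0) v z" and d: "d \<ge> 1"
  shows "((\<lambda>\<theta>. sin \<theta> ^ (d - 1) * (h (cos \<theta>) * v (cos \<theta>))) has_integral 0) {0..pi}"
proof -
  define F where "F \<theta> = (sin \<theta> ^ d * y (cos \<theta>)) * v (cos \<theta>) - (sin \<theta> ^ d * z (cos \<theta>)) * w (cos \<theta>)" for \<theta>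
  have c: "continuous_on {0..pi} (\<lambda>\<theta>. f (cos \<theta>))" if "continuous_on {-1..1} f" for f :: "real \<Rightarrow> real"
    by (rule continuous_on_compose2[OF that]) (auto intro!: continuous_intros)
  have "((\<lambda>\<theta>. sin \<theta> ^ (d - 1) * (h (cos \<theta>) * v (cos \<theta>))) has_integral F pi - F 0) {0..pi}"
  proof (rule fundamental_theorem_of_calculus_interior)
    show "continuous_on {0..pi} F"
      unfolding F_def using s1 s2 by (intro continuous_intros c zonal_solD(1,2))
    fix \<theta> assume th: "\<theta> \<in> {0<..<pi}"
    have "sin \<theta> > 0" using th by (simp add: sin_gt_zero)
    then have "(cos \<theta>)\<^sup>2 < 1" by (simp add: cos_squared_eq)
    then have ct: "cos \<theta> \<in> {-1<..<1}"
      by (simp add: power2_eq_square abs_square_less_1[unfolded power2_eq_square] abs_less_iff)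
    note dw = DERIV_chain2[OF zonal_sol_interior(1)[OF s1 ct] DERIV_cos]
    note dv = DERIV_chain2[OF zonal_sol_interior(1)[OF s2 ct] DERIV_cos]
    have "(F has_real_derivative
       (sin \<theta> ^ (d - 1) * (l * w (cos \<theta>) + h (cos \<theta>)) * v (cos \<theta>)
         + z (cos \<theta>) * - sin \<theta> * (sin \<theta> ^ d * y (cos \<theta>)))
       - (sin \<theta> ^ (d - 1) * (l * v (cos \<theta>) + 0) * w (cos \<theta>)
         + y (cos \<theta>) * - sin \<theta> * (sin \<theta> ^ d * z (cos \<theta>)))) (at \<theta>)"
      unfolding F_def[abs_def] using th
      by (intro DERIV_diff DERIV_mult zonal_sol_flux_deriv[OF s1 d] zonal_sol_flux_deriv[OF s2 d] dw dv) auto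
    then show "(F has_vector_derivative sin \<theta> ^ (d - 1) * (h (cos \<theta>) * v (cos \<theta>))) (at \<theta>)"
      by (simp add: has_real_derivative_iff_has_vector_derivative[symmetric] algebra_simps)
  qed auto
  then show ?thesis using d by (simp add: F_def power_0_left)
qed

text \<open>The integral is the denominator of the projection coefficient \<beta>. If it were 0,
  \<open>gegen\<close> would vanish between the poles, and with it its derivative at 0, against
  \<open>gegen_at_0\<close>.\<close>

lemma gegen_norm_pos:
  assumes "d \<ge> 1"
  shows "(\<lambda>\<theta>. sin \<theta> ^ (d - 1) * (gegen d k (cos \<theta>) * gegen d k (cos \<theta>))) integrable_on {0..pi}"
    and "integral {0..pi} (\<lambda>\<theta>. sin \<theta> ^ (d - 1) * (gegen d k (cos \<theta>) * gegen d k (cos \<theta>))) > 0"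
proof -
  let ?f = "\<lambda>\<theta>. sin \<theta> ^ (d - 1) * (gegen d k (cos \<theta>) * gegen d k (cos \<theta>))"
  have c: "continuous_on {0..pi} ?f"
    by (intro continuous_intros continuous_on_compose2[OF continuous_gegen(1)[of UNIV]]) auto
  show int: "?f integrable_on {0..pi}" by (rule integrable_continuous_real[OF c])
  have nn: "0 \<le> ?f \<theta>" if "\<theta> \<in> {0..pi}" for \<theta>
    using that by (intro mult_nonneg_nonneg[OF zero_le_power[OF sin_ge_zero] zero_le_square]) auto
  have "integral {0..pi} ?f \<noteq> 0"
  proof
    assume "integral {0..pi} ?f = 0"
    then have hi: "(?f has_integral 0) (cbox 0 pi)"
      using integrable_integral[OF int] by simp
    have ne: "box 0 pi \<noteq> ({} :: real set)" using pi_gt_zero by (simp add: box_eq_empty not_le)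
    have cc: "continuous_on (cbox 0 pi) ?f" using c by simp
    have nn': "0 \<le> ?f \<theta>" if "\<theta> \<in> box 0 pi" for \<theta> using that by (intro nn) auto
    have z: "?f \<theta> = 0" if "\<theta> \<in> {0..pi}" for \<theta>
      using that by (intro has_integral_0_cbox_imp_0[OF cc nn' hi ne]) auto
    have g0: "gegen d k t = 0" if t: "t \<in> {-1<..<1}" for t
    proof -
      have "0 < arccos t" "arccos t < pi" using arccos_lt_bounded[of t] t by auto
      then have "sin (arccos t) > 0" by (simp add: sin_gt_zero)
      moreover have "cos (arccos t) = t" using t by simp
      ultimately show ?thesis
        using z[of "arccos t"] \<open>0 < arccos t\<close> \<open>arccos t < pi\<close> by simp
    qed
    have "(gegen d k has_real_derivative gegen' d k 0) (at 0)"
      by (rule zonal_sol_interior(1)[OF zonal_sol_gegen]) auto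
    then have "((\<lambda>t. 0) has_real_derivative gegen' d k 0) (at 0)"
      by (rule has_field_derivative_transform_within_open[of _ _ _ "{-1<..<1}"]) (use g0 in auto)
    then have "gegen' d k 0 = 0" using DERIV_unique DERIV_const by blast
    then show False using gegen_at_0[of d k] g0[of 0] by auto
  qed
  moreover have "integral {0..pi} ?f \<ge> 0" using nn by (intro integral_nonneg int) auto
  ultimately show "integral {0..pi} ?f > 0" by linarith
qed

text \<open>The normalisation \<open>w 1 = 0\<close> fixes the multiple of the kernel element \<open>gegen d k\<close> in \<open>w\<close>; the
  number \<open>\<beta>\<close> is the coefficient of the projection of \<open>h\<close> onto that element.\<close>

definition resolvent :: "nat \<Rightarrow> nat \<Rightarrow> (real \<Rightarrow> real) \<Rightarrow> real \<Rightarrow> (real \<Rightarrow> real) \<Rightarrow> (real \<Rightarrow> real) \<Rightarrow> bool" where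
  "resolvent d k h \<beta> w y \<longleftrightarrow>
     zonal_sol d (sph_eig d k) (\<lambda>t. h t - \<beta> * gegen d k t) w y \<and> w 1 = 0"

lemma resolvent_diff:
  assumes "resolvent d k h1 \<beta>1 w1 y1" "resolvent d k h2 \<beta>2 w2 y2"
  shows "resolvent d k (\<lambda>t. h1 t - h2 t) (\<beta>1 - \<beta>2) (\<lambda>t. w1 t - w2 t) (\<lambda>t. y1 t - y2 t)"
  using zonal_sol_minus[of d "sph_eig d k" _ w1 y1 _ w2 y2] assms
  unfolding resolvent_def by (fastforce intro: zonal_sol_cong simp: algebra_simps)

text \<open>The bound is demanded of every triple (\<beta>, w, y) and not of a chosen one. Together
  with \<open>resolvent_diff\<close> it therefore also yields uniqueness on [-1,1] and a Lipschitz
  estimate for an arbitrary selection of solutions.\<close>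

definition resolvent_const :: "nat \<Rightarrow> nat \<Rightarrow> real \<Rightarrow> bool" where
  "resolvent_const d k C \<longleftrightarrow> C > 0 \<and>
     (\<forall>h \<beta> w y \<eta>. continuous_on {-1..1} h \<longrightarrow> resolvent d k h \<beta> w y \<longrightarrow>
        (\<forall>t. t \<in> {-1..1} \<longrightarrow> \<bar>h t\<bar> \<le> \<eta>) \<longrightarrow>
        \<bar>\<beta>\<bar> \<le> C * \<eta> \<and> (\<forall>t\<in>{-1..1}. \<bar>w t\<bar> \<le> C * \<eta> \<and> \<bar>y t\<bar> \<le> C * \<eta>))"

lemma resolvent_constD:
  assumes "resolvent_const d k C" "continuous_on {-1..1} h" "resolvent d k h \<beta> w y"
    "\<forall>t. t \<in> {-1..1} \<longrightarrow> \<bar>h t\<bar> \<le> \<eta>"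
  shows "\<bar>\<beta>\<bar> \<le> C * \<eta> \<and> (\<forall>t\<in>{-1..1}. \<bar>w t\<bar> \<le> C * \<eta> \<and> \<bar>y t\<bar> \<le> C * \<eta>)"
  using assms(1)[unfolded resolvent_const_def, THEN conjunct2,
      THEN spec, THEN spec, THEN spec, THEN spec, THEN spec, THEN mp, THEN mp, THEN mp, OF assms(2-4)] .

text \<open>Pairing the equation with \<open>gegen\<close> gives \<beta> I as the weighted integral
  of h times \<open>gegen\<close>, hence a bound for \<beta>. The bounds for w and y are then those
  of \<open>zonal_sol_bound\<close> with right-hand side h - \<beta> \<open>gegen\<close>.\<close>

lemma resolvent_bound:
  assumes d: "d \<ge> 1" and k: "k \<ge> 1"
  shows "\<exists>C. resolvent_const d k C"
proof -
  let ?g = "gegen d k"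
  obtain C1 where C1: "C1 > 0"
    and est0: "\<forall>h w y \<eta> t. zonal_sol d (sph_eig d k) h w y \<longrightarrow> w 1 = 0 \<longrightarrow> (\<forall>t. t \<in> {-1..1} \<longrightarrow> \<bar>h t\<bar> \<le> \<eta>) \<longrightarrow>
      t \<in> {-1..1} \<longrightarrow> \<bar>w t\<bar> \<le> C1 * \<eta> \<and> \<bar>y t\<bar> \<le> C1 * \<eta>"
    using zonal_sol_bound[OF d k] by (elim exE conjE) (rule that)
  note est = est0[rule_format]
  obtain B where B: "B > 0" "\<And>t. t \<in> {-1..1} \<Longrightarrow> \<bar>?g t\<bar> \<le> B"
    using continuous_interval_bound[OF continuous_gegen(1)] by metis
  define I where "I = integral {0..pi} (\<lambda>\<theta>. sin \<theta> ^ (d - 1) * (?g (cos \<theta>) * ?g (cos \<theta>)))"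
  have I: "I > 0" unfolding I_def by (rule gegen_norm_pos[OF d])
  define D where "D = B * pi / I"
  have D: "D > 0" using B(1) I by (simp add: D_def)
  define C where "C = D + C1 * (1 + D * B)"
  have C1C: "C1 * (1 + D * B) \<le> C" "D \<le> C" using C1 D B(1) by (auto simp: C_def)
  have C0: "C > 0" using C1C(2) D by simp
  have main: "\<forall>h \<beta> w y \<eta>. continuous_on {-1..1} h \<longrightarrow> resolvent d k h \<beta> w y \<longrightarrow>
      (\<forall>t. t \<in> {-1..1} \<longrightarrow> \<bar>h t\<bar> \<le> \<eta>) \<longrightarrow>
      \<bar>\<beta>\<bar> \<le> C * \<eta> \<and> (\<forall>t\<in>{-1..1}. \<bar>w t\<bar> \<le> C * \<eta> \<and> \<bar>y t\<bar> \<le> C * \<eta>)"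
  proof (intro allI impI)
    fix h \<beta> w y \<eta>
    assume ch: "continuous_on {-1..1} h" and res: "resolvent d k h \<beta> w y"
      and h0: "\<forall>t. t \<in> {-1..1} \<longrightarrow> \<bar>h t\<bar> \<le> \<eta>"
    note h = h0[rule_format]
    have eta: "0 \<le> \<eta>" using h[of 0] by auto
    have sol: "zonal_sol d (sph_eig d k) (\<lambda>t. h t - \<beta> * ?g t) w y" and w1: "w 1 = 0"
      using res by (auto simp: resolvent_def)
    let ?hg = "\<lambda>\<theta>. sin \<theta> ^ (d - 1) * (h (cos \<theta>) * ?g (cos \<theta>))"
    have chg: "continuous_on {0..pi} ?hg"
      by (intro continuous_intros continuous_on_compose2[OF ch] continuous_on_compose2[OF continuous_gegen(1)[of UNIV]]) auto
    have o: "((\<lambda>\<theta>. sin \<theta> ^ (d - 1) * ((h (cos \<theta>) - \<beta> * ?g (cos \<theta>)) * ?g (cos \<theta>))) has_integral 0) {0..pi}"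
      by (rule zonal_sol_orthogonal[OF sol zonal_sol_gegen d])
    have "((\<lambda>\<theta>. \<beta> * (sin \<theta> ^ (d - 1) * (?g (cos \<theta>) * ?g (cos \<theta>)))) has_integral \<beta> * I) {0..pi}"
      unfolding I_def by (intro has_integral_mult_right integrable_integral gegen_norm_pos(1)[OF d])
    from has_integral_add[OF o this] have hi: "(?hg has_integral \<beta> * I) {0..pi}"
      by (simp add: algebra_simps)
    have "norm (\<beta> * I) \<le> (\<eta> * B) * measure lborel (cbox 0 pi)"
    proof (rule has_integral_bound[of _ ?hg])
      show "0 \<le> \<eta> * B" using eta B(1) by simp
      show "(?hg has_integral \<beta> * I) (cbox 0 pi)" using hi by simp
      fix \<theta> assume "\<theta> \<in> cbox 0 pi"
      then have s: "0 \<le> sin \<theta>" by (auto intro: sin_ge_zero)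
      then have "\<bar>sin \<theta> ^ (d - 1)\<bar> \<le> 1" by (auto intro: power_le_one)
      moreover have "\<bar>h (cos \<theta>) * ?g (cos \<theta>)\<bar> \<le> \<eta> * B"
        unfolding abs_mult using h B eta by (intro mult_mono) auto
      ultimately show "norm (?hg \<theta>) \<le> \<eta> * B"
        using mult_mono[of "\<bar>sin \<theta> ^ (d - 1)\<bar>" 1 "\<bar>h (cos \<theta>) * ?g (cos \<theta>)\<bar>" "\<eta> * B"]
        by (simp add: abs_mult)
    qed
    then have "\<bar>\<beta>\<bar> * I \<le> \<eta> * B * pi" using I by (simp add: abs_mult)
    then have b: "\<bar>\<beta>\<bar> \<le> D * \<eta>" using I by (simp add: D_def field_simps)
    have bC: "\<bar>\<beta>\<bar> \<le> C * \<eta>" using b mult_right_mono[OF C1C(2) eta] by linarith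
    have hb: "\<bar>h t - \<beta> * ?g t\<bar> \<le> (1 + D * B) * \<eta>" if t: "t \<in> {-1..1}" for t
    proof -
      have "\<bar>\<beta> * ?g t\<bar> \<le> D * \<eta> * B"
        unfolding abs_mult using b B(2)[OF t] D eta by (intro mult_mono) auto
      then show ?thesis using h[OF t] by (simp add: algebra_simps abs_le_iff)
    qed
    have CC: "C1 * ((1 + D * B) * \<eta>) \<le> C * \<eta>"
      using mult_right_mono[OF C1C(1) eta] by (simp add: mult.assoc)
    have "\<bar>w t\<bar> \<le> C * \<eta> \<and> \<bar>y t\<bar> \<le> C * \<eta>" if t: "t \<in> {-1..1}" for t
      using est[OF sol w1 hb t] CC by linarith
    then show "\<bar>\<beta>\<bar> \<le> C * \<eta> \<and> (\<forall>t\<in>{-1..1}. \<bar>w t\<bar> \<le> C * \<eta> \<and> \<bar>y t\<bar> \<le> C * \<eta>)"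
      using bC by blast
  qed
  show ?thesis unfolding resolvent_const_def by (rule exI[of _ C], rule conjI[OF C0 main])
qed

section \<open>Solvability modulo the kernel, for polynomials and then for continuous
  functions\<close>

definition solvable_mod :: "nat \<Rightarrow> nat \<Rightarrow> (real \<Rightarrow> real) \<Rightarrow> bool" where
  "solvable_mod d k h \<longleftrightarrow> (\<exists>\<beta> w y. zonal_sol d (sph_eig d k) (\<lambda>t. h t - \<beta> * gegen d k t) w y)"

lemma solvable_mod_cmult: "solvable_mod d k h \<Longrightarrow> solvable_mod d k (\<lambda>t. c * h t)"
  unfolding solvable_mod_def
proof (elim exE)
  fix \<beta> w y assume "zonal_sol d (sph_eig d k) (\<lambda>t. h t - \<beta> * gegen d k t) w y"
  from zonal_sol_cmult[OF this, of c]
  have "zonal_sol d (sph_eig d k) (\<lambda>t. c * h t - (c * \<beta>) * gegen d k t) (\<lambda>t. c * w t) (\<lambda>t. c * y t)"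
    by (simp add: algebra_simps)
  then show "\<exists>\<beta> w y. zonal_sol d (sph_eig d k) (\<lambda>t. c * h t - \<beta> * gegen d k t) w y" by blast
qed

lemma solvable_mod_add: "solvable_mod d k h1 \<Longrightarrow> solvable_mod d k h2 \<Longrightarrow> solvable_mod d k (\<lambda>t. h1 t + h2 t)"
  unfolding solvable_mod_def
proof (elim exE)
  fix \<beta>1 w1 y1 \<beta>2 w2 y2
  assume "zonal_sol d (sph_eig d k) (\<lambda>t. h1 t - \<beta>1 * gegen d k t) w1 y1"
    "zonal_sol d (sph_eig d k) (\<lambda>t. h2 t - \<beta>2 * gegen d k t) w2 y2"
  from zonal_sol_add[OF this]
  have "zonal_sol d (sph_eig d k) (\<lambda>t. (h1 t + h2 t) - (\<beta>1 + \<beta>2) * gegen d k t)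
      (\<lambda>t. w1 t + w2 t) (\<lambda>t. y1 t + y2 t)"
    by (simp add: algebra_simps)
  then show "\<exists>\<beta> w y. zonal_sol d (sph_eig d k) (\<lambda>t. h1 t + h2 t - \<beta> * gegen d k t) w y" by blast
qed

lemma solvable_mod_zonal_sol: "zonal_sol d (sph_eig d k) h w y \<Longrightarrow> solvable_mod d k h"
  unfolding solvable_mod_def by (rule exI[of _ 0]) auto

lemma solvable_mod_gegen: "solvable_mod d k (gegen d k)"
  unfolding solvable_mod_def using zonal_sol_0 by (intro exI[of _ 1]) auto

lemma solvable_mod_sum:
  "finite S \<Longrightarrow> (\<And>i. i \<in> S \<Longrightarrow> solvable_mod d k (h i)) \<Longrightarrow> solvable_mod d k (\<lambda>t. \<Sum>i\<in>S. a i * h i t)"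
proof (induction S rule: finite_induct)
  case empty
  show ?case using solvable_mod_zonal_sol[OF zonal_sol_0] by simp
next
  case (insert x F)
  then show ?case using solvable_mod_add solvable_mod_cmult by simp
qed

text \<open>Induction along the triangular structure. For n different from k the diagonal entry can
  be inverted; for n = k it is zero, but t ^ k is a combination of \<open>gegen d k\<close>, which
  is solvable with w = 0, and of lower monomials.\<close>

lemma solvable_mod_monomial:
  assumes d: "d \<ge> 1"
  shows "solvable_mod d k (\<lambda>t. t ^ n)"
proof (induction n rule: less_induct)
  case (less n)
  let ?g = "gegen_coeff d k"
  show ?case
  proof (cases "n = k")
    case True
    have nz: "?g k \<noteq> 0" using gegen_coeff_nz[OF d, of k k] by simp
    have "solvable_mod d k (\<lambda>t. (1 / ?g k) * (gegen d k t + (- 1) * (\<Sum>j<k. ?g j * t ^ j)))"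
      using less True by (intro solvable_mod_cmult solvable_mod_add solvable_mod_gegen solvable_mod_sum) auto
    moreover have "(1 / ?g k) * (gegen d k t + (- 1) * (\<Sum>j<k. ?g j * t ^ j)) = t ^ n" for t
      using nz True by (simp add: gegen_def lessThan_Suc_atMost[symmetric])
    ultimately show ?thesis by simp
  next
    case False
    then have nz: "sph_eig d n - sph_eig d k \<noteq> 0"
      using sph_eig_strict_mono[OF d, of n k] sph_eig_strict_mono[OF d, of k n] by linarith
    have "solvable_mod d k (\<lambda>t. real n * (real n - 1) * t ^ (n - 2))"
    proof (cases "n < 2")
      case True
      then have z: "real n * (real n - 1) = 0" by (auto simp: less_2_cases_iff)
      show ?thesis unfolding z using solvable_mod_zonal_sol[OF zonal_sol_0] by simp
    next
      case False
      then show ?thesis by (intro solvable_mod_cmult less) auto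
    qed
    from solvable_mod_cmult[OF solvable_mod_add[OF this solvable_mod_zonal_sol[OF zonal_sol_monomial]],
        of "1 / (sph_eig d n - sph_eig d k)" n]
    show ?thesis using nz by simp
  qed
qed

lemma has_real_derivative_uniform_limit:
  fixes f :: "nat \<Rightarrow> real \<Rightarrow> real"
  assumes S: "convex S" and der: "\<And>n x. x \<in> S \<Longrightarrow> (f n has_real_derivative f' n x) (at x within S)"
    and ul: "uniform_limit S f' g' sequentially" and lim: "\<And>x. x \<in> S \<Longrightarrow> (\<lambda>n. f n x) \<longlonglongrightarrow> g x"
    and x: "x \<in> S"
  shows "(g has_real_derivative g' x) (at x within S)"
proof -
  have "\<exists>k. \<forall>x\<in>S. (\<lambda>n. f n x) \<longlonglongrightarrow> k x \<and> (k has_derivative (*) (g' x)) (at x within S)"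
  proof (rule has_derivative_sequence[where f = f and f' = "\<lambda>n x. (*) (f' n x)", OF S _ _ x lim[OF x]])
    show "(f n has_derivative (*) (f' n x)) (at x within S)" if "x \<in> S" for n x
      using der[OF that] by (simp add: has_field_derivative_def)
    fix e :: real assume e: "e > 0"
    from uniform_limitD[OF ul e]
    show "\<forall>\<^sub>F n in sequentially. \<forall>x\<in>S. \<forall>h. norm (f' n x * h - g' x * h) \<le> e * norm h"
    proof eventually_elim
      case (elim n)
      show ?case
      proof (intro ballI allI)
        fix x h assume "x \<in> S"
        then have "\<bar>f' n x - g' x\<bar> \<le> e" using elim by (simp add: dist_real_def less_imp_le)
        then show "norm (f' n x * h - g' x * h) \<le> e * norm h"
          by (simp add: left_diff_distrib[symmetric] abs_mult mult_right_mono)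
      qed
    qed
  qed
  then obtain k where k: "\<And>x. x \<in> S \<Longrightarrow> (\<lambda>n. f n x) \<longlonglongrightarrow> k x"
    and dk: "\<And>x. x \<in> S \<Longrightarrow> (k has_derivative (*) (g' x)) (at x within S)" by blast
  have "g z = k z" if "z \<in> S" for z using LIMSEQ_unique[OF lim[OF that] k[OF that]] .
  then show ?thesis
    unfolding has_field_derivative_def by (rule has_derivative_transform[OF x _ dk[OF x]])
qed

lemma resolvent_exists:
  assumes d: "d \<ge> 1" and k: "k \<ge> 1" and ch: "continuous_on {-1..1} h"
  shows "\<exists>\<beta> w y. resolvent d k h \<beta> w y"
proof -
  obtain C where CC: "resolvent_const d k C" using resolvent_bound[OF d k] by (rule exE)
  note est = resolvent_constD[OF CC]
  have C: "C > 0" using CC by (simp add: resolvent_const_def)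
  have "\<forall>n. \<exists>g. real_polynomial_function g \<and> (\<forall>t\<in>{-1..1}. \<bar>h t - g t\<bar> < 1 / real (Suc n))"
  proof
    fix n
    have pos: "0 < 1 / real (Suc n)" by simp
    show "\<exists>g. real_polynomial_function g \<and> (\<forall>t\<in>{-1..1}. \<bar>h t - g t\<bar> < 1 / real (Suc n))"
      by (rule Stone_Weierstrass_real_polynomial_function[OF compact_Icc ch pos]) blast
  qed
  from choice[OF this] obtain g
    where gg: "\<forall>n. real_polynomial_function (g n) \<and> (\<forall>t\<in>{-1..1}. \<bar>h t - g n t\<bar> < 1 / real (Suc n))"
    by (rule exE)
  have rg: "real_polynomial_function (g n)" for n using gg by blast
  have g: "\<bar>h t - g n t\<bar> < 1 / real (Suc n)" if "t \<in> {-1..1}" for n t using gg that by blast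
  have "\<exists>\<beta> w y. resolvent d k (g n) \<beta> w y" for n
  proof -
    obtain a N where "g n = (\<lambda>x. \<Sum>i\<le>N. a i * x ^ i)"
      using rg[of n] real_polynomial_function_iff_sum by metis
    then have "solvable_mod d k (g n)"
      using solvable_mod_sum[of "{..N}" d k "\<lambda>i t. t ^ i" a] solvable_mod_monomial[OF d] by simp
    then obtain \<beta> w y where s: "zonal_sol d (sph_eig d k) (\<lambda>t. g n t - \<beta> * gegen d k t) w y"
      unfolding solvable_mod_def by blast
    \<comment> \<open>Solutions built from monomials need not vanish at 1. Subtracting this multiple
      of the kernel element restores the normalisation.\<close>
    define c where "c = w 1 / gegen d k 1"
    have "zonal_sol d (sph_eig d k) (\<lambda>t. g n t - \<beta> * gegen d k t)
        (\<lambda>t. w t - c * gegen d k t) (\<lambda>t. y t - c * gegen' d k t)"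
      using zonal_sol_minus[OF s zonal_sol_cmult[OF zonal_sol_gegen, where c = c]] by simp
    then have "resolvent d k (g n) \<beta> (\<lambda>t. w t - c * gegen d k t) (\<lambda>t. y t - c * gegen' d k t)"
      using gegen_at_1[OF d k] by (simp add: resolvent_def c_def)
    then show ?thesis by blast
  qed
  then obtain \<beta> w y where r: "\<And>n. resolvent d k (g n) (\<beta> n) (w n) (y n)" by metis
  have cg: "continuous_on {-1..1} (g n)" for n
    using rg[of n] by (simp add: continuous_on_polymonial_function real_polynomial_function_eq)
  \<comment> \<open>The a priori bound is applied to the difference of two resolvents; 2 / (N + 1)
    collects the errors of the two polynomial approximations.\<close>
  have diff: "\<bar>\<beta> m - \<beta> n\<bar> \<le> C * (2 / real (Suc N)) \<and>
     (\<forall>t\<in>{-1..1}. \<bar>w m t - w n t\<bar> \<le> C * (2 / real (Suc N)) \<and> \<bar>y m t - y n t\<bar> \<le> C * (2 / real (Suc N)))"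
    if mn: "m \<ge> N" "n \<ge> N" for m n N
  proof (rule est[OF _ resolvent_diff[OF r r]], intro continuous_intros cg, intro allI impI)
    fix t :: real assume t: "t \<in> {-1..1}"
    have "1 / real (Suc m) \<le> 1 / real (Suc N)" "1 / real (Suc n) \<le> 1 / real (Suc N)"
      using mn by (auto intro!: divide_left_mono)
    moreover have "2 / real (Suc N) = 1 / real (Suc N) + 1 / real (Suc N)" by simp
    ultimately show "\<bar>g m t - g n t\<bar> \<le> 2 / real (Suc N)"
      using g[OF t, of m] g[OF t, of n] by linarith
  qed
  have small: "\<exists>N. C * (2 / real (Suc N)) < e" if "e > 0" for e
  proof -
    have "0 < e / (2 * C)" using that C by simp
    from reals_Archimedean[OF this] obtain N where "inverse (real (Suc N)) < e / (2 * C)" by blast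
    then have "C * (2 / real (Suc N)) < e" using C by (simp add: field_simps)
    then show ?thesis by blast
  qed
  have "Cauchy \<beta>"
  proof (rule metric_CauchyI)
    fix e :: real assume "e > 0"
    then obtain N where "C * (2 / real (Suc N)) < e" using small by blast
    then have "dist (\<beta> m) (\<beta> n) < e" if "m \<ge> N" "n \<ge> N" for m n
      using diff[OF that] unfolding dist_real_def by linarith
    then show "\<exists>M. \<forall>m\<ge>M. \<forall>n\<ge>M. dist (\<beta> m) (\<beta> n) < e" by blast
  qed
  then obtain b where b: "\<beta> \<longlonglongrightarrow> b" using real_Cauchy_convergent convergent_def by blast
  have unif: "\<exists>l. uniform_limit {-1..1} f l sequentially"
    if f: "\<And>m n N t. m \<ge> N \<Longrightarrow> n \<ge> N \<Longrightarrow> t \<in> {-1..1} \<Longrightarrow> \<bar>f m t - f n t\<bar> \<le> C * (2 / real (Suc N))"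
    for f :: "nat \<Rightarrow> real \<Rightarrow> real"
  proof -
    have "uniformly_Cauchy_on {-1..1} f"
      unfolding uniformly_Cauchy_on_def
    proof (intro allI impI)
      fix e :: real assume "e > 0"
      then obtain N where "C * (2 / real (Suc N)) < e" using small by blast
      then have "dist (f m x) (f n x) < e" if "x \<in> {-1..1}" "m \<ge> N" "n \<ge> N" for m n x
        using f[OF that(2,3,1)] unfolding dist_real_def by linarith
      then show "\<exists>M. \<forall>x\<in>{-1..1}. \<forall>m\<ge>M. \<forall>n\<ge>M. dist (f m x) (f n x) < e" by blast
    qed
    then show ?thesis
      using Cauchy_uniformly_convergent uniformly_convergent_on_def by blast
  qed
  obtain W where W: "uniform_limit {-1..1} w W sequentially"
    using unif[of w, OF diff[THEN conjunct2, THEN bspec, THEN conjunct1]] by blast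
  obtain Y where Y: "uniform_limit {-1..1} y Y sequentially"
    using unif[of y, OF diff[THEN conjunct2, THEN bspec, THEN conjunct2]] by blast
  have sol: "zonal_sol d (sph_eig d k) (\<lambda>t. g n t - \<beta> n * gegen d k t) (w n) (y n)" for n
    using r by (simp add: resolvent_def)
  have cY: "continuous_on {-1..1} Y"
    using zonal_solD(1)[OF sol] by (intro uniform_limit_theorem[OF _ Y]) auto
  have cW: "continuous_on {-1..1} W"
    using zonal_solD(2)[OF sol] by (intro uniform_limit_theorem[OF _ W]) auto
  have Wt: "(\<lambda>n. w n t) \<longlonglongrightarrow> W t" and Yt: "(\<lambda>n. y n t) \<longlonglongrightarrow> Y t" if "t \<in> {-1..1}" for t
    using tendsto_uniform_limitI[OF W that] tendsto_uniform_limitI[OF Y that] by auto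
  have bdd: "bounded (f ` {-1..1})" if "continuous_on {-1..1} f" for f :: "real \<Rightarrow> real"
    by (intro compact_imp_bounded compact_continuous_image that) auto
  have G: "uniform_limit {-1..1} g h sequentially"
  proof (rule uniform_limitI)
    fix e :: real assume "e > 0"
    then have "\<forall>\<^sub>F n in sequentially. 1 / real (Suc n) < e"
      using order_tendstoD(2)[OF lim_inverse_n'[THEN LIMSEQ_Suc]] by simp
    then show "\<forall>\<^sub>F n in sequentially. \<forall>x\<in>{-1..1}. dist (g n x) (h x) < e"
    proof eventually_elim
      case (elim n)
      show ?case
      proof
        fix x :: real assume "x \<in> {-1..1}"
        then show "dist (g n x) (h x) < e" using g[of x n] elim unfolding dist_real_def by linarith
      qed
    qed
  qed
  have bu: "uniform_limit {-1..1} (\<lambda>n t. \<beta> n) (\<lambda>t. b) sequentially"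
    using b by (auto intro!: uniform_limitI dest: tendstoD)
  have 1: "uniform_limit {-1..1} (\<lambda>n t. (real d - 2) * t * y n t) (\<lambda>t. (real d - 2) * t * Y t) sequentially"
    using uniform_lim_mult[OF uniform_limit_const[where c = "\<lambda>t. (real d - 2) * t"] Y] bdd cY
    by (simp add: continuous_intros)
  have 2: "uniform_limit {-1..1} (\<lambda>n t. sph_eig d k * w n t) (\<lambda>t. sph_eig d k * W t) sequentially"
    using uniform_lim_mult[OF uniform_limit_const[where c = "\<lambda>t. sph_eig d k"] W] bdd cW
    by (simp add: continuous_intros)
  have 3: "uniform_limit {-1..1} (\<lambda>n t. \<beta> n * gegen d k t) (\<lambda>t. b * gegen d k t) sequentially"
    using uniform_lim_mult[OF bu uniform_limit_const[where c = "gegen d k"]] bdd continuous_gegen(1)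
    by (simp add: continuous_intros)
  note derY = uniform_limit_minus[OF uniform_limit_minus[OF 1 2] uniform_limit_minus[OF G 3]]
  have "zonal_sol d (sph_eig d k) (\<lambda>t. h t - b * gegen d k t) W Y"
    unfolding zonal_sol_def
  proof (intro conjI ballI cY)
    fix t :: real assume t: "t \<in> {-1..1}"
    show "(W has_real_derivative Y t) (at t within {-1..1})"
      by (rule has_real_derivative_uniform_limit[OF convex_real_interval(5) _ Y _ t, of w])
        (auto intro: zonal_solD(3)[OF sol] Wt)
    show "((\<lambda>t. (1 - t\<^sup>2) * Y t) has_real_derivative
       (real d - 2) * t * Y t - sph_eig d k * W t - (h t - b * gegen d k t)) (at t within {-1..1})"
      by (rule has_real_derivative_uniform_limit[OF convex_real_interval(5) _ derY _ t, of "\<lambda>n t. (1 - t\<^sup>2) * y n t"])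
        (auto intro!: zonal_solD(4)[OF sol] tendsto_intros Yt)
  qed
  moreover have "W 1 = 0"
    using Wt[of 1] r by (simp add: resolvent_def LIMSEQ_const_iff)
  ultimately show ?thesis unfolding resolvent_def by blast
qed

section \<open>Lyapunov-Schmidt reduction\<close>

text \<open>A constant kernel element would have zero derivative, and the equation at 0 with
  positive eigenvalue would make it 0. The gap between two of its values is what keeps the
  bifurcating solutions nonconstant.\<close>

lemma gegen_not_constant:
  assumes d: "d \<ge> 1" and k: "k \<ge> 1"
  shows "\<not> gegen d k constant_on {-1..1}"
proof
  assume "gegen d k constant_on {-1..1}"
  then obtain e where e: "\<forall>t\<in>{-1..1}. gegen d k t = e" unfolding constant_on_def by blast
  have g'0: "gegen' d k t = 0" if t: "t \<in> {-1<..<1}" for t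
  proof -
    have "((\<lambda>t. e) has_real_derivative gegen' d k t) (at t)"
      by (rule has_field_derivative_transform_within_open[OF zonal_sol_interior(1)[OF zonal_sol_gegen t], of "{-1<..<1}"])
        (use t e in auto)
    from DERIV_unique[OF this DERIV_const] show ?thesis .
  qed
  have "(gegen' d k has_real_derivative (real d * 0 * gegen' d k 0 - sph_eig d k * gegen d k 0 - 0) / (1 - 0\<^sup>2)) (at 0)"
    by (rule zonal_sol_interior(2)[OF zonal_sol_gegen]) auto
  then have "((\<lambda>t. 0) has_real_derivative (real d * 0 * gegen' d k 0 - sph_eig d k * gegen d k 0 - 0) / (1 - 0\<^sup>2)) (at 0)"
    by (rule has_field_derivative_transform_within_open[of "gegen' d k" _ _ "{-1<..<1}"]) (simp_all add: g'0)
  from DERIV_unique[OF this DERIV_const] have "sph_eig d k * gegen d k 0 = 0" by simp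
  then show False using gegen_at_0[of d k] g'0[of 0] sph_eig_pos[OF d k] by auto
qed

text \<open>The first estimate carries the factor s and supplies the contraction for small s. The
  second makes the fixed point Lipschitz in s. Both are restricted to the box in which the iteration
  moves.\<close>

definition s_lipschitz :: "real \<Rightarrow> real \<Rightarrow> real \<Rightarrow> (real \<Rightarrow> real \<Rightarrow> real \<Rightarrow> real \<Rightarrow> real \<Rightarrow> real) \<Rightarrow> bool" where
  "s_lipschitz R s1 K N \<longleftrightarrow>
     (\<forall>s \<zeta> \<zeta>' t z z' v v'. s \<in> {0..s1} \<longrightarrow> \<bar>\<zeta>\<bar> \<le> 1 \<longrightarrow> \<bar>\<zeta>'\<bar> \<le> 1 \<longrightarrow> t \<in> {-1..1} \<longrightarrow>
        \<bar>z\<bar> \<le> R \<longrightarrow> \<bar>z'\<bar> \<le> R \<longrightarrow> \<bar>v\<bar> \<le> R \<longrightarrow> \<bar>v'\<bar> \<le> R \<longrightarrow>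
        \<bar>N s \<zeta> t z v - N s \<zeta>' t z' v'\<bar> \<le> K * s * (\<bar>\<zeta> - \<zeta>'\<bar> + \<bar>z - z'\<bar> + \<bar>v - v'\<bar>)) \<and>
     (\<forall>s s' \<zeta> t z v. s \<in> {0..s1} \<longrightarrow> s' \<in> {0..s1} \<longrightarrow> \<bar>\<zeta>\<bar> \<le> 1 \<longrightarrow> t \<in> {-1..1} \<longrightarrow>
        \<bar>z\<bar> \<le> R \<longrightarrow> \<bar>v\<bar> \<le> R \<longrightarrow> \<bar>N s \<zeta> t z v - N s' \<zeta> t z v\<bar> \<le> K * \<bar>s - s'\<bar>)"

lemma s_lipschitzD:
  assumes "s_lipschitz R s1 K N"
  shows "s \<in> {0..s1} \<Longrightarrow> \<bar>\<zeta>\<bar> \<le> 1 \<Longrightarrow> \<bar>\<zeta>'\<bar> \<le> 1 \<Longrightarrow> t \<in> {-1..1} \<Longrightarrow>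
       \<bar>z\<bar> \<le> R \<Longrightarrow> \<bar>z'\<bar> \<le> R \<Longrightarrow> \<bar>v\<bar> \<le> R \<Longrightarrow> \<bar>v'\<bar> \<le> R \<Longrightarrow>
       \<bar>N s \<zeta> t z v - N s \<zeta>' t z' v'\<bar> \<le> K * s * (\<bar>\<zeta> - \<zeta>'\<bar> + \<bar>z - z'\<bar> + \<bar>v - v'\<bar>)"
    and "s \<in> {0..s1} \<Longrightarrow> s' \<in> {0..s1} \<Longrightarrow> \<bar>\<zeta>\<bar> \<le> 1 \<Longrightarrow> t \<in> {-1..1} \<Longrightarrow>
       \<bar>z\<bar> \<le> R \<Longrightarrow> \<bar>v\<bar> \<le> R \<Longrightarrow> \<bar>N s \<zeta> t z v - N s' \<zeta> t z v\<bar> \<le> K * \<bar>s - s'\<bar>"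
  using assms unfolding s_lipschitz_def by blast+

text \<open>Here z is the profile after division by the amplitude s, which is why it is nonconstant
  at s = 0 as well.\<close>

definition solution_branch :: "nat \<Rightarrow> nat \<Rightarrow> real \<Rightarrow> (real \<Rightarrow> real \<Rightarrow> real \<Rightarrow> real \<Rightarrow> real \<Rightarrow> real) \<Rightarrow>
    real \<Rightarrow> real \<Rightarrow> (real \<Rightarrow> real) \<Rightarrow> (real \<Rightarrow> real \<Rightarrow> real) \<Rightarrow> (real \<Rightarrow> real \<Rightarrow> real) \<Rightarrow> bool" where
  "solution_branch d k R N \<epsilon> L \<zeta> z v \<longleftrightarrow> 0 < \<epsilon> \<and> \<zeta> 0 = 0 \<and>
     (\<forall>s\<in>{0..\<epsilon>}. zonal_sol d (sph_eig d k) (\<lambda>t. \<zeta> s * z s t + N s (\<zeta> s) t (z s t) (v s t)) (z s) (v s) \<and>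
        \<bar>\<zeta> s\<bar> \<le> 1 \<and> (\<forall>t\<in>{-1..1}. \<bar>z s t\<bar> \<le> R \<and> \<bar>v s t\<bar> \<le> R) \<and> \<not> z s constant_on {-1..1}) \<and>
     (\<forall>s\<in>{0..\<epsilon>}. \<forall>s'\<in>{0..\<epsilon>}. \<bar>\<zeta> s - \<zeta> s'\<bar> \<le> L * \<bar>s - s'\<bar> \<and>
        (\<forall>t\<in>{-1..1}. \<bar>z s t - z s' t\<bar> \<le> L * \<bar>s - s'\<bar> \<and> \<bar>v s t - v s' t\<bar> \<le> L * \<bar>s - s'\<bar>))"

text \<open>The unknown is the right-hand side g. For z = \<open>gegen\<close> + W g and \<zeta> = -
  \<beta> g the product \<zeta> z contains - \<beta> g times \<open>gegen\<close>, exactly the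
  correction that the resolvent makes. The equation thus holds as soon as g = - \<beta> g * W g + N.
  The first summand is quadratic in g, the second of order s, and the derivative of z in N is
  harmless because Y g is bounded by the norm of g.\<close>

lemma lyapunov_schmidt:
  fixes N :: "real \<Rightarrow> real \<Rightarrow> real \<Rightarrow> real \<Rightarrow> real \<Rightarrow> real"
  assumes d: "d \<ge> 1" and k: "k \<ge> 1"
    and R: "\<And>t. t \<in> {-1..1} \<Longrightarrow> \<bar>gegen d k t\<bar> + 1 \<le> R" "\<And>t. t \<in> {-1..1} \<Longrightarrow> \<bar>gegen' d k t\<bar> + 1 \<le> R"
    and s1: "s1 > 0" and K: "K > 0"
    and NL: "s_lipschitz R s1 K N"
    and zero: "\<And>\<zeta> t z v. N 0 \<zeta> t z v = 0"
    and cont: "\<And>s \<zeta> z v. s \<in> {0..s1} \<Longrightarrow> \<bar>\<zeta>\<bar> \<le> 1 \<Longrightarrow> continuous_on {-1..1} z \<Longrightarrow> continuous_on {-1..1} v \<Longrightarrow>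
       (\<And>t. t \<in> {-1..1} \<Longrightarrow> \<bar>z t\<bar> \<le> R \<and> \<bar>v t\<bar> \<le> R) \<Longrightarrow> continuous_on {-1..1} (\<lambda>t. N s \<zeta> t (z t) (v t))"
  shows "\<exists>\<epsilon> L \<zeta> z v. \<epsilon> \<le> s1 \<and> solution_branch d k R N \<epsilon> L \<zeta> z v"
proof -
  note lip = s_lipschitzD(1)[OF NL] and slip = s_lipschitzD(2)[OF NL]
  let ?\<phi> = "gegen d k" and ?\<phi>' = "gegen' d k" and ?I = "{-1..1::real}"
  obtain C where CC: "resolvent_const d k C" using resolvent_bound[OF d k] by (rule exE)
  note est = resolvent_constD[OF CC]
  have C: "C > 0" using CC by (simp add: resolvent_const_def)
  have "\<forall>g :: real \<Rightarrow>\<^sub>C real. \<exists>r. resolvent d k (apply_bcontfun g) (fst r) (fst (snd r)) (snd (snd r))"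
  proof
    fix g :: "real \<Rightarrow>\<^sub>C real"
    obtain \<beta> w y where "resolvent d k (apply_bcontfun g) \<beta> w y"
      using resolvent_exists[OF d k continuous_on_apply_bcontfun] by blast
    then show "\<exists>r. resolvent d k (apply_bcontfun g) (fst r) (fst (snd r)) (snd (snd r))"
      by (intro exI[of _ "(\<beta>, w, y)"]) simp
  qed
  from choice[OF this] obtain r where r0:
    "\<forall>g :: real \<Rightarrow>\<^sub>C real. resolvent d k (apply_bcontfun g) (fst (r g)) (fst (snd (r g))) (snd (snd (r g)))"
    by (rule exE)
  define \<beta> where "\<beta> g = fst (r g)" for g
  define W where "W g = fst (snd (r g))" for g
  define Y where "Y g = snd (snd (r g))" for g
  have res: "resolvent d k (apply_bcontfun g) (\<beta> g) (W g) (Y g)" for g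
    using r0 by (simp add: \<beta>_def W_def Y_def)
  have sol: "zonal_sol d (sph_eig d k) (\<lambda>t. apply_bcontfun g t - \<beta> g * ?\<phi> t) (W g) (Y g)" for g
    using res[of g] by (simp add: resolvent_def)
  have bnd: "\<bar>\<beta> g\<bar> \<le> C * norm g \<and> (\<forall>t\<in>?I. \<bar>W g t\<bar> \<le> C * norm g \<and> \<bar>Y g t\<bar> \<le> C * norm g)" for g
  proof (rule est[OF continuous_on_apply_bcontfun res[of g]], intro allI impI)
    fix t show "\<bar>g t\<bar> \<le> norm g" using norm_bounded[where f = g] by simp
  qed
  have dif: "\<bar>\<beta> g - \<beta> g'\<bar> \<le> C * dist g g' \<and>
     (\<forall>t\<in>?I. \<bar>W g t - W g' t\<bar> \<le> C * dist g g' \<and> \<bar>Y g t - Y g' t\<bar> \<le> C * dist g g')" for g g'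
  proof (rule est[OF _ resolvent_diff[OF res[of g] res[of g']]])
    show "continuous_on ?I (\<lambda>t. g t - g' t)" by (intro continuous_intros) auto
    show "\<forall>t. t \<in> ?I \<longrightarrow> \<bar>g t - g' t\<bar> \<le> dist g g'"
      using dist_bounded[of g _ g'] by (simp add: dist_real_def)
  qed
  have difW: "\<bar>W g t - W g' t\<bar> \<le> C * dist g g'" and difY: "\<bar>Y g t - Y g' t\<bar> \<le> C * dist g g'"
    if "t \<in> ?I" for g g' t
    using dif[of g g'] that by blast+
  note dif\<beta> = conjunct1[OF dif]
  obtain t1 t2 where t12: "t1 \<in> ?I" "t2 \<in> ?I" "?\<phi> t1 \<noteq> ?\<phi> t2"
    using gegen_not_constant[OF d k] unfolding constant_on_def by blast
  define \<eta> where "\<eta> = \<bar>?\<phi> t1 - ?\<phi> t2\<bar>"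
  have eta: "\<eta> > 0" using t12 by (simp add: \<eta>_def)
  \<comment> \<open>The first bound makes the quadratic term at most \<delta>/8 with Lipschitz
    constant at most 1/4. The second keeps \<bar>\<zeta>\<bar> <= 1 and z, v within R, which leaves
    a margin of 1 around the kernel element. The third keeps z t1 and z t2 apart.\<close>
  define \<delta> where "\<delta> = min (1 / (8 * C\<^sup>2)) (min (1 / C) (\<eta> / (4 * C)))"
  have dpos: "\<delta> > 0" using C eta by (simp add: \<delta>_def)
  have "\<delta> \<le> 1 / (8 * C\<^sup>2)" "\<delta> \<le> 1 / C" "\<delta> \<le> \<eta> / (4 * C)" by (auto simp: \<delta>_def)
  then have dl: "8 * C\<^sup>2 * \<delta> \<le> 1" "C * \<delta> \<le> 1" "4 * (C * \<delta>) \<le> \<eta>"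
    using C by (auto simp: field_simps)
  \<comment> \<open>The nonlinearity sees three differences, each at most C times the distance, so
    12 K C \<epsilon> <= 1 gives it Lipschitz constant 1/4. The last bound keeps its size below
    \<delta>/2.\<close>
  define \<epsilon> where "\<epsilon> = min s1 (min (1 / (12 * K * C)) (\<delta> / (2 * K)))"
  have epos: "\<epsilon> > 0" using C K dpos s1 by (simp add: \<epsilon>_def)
  have "\<epsilon> \<le> s1" "\<epsilon> \<le> 1 / (12 * K * C)" "\<epsilon> \<le> \<delta> / (2 * K)" by (auto simp: \<epsilon>_def)
  then have el: "\<epsilon> \<le> s1" "12 * K * C * \<epsilon> \<le> 1" "2 * (K * \<epsilon>) \<le> \<delta>"
    using C K by (auto simp: field_simps)
  define B where "B = cball (0 :: real \<Rightarrow>\<^sub>C real) \<delta>"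
  have nB: "g \<in> B \<longleftrightarrow> norm g \<le> \<delta>" for g by (simp add: B_def dist_norm)
  have bB: "\<bar>\<beta> g\<bar> \<le> C * \<delta>" "t \<in> ?I \<Longrightarrow> \<bar>W g t\<bar> \<le> C * \<delta>" "t \<in> ?I \<Longrightarrow> \<bar>Y g t\<bar> \<le> C * \<delta>" if "g \<in> B" for g t
  proof -
    have "C * norm g \<le> C * \<delta>" using that C by (simp add: nB)
    moreover have "\<bar>\<beta> g\<bar> \<le> C * norm g" using bnd[of g] by blast
    moreover have "\<bar>W g t\<bar> \<le> C * norm g \<and> \<bar>Y g t\<bar> \<le> C * norm g" if "t \<in> ?I"
      using bnd[of g] that by blast
    ultimately show "\<bar>\<beta> g\<bar> \<le> C * \<delta>" "t \<in> ?I \<Longrightarrow> \<bar>W g t\<bar> \<le> C * \<delta>" "t \<in> ?I \<Longrightarrow> \<bar>Y g t\<bar> \<le> C * \<delta>"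
      by (meson order_trans)+
  qed
  define z where "z g t = ?\<phi> t + W g t" for g t
  define v where "v g t = ?\<phi>' t + Y g t" for g t
  have zv: "\<bar>z g t\<bar> \<le> R" "\<bar>v g t\<bar> \<le> R" if "g \<in> B" "t \<in> ?I" for g t
    using bB(2,3)[OF that] R[OF that(2)] dl(2) unfolding z_def v_def by linarith+
  have b1: "\<bar>- \<beta> g\<bar> \<le> 1" if "g \<in> B" for g using bB(1)[OF that] dl(2) by simp
  have czv: "continuous_on ?I (z g)" "continuous_on ?I (v g)" for g
    unfolding z_def[abs_def] v_def[abs_def]
    by (intro continuous_intros continuous_gegen zonal_solD(1,2)[OF sol])+
  define f where "f s g t = - \<beta> g * W g t + N s (- \<beta> g) t (z g t) (v g t)" for s g t
  have cf: "continuous_on (cbox (-1) 1) (f s g)" if "s \<in> {0..\<epsilon>}" "g \<in> B" for s g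
    unfolding f_def[abs_def] cbox_interval
    using that el(1) zv[OF that(2)] b1[OF that(2)]
    by (intro continuous_intros zonal_solD(2)[OF sol] cont czv) auto
  \<comment> \<open>Elements of the function space live on the whole line, so the values on [-1,1]
    are extended by clamping. The choice makes S total; it is characterised for s and g in range,
    where f is continuous.\<close>
  define S where "S s g = (SOME h :: real \<Rightarrow>\<^sub>C real. \<forall>x. h x = f s g (clamp (-1) 1 x))" for s g
  have S: "S s g x = f s g (clamp (-1) 1 x)" if "s \<in> {0..\<epsilon>}" "g \<in> B" for s g x
  proof -
    have "\<exists>h :: real \<Rightarrow>\<^sub>C real. \<forall>x. h x = f s g (clamp (-1) 1 x)"
      by (rule continuous_on_cbox_bcontfunE[OF cf[OF that]]) blast
    from someI_ex[OF this] show ?thesis by (simp add: S_def)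
  qed
  have cl: "clamp (-1) 1 x \<in> ?I" for x :: real
    using clamp_in_interval[of "-1" 1 x] by (simp add: cbox_interval)
  have fB: "\<bar>f s g t\<bar> \<le> \<delta>" if s: "s \<in> {0..\<epsilon>}" and g: "g \<in> B" and t: "t \<in> ?I" for s g t
  proof -
    have "\<bar>\<beta> g * W g t\<bar> \<le> (C * \<delta>) * (C * \<delta>)"
      unfolding abs_mult using bB[OF g] t C dpos by (intro mult_mono) auto
    also have "\<dots> = (8 * C\<^sup>2 * \<delta>) * (\<delta> / 8)" by (simp add: power2_eq_square)
    also have "\<dots> \<le> 1 * (\<delta> / 8)" using dl(1) dpos by (intro mult_right_mono) auto
    finally have 1: "\<bar>\<beta> g * W g t\<bar> \<le> \<delta> / 8" by simp
    have "\<bar>N s (- \<beta> g) t (z g t) (v g t) - N 0 (- \<beta> g) t (z g t) (v g t)\<bar> \<le> K * \<bar>s - 0\<bar>"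
      using s el(1) s1 b1[OF g] t zv[OF g t] by (intro slip) auto
    also have "\<dots> \<le> K * \<epsilon>" using s K by auto
    finally have "\<bar>N s (- \<beta> g) t (z g t) (v g t)\<bar> \<le> \<delta> / 2" using zero el(3) by simp
    then show ?thesis using 1 dpos unfolding f_def by linarith
  qed
  have fL: "\<bar>f s g t - f s g' t\<bar> \<le> 1/2 * dist g g'"
    if s: "s \<in> {0..\<epsilon>}" and g: "g \<in> B" "g' \<in> B" and t: "t \<in> ?I" for s g g' t
  proof -
    let ?D = "C * dist g g'"
    have D0: "0 \<le> ?D" using C by simp
    have "\<bar>\<beta> g * W g t - \<beta> g' * W g' t\<bar> = \<bar>(\<beta> g - \<beta> g') * W g t + \<beta> g' * (W g t - W g' t)\<bar>"
      by (simp add: algebra_simps)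
    also have "\<dots> \<le> \<bar>\<beta> g - \<beta> g'\<bar> * \<bar>W g t\<bar> + \<bar>\<beta> g'\<bar> * \<bar>W g t - W g' t\<bar>"
      by (rule order_trans[OF abs_triangle_ineq]) (simp add: abs_mult)
    also have "\<dots> \<le> ?D * (C * \<delta>) + (C * \<delta>) * ?D"
      using dif\<beta>[of g g'] difW[OF t, of g g'] t bB[OF g(1)] bB[OF g(2)] C dpos D0 by (intro add_mono mult_mono) auto
    also have "\<dots> = (8 * C\<^sup>2 * \<delta>) * (dist g g' / 4)" by (simp add: power2_eq_square)
    also have "\<dots> \<le> 1 * (dist g g' / 4)" using dl(1) by (intro mult_right_mono) auto
    finally have 1: "\<bar>\<beta> g * W g t - \<beta> g' * W g' t\<bar> \<le> dist g g' / 4" by simp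
    have "\<bar>N s (- \<beta> g) t (z g t) (v g t) - N s (- \<beta> g') t (z g' t) (v g' t)\<bar>
      \<le> K * s * (\<bar>- \<beta> g - - \<beta> g'\<bar> + \<bar>z g t - z g' t\<bar> + \<bar>v g t - v g' t\<bar>)"
      using s el(1) b1 g t zv by (intro lip) auto
    also have "\<dots> \<le> K * \<epsilon> * (?D + ?D + ?D)"
    proof (intro mult_mono add_mono)
      show "\<bar>- \<beta> g - - \<beta> g'\<bar> \<le> ?D" using dif\<beta>[of g g'] by (simp add: abs_minus_commute)
      show "\<bar>z g t - z g' t\<bar> \<le> ?D" "\<bar>v g t - v g' t\<bar> \<le> ?D" using difW[OF t, of g g'] difY[OF t, of g g'] by (auto simp: z_def v_def)
    qed (use s K epos in auto)
    also have "\<dots> = (12 * K * C * \<epsilon>) * (dist g g' / 4)" by simp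
    also have "\<dots> \<le> 1 * (dist g g' / 4)" using el(2) by (intro mult_right_mono) auto
    finally have 2: "\<bar>N s (- \<beta> g) t (z g t) (v g t) - N s (- \<beta> g') t (z g' t) (v g' t)\<bar> \<le> dist g g' / 4" by simp
    show ?thesis using 1 2 unfolding f_def by linarith
  qed
  have SB: "S s ` B \<subseteq> B" if "s \<in> {0..\<epsilon>}" for s
  proof (rule image_subsetI)
    fix g assume g: "g \<in> B"
    show "S s g \<in> B"
      unfolding nB by (rule norm_bound) (simp add: S[OF that g] fB[OF that g cl])
  qed
  have SL: "dist (S s g) (S s g') \<le> 1/2 * dist g g'" if "s \<in> {0..\<epsilon>}" "g \<in> B" "g' \<in> B" for s g g'
    by (rule dist_bound) (unfold dist_real_def S[OF that(1,2)] S[OF that(1,3)], rule fL[OF that cl])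
  have "\<exists>g. g \<in> B \<and> S s g = g" if "s \<in> {0..\<epsilon>}" for s
  proof -
    have "\<exists>!g\<in>B. S s g = g"
    proof (rule Banach_fix[of B "1/2"])
      show "complete B" unfolding B_def by (simp add: complete_eq_closed)
      show "B \<noteq> {}" using dpos unfolding B_def by auto
    qed (use SB[OF that] SL[OF that] in auto)
    then show ?thesis by blast
  qed
  then have "\<forall>s. \<exists>g. s \<in> {0..\<epsilon>} \<longrightarrow> g \<in> B \<and> S s g = g" by blast
  from choice[OF this] obtain G where G0: "\<forall>s. s \<in> {0..\<epsilon>} \<longrightarrow> G s \<in> B \<and> S s (G s) = G s" by (rule exE)
  have GB: "G s \<in> B" and GS: "S s (G s) = G s" if "s \<in> {0..\<epsilon>}" for s using G0 that by auto
  have Gf: "G s t = f s (G s) t" if "s \<in> {0..\<epsilon>}" "t \<in> ?I" for s t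
    using S[OF that(1) GB[OF that(1)], of t] GS[OF that(1)] that(2) by (simp add: cbox_interval)
  \<comment> \<open>Dependence of a fixed point on a parameter: with contraction factor 1/2 the
    change K \<bar>s - s'\<bar> of the map is at most doubled.\<close>
  have GL: "dist (G s) (G s') \<le> 2 * K * \<bar>s - s'\<bar>" if s: "s \<in> {0..\<epsilon>}" "s' \<in> {0..\<epsilon>}" for s s'
  proof -
    have "dist (S s (G s')) (S s' (G s')) \<le> K * \<bar>s - s'\<bar>"
    proof (rule dist_bound)
      fix x
      have "\<bar>N s (- \<beta> (G s')) (clamp (-1) 1 x) (z (G s') (clamp (-1) 1 x)) (v (G s') (clamp (-1) 1 x)) -
         N s' (- \<beta> (G s')) (clamp (-1) 1 x) (z (G s') (clamp (-1) 1 x)) (v (G s') (clamp (-1) 1 x))\<bar> \<le> K * \<bar>s - s'\<bar>"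
        using s el(1) b1 GB[OF s(2)] cl zv by (intro slip) auto
      then show "dist (S s (G s') x) (S s' (G s') x) \<le> K * \<bar>s - s'\<bar>"
        by (simp add: S[OF s(1) GB[OF s(2)]] S[OF s(2) GB[OF s(2)]] dist_real_def f_def)
    qed
    moreover have "dist (G s) (G s') \<le> dist (S s (G s)) (S s (G s')) + dist (S s (G s')) (S s' (G s'))"
      using GS[OF s(1)] GS[OF s(2)] by (metis dist_triangle)
    ultimately show ?thesis
      using SL[OF s(1) GB[OF s(1)] GB[OF s(2)]] by linarith
  qed
  \<comment> \<open>At s = 0 only the quadratic term is left, so the norm of the fixed point is at
    most an eighth of itself.\<close>
  have G00: "\<beta> (G 0) = 0"
  proof -
    have z0: "0 \<in> {0..\<epsilon>}" using epos by simp
    have "\<bar>G 0 x\<bar> \<le> norm (G 0) / 8" for x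
    proof -
      let ?t = "clamp (-1) 1 x"
      have "G 0 x = f 0 (G 0) ?t" using S[OF z0 GB[OF z0], of x] GS[OF z0] by simp
      then have "\<bar>G 0 x\<bar> = \<bar>\<beta> (G 0)\<bar> * \<bar>W (G 0) ?t\<bar>" by (simp add: f_def zero abs_mult)
      also have "\<dots> \<le> (C * norm (G 0)) * (C * \<delta>)"
        using conjunct1[OF bnd, of "G 0"] bB(2)[OF GB[OF z0] cl] C dpos by (intro mult_mono) auto
      also have "\<dots> = (8 * C\<^sup>2 * \<delta>) * (norm (G 0) / 8)" by (simp add: power2_eq_square)
      also have "\<dots> \<le> 1 * (norm (G 0) / 8)" using dl(1) by (intro mult_right_mono) auto
      finally show ?thesis by simp
    qed
    then have "norm (G 0) \<le> norm (G 0) / 8" by (intro norm_bound) simp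
    then have "norm (G 0) \<le> 0" by simp
    then show ?thesis using conjunct1[OF bnd, of "G 0"] by simp
  qed
  have "solution_branch d k R N \<epsilon> (C * (2 * K)) (\<lambda>s. - \<beta> (G s)) (\<lambda>s. z (G s)) (\<lambda>s. v (G s))"
    unfolding solution_branch_def
  proof (rule conjI[OF epos], rule conjI)
    show "- \<beta> (G 0) = 0" using G00 by simp
    show "(\<forall>s\<in>{0..\<epsilon>}. zonal_sol d (sph_eig d k) (\<lambda>t. - \<beta> (G s) * z (G s) t + N s (- \<beta> (G s)) t (z (G s) t) (v (G s) t)) (z (G s)) (v (G s)) \<and>
        \<bar>- \<beta> (G s)\<bar> \<le> 1 \<and> (\<forall>t\<in>?I. \<bar>z (G s) t\<bar> \<le> R \<and> \<bar>v (G s) t\<bar> \<le> R) \<and> \<not> z (G s) constant_on ?I) \<and>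
     (\<forall>s\<in>{0..\<epsilon>}. \<forall>s'\<in>{0..\<epsilon>}. \<bar>- \<beta> (G s) - - \<beta> (G s')\<bar> \<le> C * (2 * K) * \<bar>s - s'\<bar> \<and>
        (\<forall>t\<in>?I. \<bar>z (G s) t - z (G s') t\<bar> \<le> C * (2 * K) * \<bar>s - s'\<bar> \<and> \<bar>v (G s) t - v (G s') t\<bar> \<le> C * (2 * K) * \<bar>s - s'\<bar>))"
      (is "?A \<and> ?B")
    proof
      show ?A
      proof (intro ballI conjI)
        fix s assume s: "s \<in> {0..\<epsilon>}"
        have "zonal_sol d (sph_eig d k) (\<lambda>t. 0 + (G s t - \<beta> (G s) * ?\<phi> t)) (z (G s)) (v (G s))"
          unfolding z_def[abs_def] v_def[abs_def] by (rule zonal_sol_add[OF zonal_sol_gegen sol])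
        then show "zonal_sol d (sph_eig d k) (\<lambda>t. - \<beta> (G s) * z (G s) t + N s (- \<beta> (G s)) t (z (G s) t) (v (G s) t)) (z (G s)) (v (G s))"
          by (rule zonal_sol_cong) (simp add: Gf[OF s] f_def, simp add: z_def algebra_simps)
        show "\<bar>- \<beta> (G s)\<bar> \<le> 1" by (rule b1[OF GB[OF s]])
        show "\<not> z (G s) constant_on ?I"
        proof
          assume "z (G s) constant_on ?I"
          then have "z (G s) t1 = z (G s) t2" using t12 unfolding constant_on_def by metis
          then have "\<eta> \<le> \<bar>W (G s) t1\<bar> + \<bar>W (G s) t2\<bar>" unfolding \<eta>_def z_def by linarith
          then show False
            using bB(2)[OF GB[OF s] t12(1)] bB(2)[OF GB[OF s] t12(2)] dl(3) eta by linarith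
        qed
      qed (use zv GB in auto)
      show ?B
      proof (intro ballI conjI)
        fix s s' assume s: "s \<in> {0..\<epsilon>}" "s' \<in> {0..\<epsilon>}"
        have D: "C * dist (G s) (G s') \<le> C * (2 * K) * \<bar>s - s'\<bar>"
          using mult_left_mono[OF GL[OF s], of C] C by (simp add: mult.assoc)
        show "\<bar>- \<beta> (G s) - - \<beta> (G s')\<bar> \<le> C * (2 * K) * \<bar>s - s'\<bar>"
          using dif\<beta>[of "G s" "G s'"] D by (simp add: abs_minus_commute)
        fix t assume t: "t \<in> ?I"
        show "\<bar>z (G s) t - z (G s') t\<bar> \<le> C * (2 * K) * \<bar>s - s'\<bar>"
          using difW[OF t, of "G s" "G s'"] D by (simp add: z_def)
        show "\<bar>v (G s) t - v (G s') t\<bar> \<le> C * (2 * K) * \<bar>s - s'\<bar>"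
          using difY[OF t, of "G s" "G s'"] D by (simp add: v_def)
      qed
    qed
  qed
  with el(1) show ?thesis by (intro exI conjI)
qed

section \<open>The nonlinearity\<close>

definition pow_rem :: "real \<Rightarrow> real \<Rightarrow> real" where
  "pow_rem \<gamma> y = (1 + y) powr \<gamma> - 1 - \<gamma> * y"

text \<open>At \<open>s = 0\<close> this is \<open>0\<close>, the limit for \<open>s \<rightarrow> 0\<close>, because \<open>x / 0 = 0\<close>.\<close>

definition scaled_rem :: "real \<Rightarrow> real \<Rightarrow> real \<Rightarrow> real" where
  "scaled_rem \<gamma> s x = pow_rem \<gamma> (s * x) / s"

lemma pow_rem_0 [simp]: "pow_rem \<gamma> 0 = 0"
  by (simp add: pow_rem_def)

text \<open>The derivative of the remainder vanishes at 0, hence is at most A m on [-m, m], with A a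
  bound for the second derivative. The restriction m <= 1/2 keeps 1 + y away from 0.\<close>

lemma pow_rem_lipschitz:
  obtains A where "A > 0"
    "\<And>m y y'. 0 \<le> m \<Longrightarrow> m \<le> 1/2 \<Longrightarrow> \<bar>y\<bar> \<le> m \<Longrightarrow> \<bar>y'\<bar> \<le> m \<Longrightarrow> \<bar>pow_rem \<gamma> y - pow_rem \<gamma> y'\<bar> \<le> A * m * \<bar>y - y'\<bar>"
proof -
  let ?J = "{-(1/2)..1/2::real}"
  have "continuous_on ?J (\<lambda>y. \<gamma> * ((\<gamma> - 1) * (1 + y) powr (\<gamma> - 2)))"
    by (intro continuous_intros) auto
  then have "bounded ((\<lambda>y. \<gamma> * ((\<gamma> - 1) * (1 + y) powr (\<gamma> - 2))) ` ?J)"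
    by (intro compact_imp_bounded compact_continuous_image) auto
  then obtain A where A: "A > 0" "\<And>y. y \<in> ?J \<Longrightarrow> \<bar>\<gamma> * ((\<gamma> - 1) * (1 + y) powr (\<gamma> - 2))\<bar> \<le> A"
    by (auto simp: bounded_pos)
  define D where "D y = \<gamma> * (1 + y) powr (\<gamma> - 1) - \<gamma>" for y
  have D: "\<bar>D y\<bar> \<le> A * m" if "0 \<le> m" "m \<le> 1/2" "\<bar>y\<bar> \<le> m" for y m
  proof -
    have "norm (D y - D 0) \<le> A * norm (y - 0)"
    proof (rule field_differentiable_bound[of ?J D "\<lambda>y. \<gamma> * ((\<gamma> - 1) * (1 + y) powr (\<gamma> - 2))"])
      fix x assume x: "x \<in> ?J"
      show "(D has_field_derivative \<gamma> * ((\<gamma> - 1) * (1 + x) powr (\<gamma> - 2))) (at x within ?J)"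
        unfolding D_def[abs_def] using x by (auto intro!: derivative_eq_intros simp: algebra_simps)
      show "norm (\<gamma> * ((\<gamma> - 1) * (1 + x) powr (\<gamma> - 2))) \<le> A" using A(2)[OF x] by simp
    qed (use that in auto)
    also have "\<dots> \<le> A * m" using that A by simp
    finally show ?thesis by (simp add: D_def)
  qed
  show thesis
  proof (rule that[OF A(1)])
    fix m y y' :: real assume m: "0 \<le> m" "m \<le> 1/2" and y: "\<bar>y\<bar> \<le> m" "\<bar>y'\<bar> \<le> m"
    have "norm (pow_rem \<gamma> y - pow_rem \<gamma> y') \<le> (A * m) * norm (y - y')"
    proof (rule field_differentiable_bound[of "{-m..m}" "pow_rem \<gamma>" D])
      fix x assume x: "x \<in> {-m..m}"
      show "(pow_rem \<gamma> has_field_derivative D x) (at x within {-m..m})"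
        unfolding D_def pow_rem_def[abs_def] using x m by (auto intro!: derivative_eq_intros)
      show "norm (D x) \<le> A * m" using D[OF m, of x] x by auto
    qed (use y in auto)
    then show "\<bar>pow_rem \<gamma> y - pow_rem \<gamma> y'\<bar> \<le> A * m * \<bar>y - y'\<bar>" by simp
  qed
qed

text \<open>The remainder is quadratic, so after division by s one factor s is left in the Lipschitz
  constant for x. In s the quotient remains Lipschitz down to s = 0.\<close>

lemma scaled_rem_lipschitz:
  obtains A where "A > 0"
    "\<And>B s x x'. 0 \<le> s \<Longrightarrow> s * B \<le> 1/2 \<Longrightarrow> \<bar>x\<bar> \<le> B \<Longrightarrow> \<bar>x'\<bar> \<le> B \<Longrightarrow>
       \<bar>scaled_rem \<gamma> s x - scaled_rem \<gamma> s x'\<bar> \<le> A * s * B * \<bar>x - x'\<bar>"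
    "\<And>B s s' x. 0 \<le> s \<Longrightarrow> 0 \<le> s' \<Longrightarrow> s * B \<le> 1/2 \<Longrightarrow> s' * B \<le> 1/2 \<Longrightarrow> \<bar>x\<bar> \<le> B \<Longrightarrow>
       \<bar>scaled_rem \<gamma> s x - scaled_rem \<gamma> s' x\<bar> \<le> A * B\<^sup>2 * \<bar>s - s'\<bar>"
proof -
  obtain A where A: "A > 0" and lip:
    "\<And>m y y'. 0 \<le> m \<Longrightarrow> m \<le> 1/2 \<Longrightarrow> \<bar>y\<bar> \<le> m \<Longrightarrow> \<bar>y'\<bar> \<le> m \<Longrightarrow> \<bar>pow_rem \<gamma> y - pow_rem \<gamma> y'\<bar> \<le> A * m * \<bar>y - y'\<bar>"
    using pow_rem_lipschitz[of \<gamma>] by blast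
  have 1: "\<bar>scaled_rem \<gamma> s x - scaled_rem \<gamma> s x'\<bar> \<le> A * s * B * \<bar>x - x'\<bar>"
    if "0 \<le> s" "s * B \<le> 1/2" "\<bar>x\<bar> \<le> B" "\<bar>x'\<bar> \<le> B" for B s x x'
  proof (cases "s = 0")
    case False
    have "\<bar>pow_rem \<gamma> (s * x) - pow_rem \<gamma> (s * x')\<bar> \<le> A * (s * B) * \<bar>s * x - s * x'\<bar>"
      using that by (intro lip) (auto simp: abs_mult intro!: mult_left_mono)
    also have "\<dots> = s * (A * s * B * \<bar>x - x'\<bar>)"
      using that by (simp add: right_diff_distrib[symmetric] abs_mult)
    finally show ?thesis
      using False that by (simp add: scaled_rem_def diff_divide_distrib[symmetric] pos_divide_le_eq mult.commute)
  qed (simp add: scaled_rem_def)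
  \<comment> \<open>For 0 < s' <= s the change of numerator and the change of denominator are
    estimated separately, each by A B^2 \<bar>s - s'\<bar>; the second uses that the remainder at s'
    x is of order s'^2. For s' = 0 the value is 0 and the first estimate applies with x' =
    0.\<close>
  have 2: "\<bar>scaled_rem \<gamma> s x - scaled_rem \<gamma> s' x\<bar> \<le> 2 * A * B\<^sup>2 * \<bar>s - s'\<bar>"
    if "0 \<le> s'" "s' \<le> s" "s * B \<le> 1/2" "\<bar>x\<bar> \<le> B" for B s s' x
  proof (cases "s' = 0")
    case True
    have B: "0 \<le> B" using that by linarith
    have "scaled_rem \<gamma> s 0 = 0" "scaled_rem \<gamma> 0 x = 0" by (simp_all add: scaled_rem_def)
    then have "\<bar>scaled_rem \<gamma> s x - scaled_rem \<gamma> s' x\<bar> \<le> A * s * B * \<bar>x\<bar>"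
      using 1[of s B x 0] that True B by simp
    also have "\<dots> \<le> A * s * B * B" using that A B by (intro mult_left_mono) auto
    also have "\<dots> \<le> 2 * A * B\<^sup>2 * \<bar>s - s'\<bar>"
      using True that A B by (simp add: power2_eq_square)
    finally show ?thesis .
  next
    case False
    have B: "0 \<le> B" using that by linarith
    have pos: "0 < s'" "0 < s" using False that by auto
    have s'B: "s' * B \<le> 1/2" using mult_right_mono[OF that(2) B] that(3) by linarith
    have "\<bar>pow_rem \<gamma> (s * x) - pow_rem \<gamma> (s' * x)\<bar> \<le> A * (s * B) * \<bar>s * x - s' * x\<bar>"
      using that pos B by (intro lip) (auto simp: abs_mult intro!: mult_mono)
    also have "\<dots> = s * (A * B * (\<bar>s - s'\<bar> * \<bar>x\<bar>))"
      by (simp add: left_diff_distrib[symmetric] abs_mult)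
    also have "\<dots> \<le> s * (A * B * (\<bar>s - s'\<bar> * B))"
      using that A B pos by (intro mult_left_mono) auto
    finally have a: "\<bar>(pow_rem \<gamma> (s * x) - pow_rem \<gamma> (s' * x)) / s\<bar> \<le> A * B * (\<bar>s - s'\<bar> * B)"
      using pos by (simp add: pos_divide_le_eq mult.commute)
    have "\<bar>pow_rem \<gamma> (s' * x) - pow_rem \<gamma> 0\<bar> \<le> A * (s' * B) * \<bar>s' * x - 0\<bar>"
      using that pos B s'B by (intro lip) (auto simp: abs_mult intro!: mult_mono)
    also have "\<dots> \<le> A * (s' * B) * (s' * B)"
      using that pos A B by (intro mult_left_mono) (auto simp: abs_mult)
    finally have b0: "\<bar>pow_rem \<gamma> (s' * x)\<bar> \<le> (A * B * B) * (s' * s')" by (simp add: algebra_simps)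
    have q: "1 / s - 1 / s' = (s' - s) / (s * s')" using pos by (simp add: field_simps)
    have "\<bar>pow_rem \<gamma> (s' * x) * (1 / s - 1 / s')\<bar> = \<bar>pow_rem \<gamma> (s' * x)\<bar> * (\<bar>s - s'\<bar> / (s * s'))"
      unfolding q abs_mult abs_divide using pos by (simp add: abs_minus_commute)
    also have "\<dots> \<le> ((A * B * B) * (s' * s')) * (\<bar>s - s'\<bar> / (s * s'))"
      using b0 pos by (intro mult_right_mono) auto
    also have "\<dots> = (A * B * B * \<bar>s - s'\<bar>) * (s' / s)" using pos by (simp add: field_simps)
    also have "\<dots> \<le> (A * B * B * \<bar>s - s'\<bar>) * 1"
      using that pos A B by (intro mult_left_mono) auto
    finally have b: "\<bar>pow_rem \<gamma> (s' * x) * (1 / s - 1 / s')\<bar> \<le> A * B * B * \<bar>s - s'\<bar>" by simp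
    have "scaled_rem \<gamma> s x - scaled_rem \<gamma> s' x =
       (pow_rem \<gamma> (s * x) - pow_rem \<gamma> (s' * x)) / s + pow_rem \<gamma> (s' * x) * (1 / s - 1 / s')"
      unfolding scaled_rem_def by (simp add: diff_divide_distrib algebra_simps)
    then have "\<bar>scaled_rem \<gamma> s x - scaled_rem \<gamma> s' x\<bar> \<le> A * B * (\<bar>s - s'\<bar> * B) + A * B * B * \<bar>s - s'\<bar>"
      using a b by linarith
    then show ?thesis by (simp add: power2_eq_square algebra_simps)
  qed
  show thesis
  proof (rule that[of "2 * A"])
    show "2 * A > 0" using A by simp
    fix B s x x' :: real assume h: "0 \<le> s" "s * B \<le> 1/2" "\<bar>x\<bar> \<le> B" "\<bar>x'\<bar> \<le> B"
    have "A * s * B * \<bar>x - x'\<bar> \<le> 2 * (A * s * B * \<bar>x - x'\<bar>)" using h A by simp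
    then show "\<bar>scaled_rem \<gamma> s x - scaled_rem \<gamma> s x'\<bar> \<le> 2 * A * s * B * \<bar>x - x'\<bar>"
      using 1[OF h] by simp
  next
    fix B s s' x :: real assume "0 \<le> s" "0 \<le> s'" "s * B \<le> 1/2" "s' * B \<le> 1/2" "\<bar>x\<bar> \<le> B"
    then show "\<bar>scaled_rem \<gamma> s x - scaled_rem \<gamma> s' x\<bar> \<le> 2 * A * B\<^sup>2 * \<bar>s - s'\<bar>"
      using 2[of s' s B x] 2[of s s' B x] by (cases "s' \<le> s") (auto simp: abs_minus_commute)
  qed
qed


text \<open>
  In \<open>g = 1 + s z\<close> with \<open>v\<close> the derivative of \<open>z\<close>, the gradient term \<open>(g\<^sup>2 + e |\<nabla>g|\<^sup>2) powr \<sigma>\<close> of the normalised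
  equation is \<open>(1 + s rem_arg) powr \<sigma> = 1 + 2 \<sigma> s z + s grad_rem\<close>, and \<open>nonlin\<close> is what remains, divided
  by \<open>s\<close>, after the part linear in \<open>z\<close> is removed.
\<close>

definition rem_arg :: "real \<Rightarrow> real \<Rightarrow> real \<Rightarrow> real \<Rightarrow> real \<Rightarrow> real" where
  "rem_arg e s t z v = 2 * z + s * (z\<^sup>2 + e * (1 - t\<^sup>2) * v\<^sup>2)"

definition grad_rem :: "real \<Rightarrow> real \<Rightarrow> real \<Rightarrow> real \<Rightarrow> real \<Rightarrow> real \<Rightarrow> real" where
  "grad_rem \<sigma> e s t z v = \<sigma> * (s * (z\<^sup>2 + e * (1 - t\<^sup>2) * v\<^sup>2)) + scaled_rem \<sigma> s (rem_arg e s t z v)"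

definition nonlin :: "real \<Rightarrow> real \<Rightarrow> real \<Rightarrow> real \<Rightarrow> real \<Rightarrow> real \<Rightarrow> real \<Rightarrow> real \<Rightarrow> real \<Rightarrow> real \<Rightarrow> real \<Rightarrow> real" where
  "nonlin p \<sigma> e c P \<kappa> s \<zeta> t z v =
     c * grad_rem \<sigma> e s t z v + (P + \<zeta> / \<kappa>) * (scaled_rem p s z - grad_rem \<sigma> e s t z v)"

lemma nonlin_0: "nonlin p \<sigma> e c P \<kappa> 0 \<zeta> t z v = 0"
  by (simp add: nonlin_def grad_rem_def scaled_rem_def)

lemma square_diff_le:
  fixes z z' R :: real
  assumes "\<bar>z\<bar> \<le> R" "\<bar>z'\<bar> \<le> R"
  shows "\<bar>z\<^sup>2 - z'\<^sup>2\<bar> \<le> 2 * R * \<bar>z - z'\<bar>"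
proof -
  have "\<bar>z\<^sup>2 - z'\<^sup>2\<bar> = \<bar>z + z'\<bar> * \<bar>z - z'\<bar>"
    by (simp add: power2_eq_square abs_mult[symmetric] algebra_simps)
  also have "\<dots> \<le> 2 * R * \<bar>z - z'\<bar>" using assms by (intro mult_right_mono) auto
  finally show ?thesis .
qed

text \<open>The parameter \<zeta> multiplies a difference of two remainders which is itself of order
  s. For this reason the Lipschitz constant in \<zeta> has the factor s too.\<close>

lemma nonlin_lipschitz:
  assumes R: "R > 0" and e: "e \<ge> 0" and \<kappa>: "\<kappa> > 0"
  obtains s1 K where "s1 > 0" "s1 \<le> 1" "s1 * R \<le> 1/2" "K > 0"
    "s_lipschitz R s1 K (nonlin p \<sigma> e c P \<kappa>)"
    "\<And>s \<zeta> z v. s \<in> {0..s1} \<Longrightarrow> \<bar>\<zeta>\<bar> \<le> 1 \<Longrightarrow> continuous_on {-1..1} z \<Longrightarrow> continuous_on {-1..1} v \<Longrightarrow>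
       (\<And>t. t \<in> {-1..1} \<Longrightarrow> \<bar>z t\<bar> \<le> R \<and> \<bar>v t\<bar> \<le> R) \<Longrightarrow>
       continuous_on {-1..1} (\<lambda>t. nonlin p \<sigma> e c P \<kappa> s \<zeta> t (z t) (v t))"
proof -
  \<comment> \<open>B bounds both z and \<open>rem_arg\<close> as long as s <= 1. With s B <= 1/2
    all powers are then taken of numbers in [1/2, 3/2].\<close>
  define B where "B = 2 * R + R\<^sup>2 + e * R\<^sup>2"
  have B: "B > 0" "R \<le> B" "R\<^sup>2 + e * R\<^sup>2 \<le> B" using R e by (auto simp: B_def add_pos_nonneg)
  obtain A1 where A1: "A1 > 0"
    "\<And>B s x x'. 0 \<le> s \<Longrightarrow> s * B \<le> 1/2 \<Longrightarrow> \<bar>x\<bar> \<le> B \<Longrightarrow> \<bar>x'\<bar> \<le> B \<Longrightarrow>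
       \<bar>scaled_rem p s x - scaled_rem p s x'\<bar> \<le> A1 * s * B * \<bar>x - x'\<bar>"
    "\<And>B s s' x. 0 \<le> s \<Longrightarrow> 0 \<le> s' \<Longrightarrow> s * B \<le> 1/2 \<Longrightarrow> s' * B \<le> 1/2 \<Longrightarrow> \<bar>x\<bar> \<le> B \<Longrightarrow>
       \<bar>scaled_rem p s x - scaled_rem p s' x\<bar> \<le> A1 * B\<^sup>2 * \<bar>s - s'\<bar>"
    using scaled_rem_lipschitz[of p] by blast
  obtain A2 where A2: "A2 > 0"
    "\<And>B s x x'. 0 \<le> s \<Longrightarrow> s * B \<le> 1/2 \<Longrightarrow> \<bar>x\<bar> \<le> B \<Longrightarrow> \<bar>x'\<bar> \<le> B \<Longrightarrow>
       \<bar>scaled_rem \<sigma> s x - scaled_rem \<sigma> s x'\<bar> \<le> A2 * s * B * \<bar>x - x'\<bar>"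
    "\<And>B s s' x. 0 \<le> s \<Longrightarrow> 0 \<le> s' \<Longrightarrow> s * B \<le> 1/2 \<Longrightarrow> s' * B \<le> 1/2 \<Longrightarrow> \<bar>x\<bar> \<le> B \<Longrightarrow>
       \<bar>scaled_rem \<sigma> s x - scaled_rem \<sigma> s' x\<bar> \<le> A2 * B\<^sup>2 * \<bar>s - s'\<bar>"
    using scaled_rem_lipschitz[of \<sigma>] by blast
  define s1 where "s1 = min 1 (1 / (2 * B))"
  have s1: "s1 > 0" "s1 \<le> 1" using B by (auto simp: s1_def)
  have s1B: "s * B \<le> 1/2" if "s \<in> {0..s1}" for s
  proof -
    have "s \<le> 1 / (2 * B)" using that by (auto simp: s1_def)
    then have "s * B \<le> 1 / (2 * B) * B" using B(1) by (intro mult_right_mono) auto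
    then show ?thesis using B(1) by simp
  qed
  let ?S = "\<lambda>t z v. z\<^sup>2 + e * (1 - t\<^sup>2) * v\<^sup>2"
  let ?Y = "rem_arg e" and ?V = "grad_rem \<sigma> e" and ?U = "scaled_rem p"
  have t2: "0 \<le> 1 - t\<^sup>2" "1 - t\<^sup>2 \<le> 1" if "t \<in> {-1..1}" for t :: real
    using that abs_square_le_1[of t] by auto
  have Sb: "\<bar>?S t z v\<bar> \<le> R\<^sup>2 + e * R\<^sup>2" if t: "t \<in> {-1..1}" and z: "\<bar>z\<bar> \<le> R" "\<bar>v\<bar> \<le> R" for t z v
  proof -
    have "z\<^sup>2 \<le> R\<^sup>2" "v\<^sup>2 \<le> R\<^sup>2" using z R by (simp_all add: abs_le_square_iff[symmetric])
    moreover from this have "e * (1 - t\<^sup>2) * v\<^sup>2 \<le> e * 1 * R\<^sup>2"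
      using t2[OF t] e by (intro mult_mono) auto
    moreover have "0 \<le> e * (1 - t\<^sup>2) * v\<^sup>2" using t2[OF t] e by simp
    ultimately show ?thesis by simp
  qed
  have Sl: "\<bar>?S t z v - ?S t z' v'\<bar> \<le> (2 * R + 2 * R * e) * (\<bar>z - z'\<bar> + \<bar>v - v'\<bar>)"
    if t: "t \<in> {-1..1}" and z: "\<bar>z\<bar> \<le> R" "\<bar>z'\<bar> \<le> R" "\<bar>v\<bar> \<le> R" "\<bar>v'\<bar> \<le> R" for t z z' v v'
  proof -
    have "\<bar>?S t z v - ?S t z' v'\<bar> = \<bar>(z\<^sup>2 - z'\<^sup>2) + e * (1 - t\<^sup>2) * (v\<^sup>2 - v'\<^sup>2)\<bar>" by (simp add: algebra_simps)
    also have "\<dots> \<le> \<bar>z\<^sup>2 - z'\<^sup>2\<bar> + (e * (1 - t\<^sup>2)) * \<bar>v\<^sup>2 - v'\<^sup>2\<bar>"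
      using t2[OF t] e by (intro order_trans[OF abs_triangle_ineq]) (simp add: abs_mult)
    also have "\<dots> \<le> 2 * R * \<bar>z - z'\<bar> + (e * 1) * (2 * R * \<bar>v - v'\<bar>)"
      using t2[OF t] e z by (intro add_mono mult_mono square_diff_le) auto
    also have "\<dots> \<le> (2 * R + 2 * R * e) * (\<bar>z - z'\<bar> + \<bar>v - v'\<bar>)"
      using R e by (simp add: algebra_simps add_nonneg_nonneg)
    finally show ?thesis .
  qed
  have Yb: "\<bar>?Y s t z v\<bar> \<le> B" if s: "s \<in> {0..s1}" and t: "t \<in> {-1..1}" and z: "\<bar>z\<bar> \<le> R" "\<bar>v\<bar> \<le> R" for s t z v
  proof -
    have S1: "\<bar>s * ?S t z v\<bar> \<le> 1 * (R\<^sup>2 + e * R\<^sup>2)"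
      unfolding abs_mult[of s] using s s1 Sb[OF t z] by (intro mult_mono) auto
    have "\<bar>2 * z + s * ?S t z v\<bar> \<le> \<bar>2 * z\<bar> + \<bar>s * ?S t z v\<bar>" by (rule abs_triangle_ineq)
    also have "\<dots> \<le> 2 * R + 1 * (R\<^sup>2 + e * R\<^sup>2)"
      using z by (intro add_mono S1) auto
    finally show ?thesis by (simp add: rem_arg_def B_def)
  qed
  define L where "L = 2 + 2 * R + 2 * R * e"
  have L: "L > 0" using R e by (simp add: L_def add_pos_nonneg)
  have Yl: "\<bar>?Y s t z v - ?Y s t z' v'\<bar> \<le> L * (\<bar>z - z'\<bar> + \<bar>v - v'\<bar>)"
    if s: "s \<in> {0..s1}" and t: "t \<in> {-1..1}" and z: "\<bar>z\<bar> \<le> R" "\<bar>z'\<bar> \<le> R" "\<bar>v\<bar> \<le> R" "\<bar>v'\<bar> \<le> R" for s t z z' v v'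
  proof -
    let ?d = "\<bar>z - z'\<bar> + \<bar>v - v'\<bar>"
    have S1: "\<bar>s * (?S t z v - ?S t z' v')\<bar> \<le> 1 * ((2 * R + 2 * R * e) * ?d)"
      unfolding abs_mult[of s] using s s1 Sl[OF t z] by (intro mult_mono) auto
    have "?Y s t z v - ?Y s t z' v' = 2 * (z - z') + s * (?S t z v - ?S t z' v')"
      by (simp add: rem_arg_def algebra_simps)
    also have "\<bar>\<dots>\<bar> \<le> \<bar>2 * (z - z')\<bar> + \<bar>s * (?S t z v - ?S t z' v')\<bar>" by (rule abs_triangle_ineq)
    also have "\<dots> \<le> 2 * ?d + 1 * ((2 * R + 2 * R * e) * ?d)"
      by (intro add_mono S1) (simp add: abs_mult del: right_diff_distrib_numeral)
    finally show ?thesis by (simp add: L_def algebra_simps)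
  qed
  define K1 where "K1 = \<bar>\<sigma>\<bar> * L + A2 * B * L"
  have K1: "K1 \<ge> 0" using L A2(1) B(1) by (simp add: K1_def)
  have Vl: "\<bar>?V s t z v - ?V s t z' v'\<bar> \<le> K1 * s * (\<bar>z - z'\<bar> + \<bar>v - v'\<bar>)"
    if s: "s \<in> {0..s1}" and t: "t \<in> {-1..1}" and z: "\<bar>z\<bar> \<le> R" "\<bar>z'\<bar> \<le> R" "\<bar>v\<bar> \<le> R" "\<bar>v'\<bar> \<le> R" for s t z z' v v'
  proof -
    let ?d = "\<bar>z - z'\<bar> + \<bar>v - v'\<bar>"
    have "\<bar>scaled_rem \<sigma> s (?Y s t z v) - scaled_rem \<sigma> s (?Y s t z' v')\<bar> \<le> A2 * s * B * \<bar>?Y s t z v - ?Y s t z' v'\<bar>"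
      using s s1B[OF s] Yb[OF s t z(1,3)] Yb[OF s t z(2,4)] by (intro A2(2)) auto
    also have "\<dots> \<le> A2 * s * B * (L * ?d)"
      using A2(1) s B(1) by (intro mult_left_mono[OF Yl[OF s t z]]) auto
    finally have 1: "\<bar>scaled_rem \<sigma> s (?Y s t z v) - scaled_rem \<sigma> s (?Y s t z' v')\<bar> \<le> (A2 * B * L) * s * ?d"
      by (simp add: algebra_simps)
    have "2 * R + 2 * R * e \<le> L" by (simp add: L_def)
    then have "(2 * R + 2 * R * e) * ?d \<le> L * ?d" by (intro mult_right_mono) auto
    then have "\<bar>?S t z v - ?S t z' v'\<bar> \<le> L * ?d" using Sl[OF t z] by linarith
    then have "\<bar>\<sigma>\<bar> * (s * \<bar>?S t z v - ?S t z' v'\<bar>) \<le> \<bar>\<sigma>\<bar> * (s * (L * ?d))"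
      using s by (intro mult_left_mono) auto
    moreover have gen: "\<bar>\<sigma> * (s * X)\<bar> = \<bar>\<sigma>\<bar> * (s * \<bar>X\<bar>)" for X
      using s by (simp add: abs_mult)
    ultimately have 2: "\<bar>\<sigma> * (s * (?S t z v - ?S t z' v'))\<bar> \<le> (\<bar>\<sigma>\<bar> * L) * s * ?d"
      unfolding gen by (simp only: mult_ac)
    have "?V s t z v - ?V s t z' v' = \<sigma> * (s * (?S t z v - ?S t z' v')) +
       (scaled_rem \<sigma> s (?Y s t z v) - scaled_rem \<sigma> s (?Y s t z' v'))"
      by (simp add: grad_rem_def algebra_simps)
    then have "\<bar>?V s t z v - ?V s t z' v'\<bar> \<le> (\<bar>\<sigma>\<bar> * L) * s * ?d + (A2 * B * L) * s * ?d"
      using 1 2 by linarith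
    then show ?thesis by (simp add: K1_def algebra_simps)
  qed
  define K2 where "K2 = \<bar>\<sigma>\<bar> * B + 2 * A2 * B\<^sup>2"
  have K2: "K2 \<ge> 0" using A2(1) B(1) by (simp add: K2_def)
  have Vs: "\<bar>?V s t z v - ?V s' t z v\<bar> \<le> K2 * \<bar>s - s'\<bar>"
    if s: "s \<in> {0..s1}" "s' \<in> {0..s1}" and t: "t \<in> {-1..1}" and z: "\<bar>z\<bar> \<le> R" "\<bar>v\<bar> \<le> R" for s s' t z v
  proof -
    have SB: "\<bar>?S t z v\<bar> \<le> B" using Sb[OF t z] B(3) by linarith
    have "?Y s t z v - ?Y s' t z v = (s - s') * ?S t z v" by (simp add: rem_arg_def algebra_simps)
    then have Ys: "\<bar>?Y s t z v - ?Y s' t z v\<bar> \<le> \<bar>s - s'\<bar> * B"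
      using SB by (simp add: abs_mult mult_left_mono)
    have "\<bar>scaled_rem \<sigma> s (?Y s t z v) - scaled_rem \<sigma> s (?Y s' t z v)\<bar> \<le> A2 * s * B * \<bar>?Y s t z v - ?Y s' t z v\<bar>"
      using s(1) s1B[OF s(1)] Yb[OF s(1) t z] Yb[OF s(2) t z] by (intro A2(2)) auto
    also have "\<dots> \<le> A2 * 1 * B * (\<bar>s - s'\<bar> * B)"
      using A2(1) s s1 B(1) Ys by (intro mult_mono) auto
    finally have 1: "\<bar>scaled_rem \<sigma> s (?Y s t z v) - scaled_rem \<sigma> s (?Y s' t z v)\<bar> \<le> A2 * B\<^sup>2 * \<bar>s - s'\<bar>"
      by (simp add: power2_eq_square algebra_simps)
    have 2: "\<bar>scaled_rem \<sigma> s (?Y s' t z v) - scaled_rem \<sigma> s' (?Y s' t z v)\<bar> \<le> A2 * B\<^sup>2 * \<bar>s - s'\<bar>"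
      using s s1B Yb[OF s(2) t z] by (intro A2(3)) auto
    have 3: "\<bar>\<sigma> * ((s - s') * ?S t z v)\<bar> \<le> \<bar>\<sigma>\<bar> * B * \<bar>s - s'\<bar>"
      unfolding abs_mult[of \<sigma>] abs_mult[of "s - s'"]
      using mult_left_mono[OF SB, of "\<bar>\<sigma>\<bar> * \<bar>s - s'\<bar>"] by (simp only: mult_ac abs_ge_zero mult_nonneg_nonneg)
    have "?V s t z v - ?V s' t z v = \<sigma> * ((s - s') * ?S t z v) +
       (scaled_rem \<sigma> s (?Y s t z v) - scaled_rem \<sigma> s (?Y s' t z v)) +
       (scaled_rem \<sigma> s (?Y s' t z v) - scaled_rem \<sigma> s' (?Y s' t z v))"
      by (simp add: grad_rem_def algebra_simps)
    then have "\<bar>?V s t z v - ?V s' t z v\<bar> \<le> \<bar>\<sigma>\<bar> * B * \<bar>s - s'\<bar> + A2 * B\<^sup>2 * \<bar>s - s'\<bar> + A2 * B\<^sup>2 * \<bar>s - s'\<bar>"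
      using 1 2 3 by linarith
    then show ?thesis by (simp add: K2_def algebra_simps)
  qed
  define K3 where "K3 = A1 * B"
  define K4 where "K4 = A1 * B\<^sup>2"
  have K34: "K3 \<ge> 0" "K4 \<ge> 0" using A1(1) B(1) by (auto simp: K3_def K4_def)
  have Ul: "\<bar>?U s z - ?U s z'\<bar> \<le> K3 * s * \<bar>z - z'\<bar>"
    if s: "s \<in> {0..s1}" and z: "\<bar>z\<bar> \<le> R" "\<bar>z'\<bar> \<le> R" for s z z'
    using A1(2)[of s B z z'] s s1B[OF s] z B(2) by (simp add: K3_def algebra_simps)
  have Us: "\<bar>?U s z - ?U s' z\<bar> \<le> K4 * \<bar>s - s'\<bar>"
    if s: "s \<in> {0..s1}" "s' \<in> {0..s1}" and z: "\<bar>z\<bar> \<le> R" for s s' z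
    using A1(3)[of s s' B z] s s1B z B(2) by (simp add: K4_def)
  define Pm where "Pm = \<bar>P\<bar> + 1 / \<kappa>"
  have Pm: "Pm \<ge> 0" using \<kappa> by (simp add: Pm_def)
  have Pb: "\<bar>P + \<zeta> / \<kappa>\<bar> \<le> Pm" if "\<bar>\<zeta>\<bar> \<le> 1" for \<zeta>
  proof -
    have "\<bar>\<zeta> / \<kappa>\<bar> \<le> 1 / \<kappa>" using that \<kappa> by (simp add: divide_right_mono)
    then show ?thesis unfolding Pm_def by linarith
  qed
  define K where "K = \<bar>c\<bar> * (K1 + K2) + Pm * (K1 + K2 + K3 + K4) + (K2 + K4) / \<kappa> + 1"
  have K: "K > 0" using K1 K2 K34 Pm \<kappa> by (simp add: K_def add_nonneg_pos)
  have "\<bar>c\<bar> * K1 \<le> \<bar>c\<bar> * (K1 + K2)" "Pm * (K3 + K1) \<le> Pm * (K1 + K2 + K3 + K4)"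
    "\<bar>c\<bar> * K2 \<le> \<bar>c\<bar> * (K1 + K2)" "Pm * (K4 + K2) \<le> Pm * (K1 + K2 + K3 + K4)" "0 \<le> (K2 + K4) / \<kappa>"
    using K1 K2 K34 Pm \<kappa> by (auto intro!: mult_left_mono)
  then have Kl: "\<bar>c\<bar> * K1 + Pm * (K3 + K1) + (K2 + K4) / \<kappa> \<le> K" and Ks: "\<bar>c\<bar> * K2 + Pm * (K4 + K2) \<le> K"
    unfolding K_def by linarith+
  have tri: "x = a1 + a2 + a3 \<Longrightarrow> \<bar>a1\<bar> \<le> b1 \<Longrightarrow> \<bar>a2\<bar> \<le> b2 \<Longrightarrow> \<bar>a3\<bar> \<le> b3 \<Longrightarrow> \<bar>x\<bar> \<le> b1 + b2 + b3"
    for x a1 a2 a3 b1 b2 b3 :: real by linarith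
  have alg: "(c * V + (P + a) * (U - V)) - (c * V' + (P + a') * (U' - V')) =
      c * (V - V') + (P + a') * ((U - U') - (V - V')) + (a - a') * (U - V)" for V a U V' a' U'
    by (simp add: algebra_simps)
  have z0: "0 \<in> {0..s1}" using s1 by simp
  have V0: "?V 0 t z v = 0" "?U 0 z = 0" for t z v by (simp_all add: grad_rem_def scaled_rem_def)
  show thesis
  proof (rule that[OF s1 _ K])
    have "s1 * R \<le> s1 * B" using B(2) s1 by (intro mult_left_mono) auto
    also have "\<dots> \<le> 1/2" using s1B[of s1] s1 by simp
    finally show "s1 * R \<le> 1/2" .
  next
    show "s_lipschitz R s1 K (nonlin p \<sigma> e c P \<kappa>)"
      unfolding s_lipschitz_def
    proof (rule conjI; intro allI impI)
    fix s \<zeta> \<zeta>' t z z' v v' :: real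
    assume s: "s \<in> {0..s1}" and \<zeta>: "\<bar>\<zeta>\<bar> \<le> 1" "\<bar>\<zeta>'\<bar> \<le> 1" and t: "t \<in> {-1..1}"
      and z: "\<bar>z\<bar> \<le> R" "\<bar>z'\<bar> \<le> R" "\<bar>v\<bar> \<le> R" "\<bar>v'\<bar> \<le> R"
    let ?d = "\<bar>\<zeta> - \<zeta>'\<bar> + \<bar>z - z'\<bar> + \<bar>v - v'\<bar>"
    have s0: "0 \<le> s" using s by simp
    have dV: "\<bar>?V s t z v - ?V s t z' v'\<bar> \<le> K1 * (s * ?d)"
      using Vl[OF s t z] mult_left_mono[of "\<bar>z - z'\<bar> + \<bar>v - v'\<bar>" ?d "K1 * s"] K1 s0 by (simp add: mult.assoc)
    have dU: "\<bar>?U s z - ?U s z'\<bar> \<le> K3 * (s * ?d)"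
      using Ul[OF s z(1,2)] mult_left_mono[of "\<bar>z - z'\<bar>" ?d "K3 * s"] K34 s0 by (simp add: mult.assoc)
    \<comment> \<open>Both remainders are 0 at s = 0, so comparing with that parameter turns the
      Lipschitz estimates in s into a size estimate.\<close>
    have bVU: "\<bar>?U s z - ?V s t z v\<bar> \<le> (K2 + K4) * s"
      using Vs[OF s z0 t z(1,3)] Us[OF s z0 z(1)] s0 unfolding V0 by (simp add: algebra_simps)
    have 1: "\<bar>c * (?V s t z v - ?V s t z' v')\<bar> \<le> \<bar>c\<bar> * (K1 * (s * ?d))"
      unfolding abs_mult by (intro mult_left_mono dV) auto
    have 2: "\<bar>(P + \<zeta>' / \<kappa>) * ((?U s z - ?U s z') - (?V s t z v - ?V s t z' v'))\<bar> \<le> Pm * (K3 * (s * ?d) + K1 * (s * ?d))"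
      unfolding abs_mult using Pb[OF \<zeta>(2)] Pm by (intro mult_mono order_trans[OF abs_triangle_ineq4 add_mono[OF dU dV]]) auto
    have "\<bar>(\<zeta> - \<zeta>') / \<kappa> * (?U s z - ?V s t z v)\<bar> \<le> (\<bar>\<zeta> - \<zeta>'\<bar> / \<kappa>) * ((K2 + K4) * s)"
      unfolding abs_mult using bVU \<kappa> by (intro mult_mono) auto
    also have "\<dots> = (K2 + K4) / \<kappa> * (s * \<bar>\<zeta> - \<zeta>'\<bar>)" by simp
    also have "\<dots> \<le> (K2 + K4) / \<kappa> * (s * ?d)"
      using K2 K34 \<kappa> s0 by (intro mult_left_mono) auto
    finally have 3: "\<bar>(\<zeta> - \<zeta>') / \<kappa> * (?U s z - ?V s t z v)\<bar> \<le> (K2 + K4) / \<kappa> * (s * ?d)" .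
    have "nonlin p \<sigma> e c P \<kappa> s \<zeta> t z v - nonlin p \<sigma> e c P \<kappa> s \<zeta>' t z' v' =
        c * (?V s t z v - ?V s t z' v') + (P + \<zeta>' / \<kappa>) * ((?U s z - ?U s z') - (?V s t z v - ?V s t z' v')) +
        (\<zeta> - \<zeta>') / \<kappa> * (?U s z - ?V s t z v)"
      unfolding nonlin_def diff_divide_distrib by (rule alg)
    then have "\<bar>nonlin p \<sigma> e c P \<kappa> s \<zeta> t z v - nonlin p \<sigma> e c P \<kappa> s \<zeta>' t z' v'\<bar> \<le>
        \<bar>c\<bar> * (K1 * (s * ?d)) + Pm * (K3 * (s * ?d) + K1 * (s * ?d)) + (K2 + K4) / \<kappa> * (s * ?d)"
      using 1 2 3 by (rule tri)
    also have "\<dots> = (\<bar>c\<bar> * K1 + Pm * (K3 + K1) + (K2 + K4) / \<kappa>) * (s * ?d)"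
      by (simp only: distrib_right mult.assoc distrib_left[of Pm])
    also have "\<dots> \<le> K * (s * ?d)"
      using s0 by (intro mult_right_mono Kl) auto
    finally show "\<bar>nonlin p \<sigma> e c P \<kappa> s \<zeta> t z v - nonlin p \<sigma> e c P \<kappa> s \<zeta>' t z' v'\<bar> \<le> K * s * ?d"
      by (simp add: mult.assoc)
  next
    fix s s' \<zeta> t z v :: real
    assume s: "s \<in> {0..s1}" "s' \<in> {0..s1}" and \<zeta>: "\<bar>\<zeta>\<bar> \<le> 1" and t: "t \<in> {-1..1}" and z: "\<bar>z\<bar> \<le> R" "\<bar>v\<bar> \<le> R"
    have 1: "\<bar>c * (?V s t z v - ?V s' t z v)\<bar> \<le> \<bar>c\<bar> * (K2 * \<bar>s - s'\<bar>)"
      unfolding abs_mult by (intro mult_left_mono Vs[OF s t z]) auto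
    have 2: "\<bar>(P + \<zeta> / \<kappa>) * ((?U s z - ?U s' z) - (?V s t z v - ?V s' t z v))\<bar> \<le> Pm * (K4 * \<bar>s - s'\<bar> + K2 * \<bar>s - s'\<bar>)"
      unfolding abs_mult using Pb[OF \<zeta>] Pm
      by (intro mult_mono order_trans[OF abs_triangle_ineq4 add_mono[OF Us[OF s z(1)] Vs[OF s t z]]]) auto
    have "nonlin p \<sigma> e c P \<kappa> s \<zeta> t z v - nonlin p \<sigma> e c P \<kappa> s' \<zeta> t z v =
        c * (?V s t z v - ?V s' t z v) + (P + \<zeta> / \<kappa>) * ((?U s z - ?U s' z) - (?V s t z v - ?V s' t z v)) + 0"
      using alg[of "?V s t z v" "\<zeta> / \<kappa>" "?U s z" "?V s' t z v" "\<zeta> / \<kappa>" "?U s' z"]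
      unfolding nonlin_def by (simp only: diff_self mult_zero_left)
    then have "\<bar>nonlin p \<sigma> e c P \<kappa> s \<zeta> t z v - nonlin p \<sigma> e c P \<kappa> s' \<zeta> t z v\<bar> \<le>
        \<bar>c\<bar> * (K2 * \<bar>s - s'\<bar>) + Pm * (K4 * \<bar>s - s'\<bar> + K2 * \<bar>s - s'\<bar>) + 0"
      using 1 2 by (rule tri) simp
    also have "\<dots> = (\<bar>c\<bar> * K2 + Pm * (K4 + K2)) * \<bar>s - s'\<bar>"
      by (simp only: distrib_right mult.assoc distrib_left[of Pm] add_0_right)
    also have "\<dots> \<le> K * \<bar>s - s'\<bar>"
      by (intro mult_right_mono Ks) auto
    finally show "\<bar>nonlin p \<sigma> e c P \<kappa> s \<zeta> t z v - nonlin p \<sigma> e c P \<kappa> s' \<zeta> t z v\<bar> \<le> K * \<bar>s - s'\<bar>" .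
    qed
  next
    fix s \<zeta> :: real and z v :: "real \<Rightarrow> real"
    assume s: "s \<in> {0..s1}" and c: "continuous_on {-1..1} z" "continuous_on {-1..1} v"
      and zv: "\<And>t. t \<in> {-1..1} \<Longrightarrow> \<bar>z t\<bar> \<le> R \<and> \<bar>v t\<bar> \<le> R"
    have nz: "1 + s * x \<noteq> 0" if "\<bar>x\<bar> \<le> B" for x
    proof -
      have "\<bar>s * x\<bar> \<le> s * B" using s that by (auto simp: abs_mult intro!: mult_left_mono)
      then show ?thesis using s1B[OF s] by linarith
    qed
    have nzz: "1 + s * z t \<noteq> 0" if "t \<in> {-1..1}" for t
      using zv[OF that] B(2) by (intro nz) auto
    show "continuous_on {-1..1} (\<lambda>t. nonlin p \<sigma> e c P \<kappa> s \<zeta> t (z t) (v t))"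
    proof (cases "s = 0")
      case False
      have cY: "continuous_on {-1..1} (\<lambda>t. ?Y s t (z t) (v t))"
        unfolding rem_arg_def by (intro continuous_intros c)
      have "continuous_on {-1..1} (\<lambda>t. scaled_rem \<sigma> s (?Y s t (z t) (v t)))"
        unfolding scaled_rem_def pow_rem_def using False nz Yb[OF s] zv
        by (intro continuous_intros cY) auto
      moreover have "continuous_on {-1..1} (\<lambda>t. scaled_rem p s (z t))"
        unfolding scaled_rem_def pow_rem_def using False nzz
        by (intro continuous_intros c) auto
      ultimately show ?thesis
        unfolding nonlin_def grad_rem_def by (intro continuous_intros c)
    qed (simp add: nonlin_0)
  qed
qed

section \<open>Zonal functions on the sphere\<close>

text \<open>A product rule at a zero of v that asks only continuity of u. It serves at the poles,
  where y is merely known to be continuous while its factor vanishes.\<close>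

lemma has_derivative_mult_null:
  fixes u v :: "'a::real_normed_vector \<Rightarrow> real"
  assumes u: "continuous (at x within S) u" and v: "(v has_derivative v') (at x within S)" and v0: "v x = 0"
  shows "((\<lambda>x. u x * v x) has_derivative (\<lambda>h. u x * v' h)) (at x within S)"
proof -
  have bl: "bounded_linear v'" using v by (rule has_derivative_bounded_linear)
  obtain K where K: "\<And>h. norm (v' h) \<le> norm h * K" using bounded_linear.bounded[OF bl] by blast
  have u': "(u \<longlongrightarrow> u x) (at x within S)" using u by (simp add: continuous_within)
  have l1: "((\<lambda>y. (v y - v x - v' (y - x)) /\<^sub>R norm (y - x)) \<longlongrightarrow> 0) (at x within S)"
    using v unfolding has_derivative_within by (simp add: inverse_eq_divide diff_diff_eq)
  have "((\<lambda>y. u y * ((v y - v x - v' (y - x)) /\<^sub>R norm (y - x))) \<longlongrightarrow> u x * 0) (at x within S)"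
    by (rule tendsto_mult[OF u' l1])
  moreover have "((\<lambda>y. (u y - u x) * (v' (y - x) /\<^sub>R norm (y - x))) \<longlongrightarrow> 0) (at x within S)"
  proof (rule tendsto_0_le[where f = "\<lambda>y. u y - u x" and K = "\<bar>K\<bar>"])
    show "((\<lambda>y. u y - u x) \<longlongrightarrow> 0) (at x within S)" using u' by (simp add: LIM_zero)
    show "\<forall>\<^sub>F y in at x within S. norm ((u y - u x) * (v' (y - x) /\<^sub>R norm (y - x))) \<le> norm (u y - u x) * \<bar>K\<bar>"
    proof (rule always_eventually, rule allI)
      fix y
      have "norm (v' (y - x) /\<^sub>R norm (y - x)) \<le> \<bar>K\<bar>"
      proof (cases "y = x")
        case False
        have "norm (v' (y - x)) \<le> norm (y - x) * \<bar>K\<bar>"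
          using K[of "y - x"] mult_left_mono[OF abs_ge_self[of K], of "norm (y - x)"] by simp
        then show ?thesis using False by (simp add: field_simps)
      qed simp
      then show "norm ((u y - u x) * (v' (y - x) /\<^sub>R norm (y - x))) \<le> norm (u y - u x) * \<bar>K\<bar>"
        unfolding norm_mult by (intro mult_left_mono) auto
    qed
  qed
  ultimately have "((\<lambda>y. u y * ((v y - v x - v' (y - x)) /\<^sub>R norm (y - x)) + (u y - u x) * (v' (y - x) /\<^sub>R norm (y - x))) \<longlongrightarrow> 0) (at x within S)"
    using tendsto_add by fastforce
  then have "((\<lambda>y. (u y * v y - u x * v x - u x * v' (y - x)) /\<^sub>R norm (y - x)) \<longlongrightarrow> 0) (at x within S)"
    by (rule Lim_transform_eventually) (auto simp: v0 algebra_simps intro!: always_eventually)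
  then show ?thesis
    unfolding has_derivative_within using bounded_linear_const_mult[OF bl]
    by (simp add: inverse_eq_divide diff_diff_eq)
qed

text \<open>The derivative of (1 - t^2) y at a pole is computed twice: by the product rule at a zero
  it is -2 t y t, and the equation prescribes another expression.\<close>

lemma zonal_sol_endpoint:
  assumes sol: "zonal_sol d l h w y" and t: "t = 1 \<or> t = -1"
  shows "d * t * y t = l * w t + h t"
proof -
  have tI: "t \<in> {-1..1}" and t2: "t\<^sup>2 = 1" using t by auto
  have "continuous (at t within {-1..1}) y"
    using zonal_solD(1)[OF sol] tI by (simp add: continuous_on_eq_continuous_within)
  moreover have "((\<lambda>t. 1 - t\<^sup>2) has_derivative (\<lambda>h. - 2 * t * h)) (at t within {-1..1})"
    by (auto intro!: derivative_eq_intros)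
  ultimately have "((\<lambda>t. y t * (1 - t\<^sup>2)) has_derivative (\<lambda>h. y t * (- 2 * t * h))) (at t within {-1..1})"
    by (rule has_derivative_mult_null) (simp add: t2)
  then have 1: "((\<lambda>t. (1 - t\<^sup>2) * y t) has_vector_derivative (- 2 * t * y t)) (at t within {-1..1})"
    by (simp add: has_vector_derivative_def mult.commute mult.left_commute)
  have 2: "((\<lambda>t. (1 - t\<^sup>2) * y t) has_vector_derivative ((real d - 2) * t * y t - l * w t - h t)) (at t within {-1..1})"
    using zonal_solD(4)[OF sol tI] by (simp add: has_real_derivative_iff_has_vector_derivative)
  have "- 2 * t * y t = (real d - 2) * t * y t - l * w t - h t"
    by (rule vector_derivative_unique_within_closed_interval[OF _ _ 1[folded cbox_interval] 2[folded cbox_interval]])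
      (use tI in \<open>auto simp: cbox_interval\<close>)
  then show ?thesis by (simp add: algebra_simps)
qed

section \<open>Differential calculus of the height and of zonal functions\<close>

lemma partial_eq: "(f has_derivative f') (at x) \<Longrightarrow> partial b f x = f' b"
  unfolding partial_def using frechet_derivative_at[of f f' x] by simp

context
  fixes e :: "'a::euclidean_space"
  assumes e: "norm e = 1"
begin

text \<open>The extension of \<open>\<sigma> \<bullet> e\<close> that is homogeneous of degree 0.\<close>

definition height :: "'a \<Rightarrow> real" where
  "height x = (x \<bullet> e) * inverse (norm x)"

definition height_grad :: "'a \<Rightarrow> 'a" where
  "height_grad x = inverse (norm x) *\<^sub>R e - ((x \<bullet> e) * inverse (norm x) ^ 3) *\<^sub>R x"

definition height_hess :: "'a \<Rightarrow> 'a \<Rightarrow> 'a \<Rightarrow> real" where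
  "height_hess x b c = 3 * (x \<bullet> e) * (b \<bullet> x) * (x \<bullet> c) * inverse (norm x) ^ 5
     - ((b \<bullet> e) * (x \<bullet> c) + (c \<bullet> e) * (b \<bullet> x) + (x \<bullet> e) * (b \<bullet> c)) * inverse (norm x) ^ 3"

text \<open>The gradient degenerates at the poles exactly like the square root of 1 - height^2. This
  keeps the quotient in the second derivatives of a zonal function bounded.\<close>

lemma height_grad_norm:
  assumes x: "x \<noteq> 0"
  shows "(norm (height_grad x))\<^sup>2 = (1 - (height x)\<^sup>2) * inverse (norm x) ^ 2"
proof -
  let ?i = "inverse (norm x)" and ?a = "x \<bullet> e"
  have ee: "e \<bullet> e = 1" using e by (simp add: norm_eq_1)
  have "(norm (height_grad x))\<^sup>2 = ?i ^ 2 - 2 * ?a\<^sup>2 * ?i ^ 4 + ?a\<^sup>2 * ?i ^ 6 * (x \<bullet> x)"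
    unfolding power2_norm_eq_inner height_grad_def
    by (simp add: inner_diff_left inner_diff_right ee inner_commute[of e x] eval_nat_numeral algebra_simps)
  also have "?i ^ 6 * (x \<bullet> x) = ?i ^ 4"
  proof -
    have "?i ^ 2 * (x \<bullet> x) = 1" using x by (simp add: power2_norm_eq_inner[symmetric] power_inverse)
    then have "?i ^ 4 * (?i ^ 2 * (x \<bullet> x)) = ?i ^ 4" by simp
    then show ?thesis by (simp add: eval_nat_numeral mult.assoc)
  qed
  then have "?a\<^sup>2 * ?i ^ 6 * (x \<bullet> x) = ?a\<^sup>2 * ?i ^ 4" by (simp add: mult.assoc)
  finally show ?thesis unfolding height_def by (simp add: eval_nat_numeral algebra_simps)
qed

lemma height_bound: "height x \<in> {-1..1}"
proof -
  have "\<bar>x \<bullet> e\<bar> \<le> norm x" using Cauchy_Schwarz_ineq2[of x e] e by simp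
  then have "\<bar>height x\<bar> \<le> 1"
    by (cases "x = 0") (auto simp: height_def abs_mult inverse_eq_divide divide_le_eq_1)
  then show ?thesis by (auto simp: abs_le_iff)
qed

lemma inverse_norm_has_derivative:
  "x \<noteq> 0 \<Longrightarrow> ((\<lambda>x. inverse (norm x)) has_derivative (\<lambda>h. - (x \<bullet> h) * inverse (norm x) ^ 3)) (at x)"
  for x :: 'a
  by (rule has_derivative_eq_rhs, rule Deriv.has_derivative_inverse[OF _ has_derivative_norm])
    (auto simp: fun_eq_iff sgn_div_norm inner_commute eval_nat_numeral)

lemma height_has_derivative:
  assumes x: "x \<noteq> 0"
  shows "(height has_derivative (\<lambda>h. h \<bullet> height_grad x)) (at x)"
proof -
  have "((\<lambda>x. (x \<bullet> e) * inverse (norm x)) has_derivative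
      (\<lambda>h. (x \<bullet> e) * (- (x \<bullet> h) * inverse (norm x) ^ 3) + (h \<bullet> e) * inverse (norm x))) (at x)"
    by (rule has_derivative_mult[OF _ inverse_norm_has_derivative[OF x]]) (auto intro!: derivative_eq_intros)
  then show ?thesis
    unfolding height_def[abs_def]
    by (rule has_derivative_eq_rhs)
      (auto simp: fun_eq_iff height_grad_def inner_diff_right inner_commute algebra_simps)
qed

lemma height_grad_has_derivative:
  assumes x: "x \<noteq> 0"
  shows "((\<lambda>x. b \<bullet> height_grad x) has_derivative height_hess x b) (at x)"
proof -
  let ?i = "\<lambda>x. inverse (norm x)"
  note i = inverse_norm_has_derivative[OF x]
  have i3: "((\<lambda>x. ?i x ^ 3) has_derivative (\<lambda>h. 3 * (- (x \<bullet> h) * ?i x ^ 3) * ?i x ^ 2)) (at x)"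
    using has_derivative_power[OF i, of 3] by simp
  have "((\<lambda>x. (b \<bullet> e) * ?i x - ((x \<bullet> e) * (b \<bullet> x)) * ?i x ^ 3) has_derivative
      (\<lambda>h. (b \<bullet> e) * (- (x \<bullet> h) * ?i x ^ 3) -
        (((x \<bullet> e) * (b \<bullet> x)) * (3 * (- (x \<bullet> h) * ?i x ^ 3) * ?i x ^ 2) +
         ((x \<bullet> e) * (b \<bullet> h) + (h \<bullet> e) * (b \<bullet> x)) * ?i x ^ 3))) (at x)"
    by (intro has_derivative_diff has_derivative_mult i3 has_derivative_mult_right[OF i]) (auto intro!: derivative_eq_intros)
  moreover have "(\<lambda>x. (b \<bullet> e) * ?i x - ((x \<bullet> e) * (b \<bullet> x)) * ?i x ^ 3) = (\<lambda>x. b \<bullet> height_grad x)"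
    by (auto simp: fun_eq_iff height_grad_def inner_diff_right)
  ultimately show ?thesis
    by (simp only:) (erule has_derivative_eq_rhs, auto simp: fun_eq_iff height_hess_def eval_nat_numeral algebra_simps)
qed


lemma continuous_height: "continuous_on (- {0}) height"
  using height_has_derivative by (auto intro!: continuous_at_imp_continuous_on has_derivative_continuous)

lemma continuous_height_grad: "continuous_on (- {0}) (\<lambda>x. b \<bullet> height_grad x)"
  using height_grad_has_derivative by (auto intro!: continuous_at_imp_continuous_on has_derivative_continuous)

lemma continuous_height_hess: "continuous_on (- {0}) (\<lambda>x. height_hess x b c)"
  unfolding height_hess_def by (intro continuous_intros) auto

lemma height_grad_le:
  assumes x: "x \<noteq> 0" and b: "norm b = 1"
  shows "(b \<bullet> height_grad x)\<^sup>2 \<le> (1 - (height x)\<^sup>2) * inverse (norm x) ^ 2"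
proof -
  have "\<bar>b \<bullet> height_grad x\<bar> \<le> norm (height_grad x)"
    using Cauchy_Schwarz_ineq2[of b "height_grad x"] b by simp
  then have "(b \<bullet> height_grad x)\<^sup>2 \<le> (norm (height_grad x))\<^sup>2"
    by (metis abs_le_square_iff abs_norm_cancel)
  then show ?thesis using height_grad_norm[OF x] by simp
qed

lemma height_grad_pole: "x \<noteq> 0 \<Longrightarrow> (height x)\<^sup>2 = 1 \<Longrightarrow> height_grad x = 0"
  using height_grad_norm[of x] by simp

definition zonal :: "(real \<Rightarrow> real) \<Rightarrow> 'a \<Rightarrow> real" where
  "zonal f \<sigma> = f (\<sigma> \<bullet> e)"

lemma radial_ext_zonal: "radial_ext (zonal f) = (\<lambda>x. f (height x))"
  by (auto simp: radial_ext_def zonal_def height_def fun_eq_iff mult.commute)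

text \<open>
  The second derivatives of \<open>f (height x)\<close>, where \<open>y\<close> is the derivative of \<open>f\<close> and \<open>k = (1 - t\<^sup>2) y'\<close>.
  Nothing is known about \<open>y'\<close> at the poles, but \<open>k\<close> vanishes there.
\<close>

definition zonal_hess :: "(real \<Rightarrow> real) \<Rightarrow> (real \<Rightarrow> real) \<Rightarrow> 'a \<Rightarrow> 'a \<Rightarrow> 'a \<Rightarrow> real" where
  "zonal_hess k y x b c =
     (if (height x)\<^sup>2 = 1 then 0
      else k (height x) * (((c \<bullet> height_grad x) * (b \<bullet> height_grad x)) / (1 - (height x)\<^sup>2)))
     + y (height x) * height_hess x b c"

context
  fixes d :: nat and l :: real and h f y :: "real \<Rightarrow> real"
  assumes sol: "zonal_sol d l h f y" and ch: "continuous_on {-1..1} h"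
begin

lemma zonal_has_derivative:
  assumes x: "x \<noteq> 0"
  shows "((\<lambda>x. f (height x)) has_derivative (\<lambda>h. y (height x) * (h \<bullet> height_grad x))) (at x)"
proof -
  \<comment> \<open>At \<plusminus>1 only a one-sided derivative of f exists. That suffices, because
    the height never leaves [-1,1].\<close>
  have "(f has_derivative (*) (y (height x))) (at (height x) within height ` UNIV)"
    using zonal_solD(3)[OF sol height_bound[of x]] height_bound
    by (auto simp: has_field_derivative_def intro: has_derivative_subset)
  from has_derivative_in_compose[OF height_has_derivative[OF x] this]
  show ?thesis by simp
qed

lemma partial_zonal: "x \<noteq> 0 \<Longrightarrow> partial b (\<lambda>x. f (height x)) x = y (height x) * (b \<bullet> height_grad x)"
  using partial_eq[OF zonal_has_derivative] by simp

lemma continuous_height_compose: "continuous_on {-1..1} g \<Longrightarrow> continuous_on (- {0}) (\<lambda>x. g (height x))"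
  by (rule continuous_on_compose2[OF _ continuous_height]) (use height_bound in auto)

lemma C1_zonal: "C1_on (- {0}) (\<lambda>x. f (height x))"
  unfolding C1_on_def
proof (intro conjI ballI)
  fix x :: 'a assume "x \<in> - {0}"
  then show "(\<lambda>x. f (height x)) differentiable at x"
    using zonal_has_derivative[of x] by (auto simp: differentiable_def)
next
  fix b :: 'a
  have "continuous_on (- {0}) (\<lambda>x. y (height x) * (b \<bullet> height_grad x))"
    by (intro continuous_intros continuous_height_compose zonal_solD(1)[OF sol] continuous_height_grad)
  then show "continuous_on (- {0}) (partial b (\<lambda>x. f (height x)))"
    by (rule continuous_on_eq) (simp add: partial_zonal)
qed

text \<open>This is (1 - t^2) y' as given by the equation, an expression that stays meaningful and
  continuous at the poles.\<close>

definition zonal_rhs :: "real \<Rightarrow> real" where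
  "zonal_rhs t = real d * t * y t - l * f t - h t"

lemma zonal_rhs_pole: "t\<^sup>2 = 1 \<Longrightarrow> zonal_rhs t = 0"
  using zonal_sol_endpoint[OF sol, of t] by (auto simp: zonal_rhs_def power2_eq_1_iff)

lemma continuous_zonal_rhs: "continuous_on {-1..1} zonal_rhs"
  unfolding zonal_rhs_def[abs_def] by (intro continuous_intros zonal_solD(1,2)[OF sol] ch)

lemma partial_zonal_has_derivative:
  assumes x: "x \<noteq> 0"
  shows "(partial b (\<lambda>x. f (height x)) has_derivative zonal_hess zonal_rhs y x b) (at x)"
proof -
  have "((\<lambda>x. y (height x) * (b \<bullet> height_grad x)) has_derivative zonal_hess zonal_rhs y x b) (at x)"
  proof (cases "(height x)\<^sup>2 = 1")
    case True
    \<comment> \<open>At a pole the gradient of the height vanishes, so continuity of y is enough to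
      differentiate the product.\<close>
    have "continuous (at x) (\<lambda>x. y (height x))"
      using continuous_height_compose[OF zonal_solD(1)[OF sol]] x
      by (simp add: continuous_on_eq_continuous_at open_Compl)
    from has_derivative_mult_null[OF this height_grad_has_derivative[OF x]]
    show ?thesis using height_grad_pole[OF x True] True by (simp add: zonal_hess_def[abs_def])
  next
    case False
    then have t: "height x \<in> {-1<..<1}"
      using height_bound[of x] by (auto simp: power2_eq_1_iff less_le)
    have "(y has_derivative (*) (zonal_rhs (height x) / (1 - (height x)\<^sup>2))) (at (height x))"
      using zonal_sol_interior(2)[OF sol t] by (simp add: has_field_derivative_def zonal_rhs_def)
    from has_derivative_mult[OF has_derivative_compose[OF height_has_derivative[OF x] this] height_grad_has_derivative[OF x]]
    show ?thesis
      by (rule has_derivative_eq_rhs) (auto simp: fun_eq_iff zonal_hess_def False)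
  qed
  then show ?thesis
    by (rule has_derivative_transform_within_open[of _ _ _ _ "- {0}"]) (use x in \<open>auto simp: partial_zonal\<close>)
qed

text \<open>Each gradient factor is at most the square root of 1 - height^2, divided by |x|, so the
  quotient is bounded by |x|^(-2). It is multiplied by \<open>zonal_rhs\<close>, which tends to 0 at
  the poles; the product therefore extends continuously by 0.\<close>

lemma continuous_zonal_hess:
  assumes b: "norm b = 1" "norm c = 1"
  shows "continuous_on (- {0}) (\<lambda>x. zonal_hess zonal_rhs y x b c)"
proof -
  define M where "M x = ((c \<bullet> height_grad x) * (b \<bullet> height_grad x)) / (1 - (height x)\<^sup>2)" for x
  define Q where "Q x = (if (height x)\<^sup>2 = 1 then 0 else zonal_rhs (height x) * M x)" for x
  have h1: "(height x)\<^sup>2 \<le> 1" for x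
    using height_bound[of x] by (simp add: abs_square_le_1 abs_le_iff)
  have Mb: "\<bar>M x\<bar> \<le> inverse (norm x) ^ 2" if x: "x \<noteq> 0" "(height x)\<^sup>2 \<noteq> 1" for x
  proof -
    let ?B = "(1 - (height x)\<^sup>2) * inverse (norm x) ^ 2"
    have pos: "1 - (height x)\<^sup>2 > 0" using h1[of x] x(2) by simp
    have "\<bar>(c \<bullet> height_grad x) * (b \<bullet> height_grad x)\<bar> \<le> ((c \<bullet> height_grad x)\<^sup>2 + (b \<bullet> height_grad x)\<^sup>2) / 2"
      using sum_squares_bound[of "\<bar>c \<bullet> height_grad x\<bar>" "\<bar>b \<bullet> height_grad x\<bar>"] by (simp add: abs_mult)
    also have "\<dots> \<le> ?B" using height_grad_le[OF x(1) b(1)] height_grad_le[OF x(1) b(2)] by simp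
    finally show ?thesis using pos by (simp add: M_def divide_le_eq mult.commute)
  qed
  have cr: "continuous_on (- {0}) (\<lambda>x. zonal_rhs (height x))"
    by (rule continuous_height_compose[OF continuous_zonal_rhs])
  have "isCont Q x" if x: "x \<noteq> 0" for x
  proof (cases "(height x)\<^sup>2 = 1")
    case False
    have op: "open {x \<in> - {0}. (height x)\<^sup>2 \<noteq> 1}"
    proof -
      have "open (- {0} \<inter> (\<lambda>x. (height x)\<^sup>2) -` (- {1}))"
        by (rule continuous_open_preimage) (auto intro!: continuous_intros continuous_height)
      moreover have "- {0} \<inter> (\<lambda>x. (height x)\<^sup>2) -` (- {1}) = {x \<in> - {0}. (height x)\<^sup>2 \<noteq> 1}" by auto
      ultimately show ?thesis by simp
    qed
    have "continuous_on {x \<in> - {0}. (height x)\<^sup>2 \<noteq> 1} (\<lambda>x. zonal_rhs (height x) * M x)"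
      unfolding M_def
      by (intro continuous_intros continuous_on_subset[OF cr] continuous_on_subset[OF continuous_height_grad]
          continuous_on_subset[OF continuous_height]) auto
    then have "continuous_on {x \<in> - {0}. (height x)\<^sup>2 \<noteq> 1} Q"
      by (rule continuous_on_eq) (simp add: Q_def)
    then show ?thesis using op x False by (simp add: continuous_on_eq_continuous_at)
  next
    case True
    have Q0: "Q x = 0" using True by (simp add: Q_def)
    have "isCont (\<lambda>x. zonal_rhs (height x)) x"
      using cr x by (simp add: continuous_on_eq_continuous_at open_Compl)
    then have rx: "((\<lambda>x. zonal_rhs (height x)) \<longlongrightarrow> 0) (at x)"
      using zonal_rhs_pole[OF True] by (simp add: isCont_def)
    have ix: "((\<lambda>x. inverse (norm x) ^ 2) \<longlongrightarrow> inverse (norm x) ^ 2) (at x)"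
      using x by (auto intro!: tendsto_intros)
    have lim: "((\<lambda>x. zonal_rhs (height x) * inverse (norm x) ^ 2) \<longlongrightarrow> 0) (at x)"
      using tendsto_mult[OF rx ix] by simp
    have "(Q \<longlongrightarrow> 0) (at x)"
    proof (rule tendsto_0_le[OF lim, of _ 1])
      have "\<forall>\<^sub>F z in at x. z \<noteq> 0"
        by (rule tendsto_imp_eventually_ne[OF tendsto_ident_at x])
      then show "\<forall>\<^sub>F z in at x. norm (Q z) \<le> norm (zonal_rhs (height z) * inverse (norm z) ^ 2) * 1"
      proof eventually_elim
        case (elim z)
        show ?case
        proof (cases "(height z)\<^sup>2 = 1")
          case False
          have "\<bar>zonal_rhs (height z)\<bar> * \<bar>M z\<bar> \<le> \<bar>zonal_rhs (height z)\<bar> * inverse (norm z) ^ 2"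
            by (rule mult_left_mono[OF Mb[OF elim False]]) simp
          then show ?thesis using False by (simp add: Q_def abs_mult)
        qed (simp add: Q_def)
      qed
    qed
    then show ?thesis using Q0 by (simp add: isCont_def)
  qed
  then have "continuous_on (- {0}) Q" by (simp add: continuous_at_imp_continuous_on)
  then have "continuous_on (- {0}) (\<lambda>x. Q x + y (height x) * height_hess x b c)"
    by (intro continuous_intros continuous_height_compose zonal_solD(1)[OF sol] continuous_height_hess)
  then show ?thesis unfolding zonal_hess_def Q_def M_def .
qed

lemma C2_sphere_zonal: "C2_sphere (zonal f)"
  unfolding C2_sphere_def C2_on_def radial_ext_zonal
proof (intro conjI ballI C1_zonal)
  fix b :: 'a assume b: "b \<in> Basis"
  show "C1_on (- {0}) (partial b (\<lambda>x. f (height x)))"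
    unfolding C1_on_def
  proof (intro conjI ballI)
    fix x :: 'a assume "x \<in> - {0}"
    then show "partial b (\<lambda>x. f (height x)) differentiable at x"
      using partial_zonal_has_derivative[of x b] by (auto simp: differentiable_def)
  next
    fix c :: 'a assume c: "c \<in> Basis"
    have "continuous_on (- {0}) (\<lambda>x. zonal_hess zonal_rhs y x b c)"
      using b c by (intro continuous_zonal_hess) auto
    then show "continuous_on (- {0}) (partial c (partial b (\<lambda>x. f (height x))))"
      by (rule continuous_on_eq) (simp add: partial_eq[OF partial_zonal_has_derivative])
  qed
qed

lemma sph_grad_zonal:
  assumes \<sigma>: "\<sigma> \<in> sphere 0 1"
  shows "sph_grad (zonal f) \<sigma> = y (\<sigma> \<bullet> e) *\<^sub>R (e - (\<sigma> \<bullet> e) *\<^sub>R \<sigma>)"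
proof -
  have n: "norm \<sigma> = 1" "\<sigma> \<noteq> 0" using \<sigma> by auto
  have "sph_grad (zonal f) \<sigma> = (\<Sum>b\<in>Basis. (y (height \<sigma>) * (height_grad \<sigma> \<bullet> b)) *\<^sub>R b)"
    unfolding sph_grad_def radial_ext_zonal by (simp add: partial_zonal[OF n(2)] inner_commute)
  also have "\<dots> = y (height \<sigma>) *\<^sub>R (\<Sum>b\<in>Basis. (height_grad \<sigma> \<bullet> b) *\<^sub>R b)"
    by (simp add: scaleR_sum_right)
  also have "\<dots> = y (height \<sigma>) *\<^sub>R height_grad \<sigma>" by (simp add: euclidean_representation)
  finally show ?thesis using n by (simp add: height_def height_grad_def)
qed

lemma norm_sph_grad_zonal:
  assumes \<sigma>: "\<sigma> \<in> sphere 0 1"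
  shows "(norm (sph_grad (zonal f) \<sigma>))\<^sup>2 = (1 - (\<sigma> \<bullet> e)\<^sup>2) * (y (\<sigma> \<bullet> e))\<^sup>2"
proof -
  have n: "norm \<sigma> = 1" "\<sigma> \<noteq> 0" using \<sigma> by auto
  have "(norm (e - (\<sigma> \<bullet> e) *\<^sub>R \<sigma>))\<^sup>2 = 1 - (\<sigma> \<bullet> e)\<^sup>2"
    using height_grad_norm[OF n(2)] n by (simp add: height_def height_grad_def)
  then show ?thesis unfolding sph_grad_zonal[OF \<sigma>] by (simp add: power_mult_distrib mult.commute)
qed

text \<open>Traces on the unit sphere: the Hessian of the height has trace - d t and its squared
  gradient is 1 - t^2. The sum is (1 - t^2) y' - d t y, which the equation evaluates; at a pole the
  endpoint relation takes over.\<close>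

lemma sph_laplacian_zonal:
  assumes \<sigma>: "\<sigma> \<in> sphere 0 1" and d: "DIM('a) = Suc d"
  shows "sph_laplacian (zonal f) \<sigma> = - (l * f (\<sigma> \<bullet> e) + h (\<sigma> \<bullet> e))"
proof -
  have n: "norm \<sigma> = 1" "\<sigma> \<noteq> 0" using \<sigma> by auto
  have ht: "height \<sigma> = \<sigma> \<bullet> e" using n by (simp add: height_def)
  let ?t = "\<sigma> \<bullet> e"
  have ss: "\<sigma> \<bullet> \<sigma> = 1" using n by (simp add: norm_eq_1)
  have lap: "sph_laplacian (zonal f) \<sigma> = (\<Sum>b\<in>Basis. zonal_hess zonal_rhs y \<sigma> b b)"
    unfolding sph_laplacian_def radial_ext_zonal by (simp add: partial_eq[OF partial_zonal_has_derivative[OF n(2)]])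
  have "(\<Sum>b\<in>Basis. height_hess \<sigma> b b) =
     (\<Sum>b\<in>Basis. 3 * ?t * ((\<sigma> \<bullet> b) * (\<sigma> \<bullet> b)) - 2 * ((\<sigma> \<bullet> b) * (e \<bullet> b)) - ?t)"
    using n by (intro sum.cong) (auto simp: height_hess_def inner_commute algebra_simps)
  also have "\<dots> = 3 * ?t * (\<sigma> \<bullet> \<sigma>) - 2 * (\<sigma> \<bullet> e) - DIM('a) * ?t"
    unfolding sum_subtractf sum_distrib_left[symmetric] euclidean_inner[symmetric] by simp
  finally have s1: "(\<Sum>b\<in>Basis. height_hess \<sigma> b b) = - (d * ?t)"
    using ss d by (simp add: algebra_simps)
  have "(\<Sum>b\<in>Basis. (b \<bullet> height_grad \<sigma>) * (b \<bullet> height_grad \<sigma>)) = (norm (height_grad \<sigma>))\<^sup>2"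
    using euclidean_inner[of "height_grad \<sigma>" "height_grad \<sigma>"] by (simp add: power2_norm_eq_inner inner_commute)
  then have s2: "(\<Sum>b\<in>Basis. (b \<bullet> height_grad \<sigma>) * (b \<bullet> height_grad \<sigma>)) = 1 - ?t\<^sup>2"
    using height_grad_norm[OF n(2)] n ht by simp
  show ?thesis
  proof (cases "?t\<^sup>2 = 1")
    case True
    then have "sph_laplacian (zonal f) \<sigma> = (\<Sum>b\<in>Basis. y ?t * height_hess \<sigma> b b)"
      unfolding lap zonal_hess_def ht by simp
    also have "\<dots> = - (d * ?t * y ?t)" unfolding sum_distrib_left[symmetric] s1 by simp
    finally show ?thesis using zonal_rhs_pole[OF True] by (simp add: zonal_rhs_def)
  next
    case False
    have "sph_laplacian (zonal f) \<sigma> =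
      (\<Sum>b\<in>Basis. zonal_rhs ?t / (1 - ?t\<^sup>2) * ((b \<bullet> height_grad \<sigma>) * (b \<bullet> height_grad \<sigma>)) + y ?t * height_hess \<sigma> b b)"
      unfolding lap zonal_hess_def ht using False by simp
    also have "\<dots> = zonal_rhs ?t / (1 - ?t\<^sup>2) * (1 - ?t\<^sup>2) + y ?t * - (d * ?t)"
      unfolding sum.distrib sum_distrib_left[symmetric] s1 s2 ..
    finally show ?thesis using False by (simp add: zonal_rhs_def)
  qed
qed

end

end

section \<open>Bifurcation at an eigenvalue\<close>

lemma scaled_rem_mult: "s * scaled_rem \<gamma> s x = pow_rem \<gamma> (s * x)"
  by (cases "s = 0") (auto simp: scaled_rem_def)

text \<open>Comparison of the terms in powers of s: the constants agree since P + (c - P) = c, and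
  the linear factor p P + q (c - P) - c equals c (q - 1) + \<kappa> P = l + \<zeta>. Everything else
  has been collected in \<open>nonlin\<close>.\<close>

lemma reduced_equation:
  fixes p c P Z s z v t l \<zeta> :: real
  assumes p: "p > 1" and q: "q = 2 * p / (p + 1)" and \<sigma>: "\<sigma> = p / (p + 1)" and \<kappa>: "\<kappa> = p - q" and e: "e = ((p - 1) / 2)\<^sup>2"
    and P: "P = P0 + \<zeta> / \<kappa>" and l: "l = c * (q - 1) + \<kappa> * P0" and sz: "\<bar>s * z\<bar> \<le> 1/2" and t: "t \<in> {-1..1}"
  shows "s * ((l + \<zeta>) * z + nonlin p \<sigma> e c P0 \<kappa> s \<zeta> t z v) + c * (1 + s * z) =
     P * (1 + s * z) powr p + (c - P) * ((1 + s * z)\<^sup>2 + e * ((1 - t\<^sup>2) * (s * v)\<^sup>2)) powr \<sigma>"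
proof -
  have \<kappa>p: "\<kappa> \<noteq> 0" unfolding \<kappa> q using p by (simp add: field_simps)
  let ?U = "scaled_rem p s z" and ?V = "grad_rem \<sigma> e s t z v"
  have 1: "(1 + s * z) powr p = 1 + p * (s * z) + s * ?U"
    by (simp add: scaled_rem_mult pow_rem_def)
  have y: "(1 + s * z)\<^sup>2 + e * ((1 - t\<^sup>2) * (s * v)\<^sup>2) = 1 + s * rem_arg e s t z v"
    by (simp add: rem_arg_def power2_eq_square algebra_simps)
  have q2: "q = 2 * \<sigma>" by (simp add: q \<sigma>)
  have 2: "(1 + s * rem_arg e s t z v) powr \<sigma> = 1 + q * (s * z) + s * ?V"
  proof -
    have "s * ?V = \<sigma> * (s * (s * (z\<^sup>2 + e * (1 - t\<^sup>2) * v\<^sup>2))) + pow_rem \<sigma> (s * rem_arg e s t z v)"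
      unfolding grad_rem_def distrib_left scaled_rem_mult by (simp add: algebra_simps)
    then show ?thesis by (simp add: pow_rem_def q2 rem_arg_def algebra_simps)
  qed
  have \<zeta>: "\<zeta> = \<kappa> * (P - P0)" using \<kappa>p by (simp add: P)
  have n: "nonlin p \<sigma> e c P0 \<kappa> s \<zeta> t z v = c * ?V + P * (?U - ?V)"
    by (simp add: nonlin_def P)
  show ?thesis
    unfolding y 1 2 n unfolding l \<zeta> \<kappa> by (simp add: algebra_simps)
qed

text \<open>The summand \<open>0\<close> is the squared gradient of a constant.\<close>

lemma root_equation:
  fixes p M X :: real
  assumes p: "p > 1" and X: "X > 0"
  shows "2 * K_coeff N p / (p - 1) * X = X powr p + M * ((2 / (p - 1))\<^sup>2 * X\<^sup>2 + 0) powr (p / (p + 1)) \<longleftrightarrow>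
     positive_root N p M X"
proof -
  have e1: "X powr p = X * X powr (p - 1)" using X by (simp add: powr_mult_base)
  have sq: "(2 / (p - 1))\<^sup>2 * X\<^sup>2 + 0 = (2 / (p - 1) * X) powr 2"
    using p X by (simp add: power_mult_distrib power_divide)
  have "((2 / (p - 1))\<^sup>2 * X\<^sup>2 + 0) powr (p / (p + 1)) = (2 / (p - 1)) powr (2 * p / (p + 1)) * X powr (2 * p / (p + 1))"
    unfolding sq powr_powr using p X powr_mult[of "2 / (p - 1)" X "2 * p / (p + 1)"] by simp
  also have "2 * p / (p + 1) = 1 + (p - 1) / (p + 1)" using p by (simp add: field_simps)
  then have "X powr (2 * p / (p + 1)) = X * X powr ((p - 1) / (p + 1))" using X by (simp add: powr_add)
  finally have e2: "M * ((2 / (p - 1))\<^sup>2 * X\<^sup>2 + 0) powr (p / (p + 1)) = X * Phi p M X"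
    by (simp add: Phi_def)
  have "2 * K_coeff N p / (p - 1) * X = X powr p + M * ((2 / (p - 1))\<^sup>2 * X\<^sup>2 + 0) powr (p / (p + 1)) \<longleftrightarrow>
     X * (2 * K_coeff N p / (p - 1)) = X * (X powr (p - 1) + Phi p M X)"
    unfolding e1 e2 by (simp add: algebra_simps)
  also have "\<dots> \<longleftrightarrow> 2 * K_coeff N p / (p - 1) = X powr (p - 1) + Phi p M X"
    by (rule mult_left_cancel) (use X in simp)
  also have "\<dots> \<longleftrightarrow> positive_root N p M X" using X by (auto simp: positive_root_def)
  finally show ?thesis .
qed

text \<open>With the eigenvalue term on the right-hand side the left-hand operator annihilates
  constants, so that X + X s z is obtained by mere addition.\<close>

lemma zonal_sol_shift: "zonal_sol d l h w y \<Longrightarrow> zonal_sol d 0 (\<lambda>t. l * w t + h t) w y"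
  unfolding zonal_sol_def by (simp add: algebra_simps)

lemma zonal_sol_const: "zonal_sol d 0 (\<lambda>t. 0) (\<lambda>t. c) (\<lambda>t. 0)"
  unfolding zonal_sol_def by auto

text \<open>In dimension at least 2 every height is attained on the sphere. Constancy of a zonal
  function can thus be pulled back to constancy of its profile on [-1,1].\<close>

lemma sphere_heights:
  fixes e :: "'a::euclidean_space"
  assumes e: "norm e = 1" and dim: "2 \<le> DIM('a)" and t: "t \<in> {-1..1}"
  obtains \<sigma> where "\<sigma> \<in> sphere 0 1" "\<sigma> \<bullet> e = t"
proof -
  obtain b where b: "b \<noteq> 0" "orthogonal e b" using orthogonal_to_vector_exists[OF dim] by blast
  define f where "f = b /\<^sub>R norm b"
  have f: "f \<bullet> f = 1" "f \<bullet> e = 0" "e \<bullet> f = 0" "e \<bullet> e = 1"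
    using b e by (auto simp: f_def orthogonal_def inner_commute norm_eq_1 power2_norm_eq_inner[symmetric] power2_eq_square)
  define \<sigma> where "\<sigma> = t *\<^sub>R e + sqrt (1 - t\<^sup>2) *\<^sub>R f"
  have t2: "0 \<le> 1 - t\<^sup>2" using t by (simp add: abs_square_le_1 abs_le_iff)
  have "\<sigma> \<bullet> \<sigma> = 1"
    using t2 by (simp add: \<sigma>_def inner_add_left inner_add_right f power2_eq_square[symmetric] real_sqrt_mult_self flip: power2_eq_square)
  then have "\<sigma> \<in> sphere 0 1" by (simp add: norm_eq_1)
  moreover have "\<sigma> \<bullet> e = t" by (simp add: \<sigma>_def inner_add_left f)
  ultimately show thesis by (rule that)
qed

text \<open>The equation for the zonal function is X times the reduced one; each term is homogeneous
  enough to split off its power of X.\<close>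

lemma zonal_positive_solution:
  fixes e :: "'a::euclidean_space"
  assumes e: "norm e = 1" and dim: "DIM('a) = Suc d" and p: "p > 1"
    and q: "q = 2 * p / (p + 1)" and \<sigma>: "\<sigma> = p / (p + 1)" and \<kappa>: "\<kappa> = p - q" and e2: "e2 = ((p - 1) / 2)\<^sup>2"
    and c: "c = 2 * K_coeff DIM('a) p / (p - 1)"
    and P: "P = P0 + \<zeta> / \<kappa>" "P > 0" and l: "l = c * (q - 1) + \<kappa> * P0"
    and X: "X = P powr (1 / (p - 1))" and M: "Phi p M X = c - P"
    and sol: "zonal_sol d l (\<lambda>t. \<zeta> * z t + nonlin p \<sigma> e2 c P0 \<kappa> s \<zeta> t (z t) (v t)) z v"
    and cont: "continuous_on {-1..1} (\<lambda>t. nonlin p \<sigma> e2 c P0 \<kappa> s \<zeta> t (z t) (v t))"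
    and sz: "\<And>t. t \<in> {-1..1} \<Longrightarrow> \<bar>s * z t\<bar> \<le> 1/2"
  shows "positive_solution p M (zonal e (\<lambda>t. X * (1 + s * z t)))"
    and "\<sigma>' \<in> sphere 0 1 \<Longrightarrow> sph_grad (zonal e (\<lambda>t. X * (1 + s * z t))) \<sigma>' =
      (X * s * v (\<sigma>' \<bullet> e)) *\<^sub>R (e - (\<sigma>' \<bullet> e) *\<^sub>R \<sigma>')"
proof -
  let ?u = "\<lambda>t. X * (1 + s * z t)" and ?w = "\<lambda>t. X * s * v t"
  let ?N = "\<lambda>t. nonlin p \<sigma> e2 c P0 \<kappa> s \<zeta> t (z t) (v t)"
  let ?h = "\<lambda>t. X * s * (l * z t + (\<zeta> * z t + ?N t))"
  have Xpos: "X > 0" using P(2) by (simp add: X)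
  have "zonal_sol d 0 (\<lambda>t. 0 + X * s * (l * z t + (\<zeta> * z t + ?N t))) (\<lambda>t. X + X * s * z t) (\<lambda>t. 0 + X * s * v t)"
    by (intro zonal_sol_add zonal_sol_const zonal_sol_cmult zonal_sol_shift sol)
  then have us: "zonal_sol d 0 ?h ?u ?w" by (simp add: algebra_simps)
  have ch: "continuous_on {-1..1} ?h"
    by (intro continuous_intros cont zonal_solD(2)[OF sol])
  note Z = us ch
  show grad: "\<sigma>' \<in> sphere 0 1 \<Longrightarrow> sph_grad (zonal e ?u) \<sigma>' = ?w (\<sigma>' \<bullet> e) *\<^sub>R (e - (\<sigma>' \<bullet> e) *\<^sub>R \<sigma>')" for \<sigma>'
    using sph_grad_zonal[OF e Z] by simp
  show "positive_solution p M (zonal e ?u)"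
    unfolding positive_solution_def
  proof (intro conjI ballI)
    show "C2_sphere (zonal e ?u)" by (rule C2_sphere_zonal[OF e Z])
    fix \<tau> :: 'a assume \<tau>: "\<tau> \<in> sphere 0 1"
    define t where "t = \<tau> \<bullet> e"
    have t: "t \<in> {-1..1}"
      using Cauchy_Schwarz_ineq2[of \<tau> e] e \<tau> by (auto simp: t_def abs_le_iff)
    have pos: "1 + s * z t > 0" using sz[OF t] by (simp add: abs_le_iff)
    show "0 < zonal e ?u \<tau>" using Xpos pos e by (simp add: zonal_def[OF e] t_def)
    have lap: "sph_laplacian (zonal e ?u) \<tau> = - ?h t"
      using sph_laplacian_zonal[OF e Z \<tau> dim] by (simp add: t_def)
    have ng: "(norm (sph_grad (zonal e ?u) \<tau>))\<^sup>2 = (1 - t\<^sup>2) * (X * s * v t)\<^sup>2"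
      using norm_sph_grad_zonal[OF e Z \<tau>] by (simp add: t_def)
    have u: "zonal e ?u \<tau> = X * (1 + s * z t)" using e by (simp add: zonal_def[OF e] t_def)
    let ?Q = "(1 + s * z t)\<^sup>2 + e2 * ((1 - t\<^sup>2) * (s * v t)\<^sup>2)"
    have t2: "0 \<le> 1 - t\<^sup>2" using t by (simp add: abs_square_le_1 abs_le_iff)
    have Qp: "?Q > 0" using pos t2 e2 by (intro add_pos_nonneg mult_nonneg_nonneg) auto
    have XP: "X powr (p - 1) = P" using p P(2) by (simp add: X powr_powr)
    \<comment> \<open>This is the reason for the constant ((p - 1) / 2)^2: it lets (2 / (p - 1))^2
      X^2 be pulled out of the sum of the zeroth-order and gradient terms.\<close>
    have c2: "(2 / (p - 1))\<^sup>2 * e2 = 1" using p by (simp add: e2 power_divide)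
    have "(2 / (p - 1))\<^sup>2 * (X * (1 + s * z t))\<^sup>2 + (1 - t\<^sup>2) * (X * s * v t)\<^sup>2 =
       (2 / (p - 1))\<^sup>2 * X\<^sup>2 * (1 + s * z t)\<^sup>2 + ((2 / (p - 1))\<^sup>2 * e2) * ((1 - t\<^sup>2) * X\<^sup>2 * (s * v t)\<^sup>2)"
      unfolding c2 by (simp add: power_mult_distrib)
    also have "\<dots> = ((2 / (p - 1))\<^sup>2 * X\<^sup>2 + 0) * ?Q"
      by (simp add: algebra_simps)
    finally have "((2 / (p - 1))\<^sup>2 * (X * (1 + s * z t))\<^sup>2 + (1 - t\<^sup>2) * (X * s * v t)\<^sup>2) powr \<sigma> =
       ((2 / (p - 1))\<^sup>2 * X\<^sup>2 + 0) powr \<sigma> * ?Q powr \<sigma>"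
      using Qp by (simp add: powr_mult)
    \<comment> \<open>The power of X produced by the gradient term is evaluated by the root
      equation: it is the M-term of the constant solution X.\<close>
    moreover have "M * ((2 / (p - 1))\<^sup>2 * X\<^sup>2 + 0) powr \<sigma> = X * (c - P)"
    proof -
      have "positive_root DIM('a) p M X" using Xpos XP M by (simp add: positive_root_def c)
      then have "c * X = X powr p + M * ((2 / (p - 1))\<^sup>2 * X\<^sup>2 + 0) powr \<sigma>"
        using root_equation[OF p Xpos, of "DIM('a)" M] by (simp add: c \<sigma>)
      moreover have "X powr p = X * P" using Xpos XP powr_mult_base[of X "p - 1"] by simp
      ultimately show ?thesis by (simp add: algebra_simps)
    qed
    ultimately have grad_term: "M * ((2 / (p - 1))\<^sup>2 * (X * (1 + s * z t))\<^sup>2 + (1 - t\<^sup>2) * (X * s * v t)\<^sup>2) powr \<sigma> =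
       X * ((c - P) * ?Q powr \<sigma>)"
      by (simp add: mult.assoc[symmetric])
    have pw: "(X * (1 + s * z t)) powr p = X * (P * (1 + s * z t) powr p)"
      using Xpos pos XP powr_mult_base[of X "p - 1"] by (simp add: powr_mult)
    have red: "s * ((l + \<zeta>) * z t + ?N t) + c * (1 + s * z t) = P * (1 + s * z t) powr p + (c - P) * ?Q powr \<sigma>"
      by (rule reduced_equation[OF p q \<sigma> \<kappa> e2 P(1) l sz[OF t] t])
    have "- sph_laplacian (zonal e ?u) \<tau> + c * (X * (1 + s * z t)) =
        X * (s * ((l + \<zeta>) * z t + ?N t) + c * (1 + s * z t))"
      unfolding lap by (simp add: algebra_simps)
    also have "\<dots> = X * (P * (1 + s * z t) powr p) + X * ((c - P) * ?Q powr \<sigma>)"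
      unfolding red by (simp add: algebra_simps)
    finally show "- sph_laplacian (zonal e ?u) \<tau> + 2 * K_coeff DIM('a) p / (p - 1) * zonal e ?u \<tau> =
        zonal e ?u \<tau> powr p +
        M * ((2 / (p - 1))\<^sup>2 * (zonal e ?u \<tau>)\<^sup>2 + (norm (sph_grad (zonal e ?u) \<tau>))\<^sup>2) powr (p / (p + 1))"
      unfolding u ng pw c[symmetric] \<sigma>[symmetric] grad_term .
  qed
qed

section \<open>From the Lipschitz branch to a bifurcation curve\<close>

lemma uniform_limit_lipschitz:
  fixes g :: "real \<Rightarrow> 'b \<Rightarrow> real"
  assumes lip: "\<And>s s' x. s \<in> I \<Longrightarrow> s' \<in> I \<Longrightarrow> x \<in> S \<Longrightarrow> \<bar>g s x - g s' x\<bar> \<le> L * \<bar>s - s'\<bar>" and s: "s \<in> I"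
  shows "uniform_limit S g (g s) (at s within I)"
proof (rule uniform_limitI)
  fix e :: real assume e: "e > 0"
  have pos: "e / (\<bar>L\<bar> + 1) > 0" using e by simp
  have "\<forall>\<^sub>F s' in at s within I. s' \<in> I \<and> dist s' s < e / (\<bar>L\<bar> + 1)"
    unfolding eventually_at using pos by blast
  then show "\<forall>\<^sub>F s' in at s within I. \<forall>x\<in>S. dist (g s' x) (g s x) < e"
  proof eventually_elim
    case (elim s')
    show ?case
    proof
      fix x assume x: "x \<in> S"
      have "\<bar>g s' x - g s x\<bar> \<le> L * \<bar>s' - s\<bar>" using elim s x by (intro lip) auto
      also have "\<dots> \<le> (\<bar>L\<bar> + 1) * \<bar>s' - s\<bar>" by (intro mult_right_mono) auto
      also have "\<dots> < e" using elim by (simp add: dist_real_def pos_less_divide_eq mult.commute)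
      finally show "dist (g s' x) (g s x) < e" by (simp add: dist_real_def)
    qed
  qed
qed

lemma uniform_limit_of_continuous:
  assumes "continuous_on I f" "s \<in> I"
  shows "uniform_limit S (\<lambda>s x. f s) (\<lambda>x. f s) (at s within I)"
proof (rule uniform_limitI)
  fix e :: real assume e: "e > 0"
  have "(f \<longlongrightarrow> f s) (at s within I)" using assms by (simp add: continuous_on_def)
  from tendstoD[OF this e] show "\<forall>\<^sub>F n in at s within I. \<forall>x\<in>S. dist (f n) (f s) < e"
    by eventually_elim simp
qed

lemma bifurcation_at_eigenvalue:
  fixes p M0 X0 :: real
  assumes dim: "DIM('a::euclidean_space) \<ge> 2" and k: "k \<ge> 1" and p: "p > 1"
    and root: "positive_root DIM('a) p M0 X0" and assoc: "associated DIM('a) p k M0 X0"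
  shows "\<exists>\<epsilon>>0. \<exists>M (\<omega> :: real \<Rightarrow> 'a \<Rightarrow> real). bifurcation_curve p {-\<epsilon><..<\<epsilon>} M \<omega> M0 X0"
proof -
  define d where "d = DIM('a) - 1"
  have d: "d \<ge> 1" "DIM('a) = Suc d" using dim by (auto simp: d_def)
  obtain e :: 'a where e: "norm e = 1" using nonempty_Basis norm_Basis by blast
  define l where "l = sph_eig d k"
  define c where "c = 2 * K_coeff DIM('a) p / (p - 1)"
  define q where "q = 2 * p / (p + 1)"
  define \<sigma> where "\<sigma> = p / (p + 1)"
  define \<kappa> where "\<kappa> = p - q"
  define e2 where "e2 = ((p - 1) / 2)\<^sup>2"
  define \<gamma> where "\<gamma> = (p - 1) / (p + 1)"
  define P0 where "P0 = X0 powr (p - 1)"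
  have X0: "X0 > 0" using root by (simp add: positive_root_def)
  have P0: "P0 > 0" using X0 by (simp add: P0_def)
  have \<kappa>eq: "\<kappa> = p * (p - 1) / (p + 1)" using p by (simp add: \<kappa>_def q_def field_simps)
  have \<kappa>: "\<kappa> > 0" using p by (simp add: \<kappa>eq)
  have Phi0: "Phi p M0 X0 = c - P0" using root by (simp add: positive_root_def c_def P0_def)
  \<comment> \<open>The factor (p + 1) / (p (p - 1)) in \<open>associated\<close> is 1 / \<kappa>,
    and 2K = c (p - 1). Solved for the eigenvalue, the condition says that the linearisation at P0
    is singular.\<close>
  have leq: "l = c * (q - 1) + \<kappa> * P0"
  proof -
    have lam: "lam DIM('a) k = l" using d by (simp add: lam_def l_def sph_eig_def)
    have "c - P0 = 1 / \<kappa> * (c * (p - 1) - l)"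
      using assoc Phi0 p unfolding associated_def lam by (simp add: \<kappa>eq c_def)
    then have "\<kappa> * (c - P0) = c * (p - 1) - l" using \<kappa> by (simp add: field_simps)
    then show ?thesis by (simp add: \<kappa>_def algebra_simps)
  qed
  obtain B1 where B1: "B1 > 0" "\<And>t. t \<in> {-1..1} \<Longrightarrow> \<bar>gegen d k t\<bar> \<le> B1"
    using continuous_interval_bound[OF continuous_gegen(1)] by metis
  obtain B2 where B2: "B2 > 0" "\<And>t. t \<in> {-1..1} \<Longrightarrow> \<bar>gegen' d k t\<bar> \<le> B2"
    using continuous_interval_bound[OF continuous_gegen(2)] by metis
  define R where "R = B1 + B2 + 1"
  have R0: "R > 0" using B1(1) B2(1) by (simp add: R_def)
  have R1: "\<bar>gegen d k t\<bar> + 1 \<le> R" if "t \<in> {-1..1}" for t using B1(2)[OF that] B2(1) by (simp add: R_def)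
  have R2: "\<bar>gegen' d k t\<bar> + 1 \<le> R" if "t \<in> {-1..1}" for t using B2(2)[OF that] B1(1) by (simp add: R_def)
  have e20: "e2 \<ge> 0" by (simp add: e2_def)
  let ?N = "nonlin p \<sigma> e2 c P0 \<kappa>"
  show ?thesis
  proof (rule nonlin_lipschitz[OF R0 e20 \<kappa>, of p \<sigma> c P0], goal_cases)
    case (1 s1 K)
    note s1 = 1(1-3) and K = 1(4) and NL = 1(5) and contN = 1(6)
    have "\<exists>\<epsilon> L \<zeta> z v. \<epsilon> \<le> s1 \<and> solution_branch d k R ?N \<epsilon> L \<zeta> z v"
    proof (rule lyapunov_schmidt[OF d(1) k _ _ s1(1) K NL], goal_cases)
      case (1 t) then show ?case by (rule R1)
    next
      case (2 t) then show ?case by (rule R2)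
    next
      case (3 \<zeta> t z v) show ?case by (rule nonlin_0)
    next
      case (4 s \<zeta> z v) then show ?case by (rule contN)
    qed
    then obtain \<epsilon> L \<zeta> z v where "\<epsilon> \<le> s1 \<and> solution_branch d k R ?N \<epsilon> L \<zeta> z v"
      by (elim exE) (rule that)
    note H = this[unfolded solution_branch_def]
    have eps: "0 < \<epsilon>" "\<epsilon> \<le> s1" and \<zeta>0: "\<zeta> 0 = 0" using H by blast+
    have sol: "zonal_sol d l (\<lambda>t. \<zeta> s * z s t + ?N s (\<zeta> s) t (z s t) (v s t)) (z s) (v s)"
      and \<zeta>1: "\<bar>\<zeta> s\<bar> \<le> 1" and nc: "\<not> z s constant_on {-1..1}" if "s \<in> {0..\<epsilon>}" for s
      using H that unfolding l_def by blast+
    have zv: "\<bar>z s t\<bar> \<le> R \<and> \<bar>v s t\<bar> \<le> R" if "s \<in> {0..\<epsilon>}" "t \<in> {-1..1}" for s t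
      using H that by blast
    have L: "\<bar>\<zeta> s - \<zeta> s'\<bar> \<le> L * \<bar>s - s'\<bar>" if "s \<in> {0..\<epsilon>}" "s' \<in> {0..\<epsilon>}" for s s'
      using H that by blast
    have Lzv: "\<bar>z s t - z s' t\<bar> \<le> L * \<bar>s - s'\<bar>" "\<bar>v s t - v s' t\<bar> \<le> L * \<bar>s - s'\<bar>"
      if "s \<in> {0..\<epsilon>}" "s' \<in> {0..\<epsilon>}" "t \<in> {-1..1}" for s s' t
      using H that by blast+
    have L0: "L \<ge> 0"
    proof -
      have "0 \<le> L * \<bar>\<epsilon> - 0\<bar>" using L[of \<epsilon> 0] eps(1) by (intro order_trans[OF abs_ge_zero]) auto
      then show ?thesis using eps(1) by (simp add: zero_le_mult_iff)
    qed
    \<comment> \<open>On this interval \<bar>\<zeta>\<bar> <= \<kappa> P0 / 2, so P stays positive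
      and X is defined by a genuine power. Adding 1 to L avoids a division by 0.\<close>
    define \<epsilon>' where "\<epsilon>' = min \<epsilon> (\<kappa> * P0 / (2 * (L + 1)))"
    have eps': "\<epsilon>' > 0" using eps(1) \<kappa> P0 L0 by (simp add: \<epsilon>'_def)
    define I where "I = {-\<epsilon>'<..<\<epsilon>'}"
    have absI: "\<bar>s\<bar> \<in> {0..\<epsilon>}" if "s \<in> I" for s using that by (auto simp: I_def \<epsilon>'_def)
    have dabs: "L * \<bar>\<bar>s\<bar> - \<bar>s'\<bar>\<bar> \<le> L * \<bar>s - s'\<bar>" for s s' :: real
      using L0 abs_triangle_ineq3[of s s'] by (intro mult_left_mono)
    define P where "P s = P0 + \<zeta> \<bar>s\<bar> / \<kappa>" for s
    define X where "X s = P s powr (1 / (p - 1))" for s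
    define b where "b = (2 / (p - 1)) powr (2 * p / (p + 1))"
    \<comment> \<open>M is found last, by solving \<open>Phi p M X\<close> = c - P, the root
      equation at the current P.\<close>
    define M where "M s = (c - P s) / (b * X s powr \<gamma>)" for s
    define u where "u s t = X s * (1 + \<bar>s\<bar> * z \<bar>s\<bar> t)" for s t
    have b: "b > 0" using p by (simp add: b_def)
    have Ppos: "P s > 0" if s: "s \<in> I" for s
    proof -
      have "\<bar>\<zeta> \<bar>s\<bar>\<bar> \<le> L * \<bar>s\<bar>" using L[OF absI[OF s], of 0] eps(1) \<zeta>0 by simp
      also have "\<dots> \<le> (L + 1) * (\<kappa> * P0 / (2 * (L + 1)))"
        using s L0 by (intro mult_mono) (auto simp: I_def \<epsilon>'_def)
      also have "\<dots> = \<kappa> * P0 / 2" using L0 by (simp add: field_simps)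
      also have "\<dots> < \<kappa> * P0" using \<kappa> P0 by simp
      finally have "\<bar>\<zeta> \<bar>s\<bar>\<bar> < \<kappa> * P0" .
      then have "- \<zeta> \<bar>s\<bar> < P0 * \<kappa>" by (simp add: mult.commute)
      then have "- \<zeta> \<bar>s\<bar> / \<kappa> < P0" using \<kappa> by (simp only: pos_divide_less_eq)
      then show ?thesis by (simp add: P_def)
    qed
    have Xpos: "X s > 0" if "s \<in> I" for s using Ppos[OF that] by (simp add: X_def)
    have PhiM: "Phi p (M s) (X s) = c - P s" if "s \<in> I" for s
      using Xpos[OF that] b by (simp add: Phi_def M_def b_def \<gamma>_def)
    have sz: "\<bar>\<bar>s\<bar> * z \<bar>s\<bar> t\<bar> \<le> 1/2" if s: "s \<in> I" and t: "t \<in> {-1..1}" for s t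
    proof -
      have "\<bar>s\<bar> * \<bar>z \<bar>s\<bar> t\<bar> \<le> s1 * R"
        using zv[OF absI[OF s] t] absI[OF s] eps s1 by (intro mult_mono) auto
      then show ?thesis using s1(3) by (simp add: abs_mult)
    qed
    have cN: "continuous_on {-1..1} (\<lambda>t. ?N \<bar>s\<bar> (\<zeta> \<bar>s\<bar>) t (z \<bar>s\<bar> t) (v \<bar>s\<bar> t))" if s: "s \<in> I" for s
      using absI[OF s] eps \<zeta>1[OF absI[OF s]] zv[OF absI[OF s]] zonal_solD(1,2)[OF sol[OF absI[OF s]]]
      by (intro contN) auto
    note zps = zonal_positive_solution[OF e d(2) p q_def \<sigma>_def \<kappa>_def e2_def c_def P_def Ppos leq X_def PhiM
        sol[OF absI] cN sz]
    have pos_sol: "positive_solution p (M s) (zonal e (u s))" if s: "s \<in> I" for s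
      unfolding u_def using s by (intro zps(1)) auto
    have grad: "sph_grad (zonal e (u s)) \<tau> = (X s * \<bar>s\<bar> * v \<bar>s\<bar> (\<tau> \<bullet> e)) *\<^sub>R (e - (\<tau> \<bullet> e) *\<^sub>R \<tau>)"
      if s: "s \<in> I" and \<tau>: "\<tau> \<in> sphere 0 1" for s \<tau>
      unfolding u_def using s \<tau> by (intro zps(2)) auto
    have hb: "\<tau> \<bullet> e \<in> {-1..1}" if "\<tau> \<in> sphere 0 1" for \<tau>
      using Cauchy_Schwarz_ineq2[of \<tau> e] e that by (auto simp: abs_le_iff)
    have c\<zeta>: "continuous_on I (\<lambda>s. \<zeta> \<bar>s\<bar>)"
    proof -
      have "L-lipschitz_on I (\<lambda>s. \<zeta> \<bar>s\<bar>)"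
        using L0 order_trans[OF L[OF absI absI] dabs] by (auto intro!: lipschitz_onI simp: dist_real_def)
      then show ?thesis by (rule lipschitz_on_continuous_on)
    qed
    have cP: "continuous_on I P" unfolding P_def[abs_def] using \<kappa> by (intro continuous_intros c\<zeta>) auto
    have cX: "continuous_on I X" unfolding X_def[abs_def] using Ppos by (intro continuous_intros cP) force
    have cM: "continuous_on I M" unfolding M_def[abs_def] using Xpos b by (intro continuous_intros cP cX) force+
    have cs: "continuous_on I (\<lambda>s. \<bar>s\<bar>)" by (intro continuous_intros)
    have "bifurcation_curve p I M (\<lambda>s. zonal e (u s)) M0 X0"
      unfolding bifurcation_curve_def
    proof (intro conjI ballI)
      show "open I" "connected I" "0 \<in> I" using eps' by (auto simp: I_def)
      show "continuous_on I M" by (rule cM)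
      have P00: "P 0 = P0" by (simp add: P_def \<zeta>0)
      have X00: "X 0 = X0" using p X0 by (simp add: X_def P00 P0_def powr_powr)
      show "M 0 = M0"
      proof -
        have "M0 * (b * X0 powr \<gamma>) = c - P0" using Phi0 by (simp add: Phi_def b_def \<gamma>_def mult.assoc)
        then show ?thesis using b X0 unfolding M_def P00 X00 by (simp add: nonzero_divide_eq_eq)
      qed
      show "zonal e (u 0) \<tau> = X0" for \<tau> using e by (simp add: zonal_def u_def X00)
      fix s assume s: "s \<in> I"
      show "positive_solution p (M s) (zonal e (u s))" by (rule pos_sol[OF s])
      have uz: "uniform_limit (sphere 0 1) (\<lambda>s \<tau>. z \<bar>s\<bar> (\<tau> \<bullet> e)) (\<lambda>\<tau>. z \<bar>s\<bar> (\<tau> \<bullet> e)) (at s within I)"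
        by (rule uniform_limit_lipschitz[OF _ s, where L = L]) (rule order_trans[OF Lzv(1)[OF absI absI hb] dabs])
      have uv: "uniform_limit (sphere 0 1) (\<lambda>s \<tau>. v \<bar>s\<bar> (\<tau> \<bullet> e)) (\<lambda>\<tau>. v \<bar>s\<bar> (\<tau> \<bullet> e)) (at s within I)"
        by (rule uniform_limit_lipschitz[OF _ s, where L = L]) (rule order_trans[OF Lzv(2)[OF absI absI hb] dabs])
      note us = uniform_limit_of_continuous[OF cs s] and uX = uniform_limit_of_continuous[OF cX s]
      have bz: "bounded ((\<lambda>\<tau>. z \<bar>s\<bar> (\<tau> \<bullet> e)) ` sphere 0 1)" "bounded ((\<lambda>\<tau>. v \<bar>s\<bar> (\<tau> \<bullet> e)) ` sphere 0 1)"
        using zv[OF absI[OF s] hb] by (auto simp: bounded_iff intro!: exI[of _ R])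
      have bc: "bounded ((\<lambda>\<tau>. a) ` S)" for a :: real and S :: "'a set"
        by (auto simp: bounded_iff)
      have usz: "uniform_limit (sphere 0 1) (\<lambda>s \<tau>. 1 + \<bar>s\<bar> * z \<bar>s\<bar> (\<tau> \<bullet> e)) (\<lambda>\<tau>. 1 + \<bar>s\<bar> * z \<bar>s\<bar> (\<tau> \<bullet> e)) (at s within I)"
        by (rule uniform_limit_add[OF uniform_limit_const uniform_lim_mult[OF us uz bc bz(1)]])
      have bsz: "bounded ((\<lambda>\<tau>. 1 + \<bar>s\<bar> * z \<bar>s\<bar> (\<tau> \<bullet> e)) ` sphere 0 1)"
      proof -
        have "\<bar>1 + \<bar>s\<bar> * z \<bar>s\<bar> (\<tau> \<bullet> e)\<bar> \<le> 2" if "\<tau> \<in> sphere 0 1" for \<tau>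
          using sz[OF s hb[OF that]] by (simp add: abs_le_iff)
        then show ?thesis by (auto simp: bounded_iff intro!: exI[of _ 2])
      qed
      show "uniform_limit (sphere 0 1) (\<lambda>s. zonal e (u s)) (zonal e (u s)) (at s within I)"
        using uniform_lim_mult[OF uX usz bc bsz] unfolding zonal_def[OF e, abs_def] u_def .
      have uXs: "uniform_limit (sphere 0 1) (\<lambda>s \<tau>. X s * \<bar>s\<bar> * v \<bar>s\<bar> (\<tau> \<bullet> e)) (\<lambda>\<tau>. X s * \<bar>s\<bar> * v \<bar>s\<bar> (\<tau> \<bullet> e)) (at s within I)"
        by (rule uniform_lim_mult[OF uniform_lim_mult[OF uX us bc bc] uv bc bz(2)])
      have bXs: "bounded ((\<lambda>\<tau>. X s * \<bar>s\<bar> * v \<bar>s\<bar> (\<tau> \<bullet> e)) ` sphere 0 1)"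
      proof -
        have "\<bar>X s * \<bar>s\<bar> * v \<bar>s\<bar> (\<tau> \<bullet> e)\<bar> \<le> \<bar>X s * \<bar>s\<bar>\<bar> * R" if "\<tau> \<in> sphere 0 1" for \<tau>
          unfolding abs_mult[of "X s * \<bar>s\<bar>"] using zv[OF absI[OF s] hb[OF that]] by (intro mult_left_mono) auto
        then show ?thesis
          unfolding bounded_iff by (intro exI[of _ "\<bar>X s * \<bar>s\<bar>\<bar> * R"]) auto
      qed
      have bt: "bounded ((\<lambda>\<tau>. e - (\<tau> \<bullet> e) *\<^sub>R \<tau>) ` sphere 0 1)"
        by (intro compact_imp_bounded compact_continuous_image continuous_intros) auto
      have "uniform_limit (sphere 0 1) (\<lambda>s \<tau>. (X s * \<bar>s\<bar> * v \<bar>s\<bar> (\<tau> \<bullet> e)) *\<^sub>R (e - (\<tau> \<bullet> e) *\<^sub>R \<tau>))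
         (\<lambda>\<tau>. (X s * \<bar>s\<bar> * v \<bar>s\<bar> (\<tau> \<bullet> e)) *\<^sub>R (e - (\<tau> \<bullet> e) *\<^sub>R \<tau>)) (at s within I)"
        by (rule bounded_bilinear.bounded_uniform_limit[OF bounded_bilinear_scaleR uXs uniform_limit_const bt bXs])
      then show "uniform_limit (sphere 0 1) (\<lambda>s. sph_grad (zonal e (u s))) (sph_grad (zonal e (u s))) (at s within I)"
      \<comment> \<open>The gradient formula is known for parameters in I and points of the sphere,
        which is all that the limit sees; the radius 1 is arbitrary.\<close>
      proof (rule uniform_limit_cong[THEN iffD1, rotated -1])
        show "\<forall>\<^sub>F s in at s within I. \<forall>\<tau>\<in>sphere 0 1. (X s * \<bar>s\<bar> * v \<bar>s\<bar> (\<tau> \<bullet> e)) *\<^sub>R (e - (\<tau> \<bullet> e) *\<^sub>R \<tau>) = sph_grad (zonal e (u s)) \<tau>"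
          unfolding eventually_at by (intro exI[of _ 1]) (simp add: grad)
      qed (simp add: grad[OF s])
    next
      fix s assume s: "s \<in> I - {0}"
      then have sI: "s \<in> I" and s0: "s \<noteq> 0" by auto
      show "\<not> zonal e (u s) constant_on sphere 0 1"
      proof
        assume "zonal e (u s) constant_on sphere 0 1"
        then obtain a where a: "\<forall>\<tau>\<in>sphere 0 1. zonal e (u s) \<tau> = a" unfolding constant_on_def by blast
        have "z \<bar>s\<bar> t = (a / X s - 1) / \<bar>s\<bar>" if t: "t \<in> {-1..1}" for t
        proof (rule sphere_heights[OF e dim t])
          fix \<tau> assume "\<tau> \<in> sphere 0 1" "\<tau> \<bullet> e = t"
          then have "u s t = a" using a by (auto simp: zonal_def[OF e])
          then show ?thesis using Xpos[OF sI] s0 by (simp add: u_def field_simps)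
        qed
        then have "z \<bar>s\<bar> constant_on {-1..1}" unfolding constant_on_def by blast
        then show False using nc[OF absI[OF sI]] by simp
      qed
    qed
    then show ?case using eps' unfolding I_def by blast
  qed
qed

section \<open>Constant solutions\<close>

text \<open>This covers constants in every dimension and also arbitrary functions on the two-point
  sphere, whose extensions are constant on each open half-line.\<close>

lemma locally_constant_calculus:
  fixes \<omega> :: "'a::euclidean_space \<Rightarrow> real"
  assumes lc: "\<And>x. x \<noteq> 0 \<Longrightarrow> \<exists>U. open U \<and> x \<in> U \<and> (\<forall>y\<in>U. radial_ext \<omega> y = radial_ext \<omega> x)"
  shows "C2_sphere \<omega>"
    and "\<sigma> \<in> sphere 0 1 \<Longrightarrow> sph_grad \<omega> \<sigma> = 0"
    and "\<sigma> \<in> sphere 0 1 \<Longrightarrow> sph_laplacian \<omega> \<sigma> = 0"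
proof -
  have d1: "(radial_ext \<omega> has_derivative (\<lambda>h. 0)) (at x)" if x: "x \<noteq> 0" for x
  proof -
    obtain U where U: "open U" "x \<in> U" "\<forall>y\<in>U. radial_ext \<omega> y = radial_ext \<omega> x" using lc[OF x] by blast
    show ?thesis
    proof (rule has_derivative_transform_within_open[OF has_derivative_const U(1,2)])
      show "radial_ext \<omega> x = radial_ext \<omega> y" if "y \<in> U" for y
        using bspec[OF U(3) that] by (rule sym)
    qed
  qed
  have p1: "partial b (radial_ext \<omega>) x = 0" if "x \<noteq> 0" for b x
    using partial_eq[OF d1[OF that]] .
  have d2: "(partial b (radial_ext \<omega>) has_derivative (\<lambda>h. 0)) (at x)" if x: "x \<noteq> 0" for b x
    by (rule has_derivative_transform_within_open[OF has_derivative_const[of 0], of "- {0}"]) (use x p1 in auto)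
  have p2: "partial c (partial b (radial_ext \<omega>)) x = 0" if "x \<noteq> 0" for b c x
    using partial_eq[OF d2[OF that]] .
  have "C1_on (- {0}) (radial_ext \<omega>)"
    unfolding C1_on_def
  proof (intro conjI ballI)
    show "radial_ext \<omega> differentiable at x" if "x \<in> - {0}" for x
      using d1 that by (auto simp: differentiable_def)
    show "continuous_on (- {0}) (partial b (radial_ext \<omega>))" for b
      by (rule continuous_on_eq[OF continuous_on_const[of _ 0]]) (simp add: p1)
  qed
  moreover have "C1_on (- {0}) (partial b (radial_ext \<omega>))" for b
    unfolding C1_on_def
  proof (intro conjI ballI)
    show "partial b (radial_ext \<omega>) differentiable at x" if "x \<in> - {0}" for x
      using d2 that by (auto simp: differentiable_def)
    show "continuous_on (- {0}) (partial c (partial b (radial_ext \<omega>)))" for c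
      by (rule continuous_on_eq[OF continuous_on_const[of _ 0]]) (simp add: p2)
  qed
  ultimately show "C2_sphere \<omega>" by (simp add: C2_sphere_def C2_on_def)
  assume "\<sigma> \<in> sphere 0 1"
  then have "\<sigma> \<noteq> 0" by auto
  then show "sph_grad \<omega> \<sigma> = 0" "sph_laplacian \<omega> \<sigma> = 0"
    by (simp_all add: sph_grad_def sph_laplacian_def p1 p2)
qed

lemma locally_constant_positive_solution:
  fixes \<omega> :: "'a::euclidean_space \<Rightarrow> real"
  assumes lc: "\<And>x. x \<noteq> 0 \<Longrightarrow> \<exists>U. open U \<and> x \<in> U \<and> (\<forall>y\<in>U. radial_ext \<omega> y = radial_ext \<omega> x)"
    and p: "p > 1"
  shows "positive_solution p M \<omega> \<longleftrightarrow> (\<forall>\<sigma>\<in>sphere 0 1. positive_root DIM('a) p M (\<omega> \<sigma>))"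
proof -
  note C = locally_constant_calculus[OF lc]
  have "positive_root DIM('a) p M (\<omega> \<sigma>) \<longleftrightarrow> \<omega> \<sigma> > 0 \<and>
     - sph_laplacian \<omega> \<sigma> + 2 * K_coeff DIM('a) p / (p - 1) * \<omega> \<sigma> =
        \<omega> \<sigma> powr p + M * ((2 / (p - 1))\<^sup>2 * (\<omega> \<sigma>)\<^sup>2 + (norm (sph_grad \<omega> \<sigma>))\<^sup>2) powr (p / (p + 1))"
    if "\<sigma> \<in> sphere 0 1" for \<sigma>
  proof (cases "\<omega> \<sigma> > 0")
    case True
    then show ?thesis
      using root_equation[OF p True, of "DIM('a)" M] C(2,3)[OF _ that] by simp
  qed (simp add: positive_root_def)
  then show ?thesis unfolding positive_solution_def using C(1) by blast
qed

text \<open>\<open>X_root\<close> is a definite description and says nothing where there is no root,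
  as for p = N / (N - 2) and M >= 0. The start of a curve is itself a constant solution and
  certifies that the value is a root.\<close>

lemma bifurcation_curve_root:
  fixes \<omega> :: "real \<Rightarrow> 'a::euclidean_space \<Rightarrow> real"
  assumes bc: "bifurcation_curve p I M \<omega> M0 X" and p: "p > 1"
  shows "positive_root DIM('a) p M0 X"
proof -
  have w0: "\<omega> 0 \<sigma> = X" if "\<sigma> \<in> sphere 0 1" for \<sigma> using bc that unfolding bifurcation_curve_def by blast
  have ps: "positive_solution p M0 (\<omega> 0)" using bc unfolding bifurcation_curve_def by blast
  have r: "radial_ext (\<omega> 0) x = X" if "x \<noteq> 0" for x using that by (simp add: radial_ext_def w0)
  have "positive_solution p M0 (\<omega> 0) \<longleftrightarrow> (\<forall>\<sigma>\<in>sphere 0 1. positive_root DIM('a) p M0 (\<omega> 0 \<sigma>))"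
  proof (rule locally_constant_positive_solution[OF _ p])
    fix x :: 'a assume "x \<noteq> 0"
    then show "\<exists>U. open U \<and> x \<in> U \<and> (\<forall>y\<in>U. radial_ext (\<omega> 0) y = radial_ext (\<omega> 0) x)"
      by (intro exI[of _ "- {0}"]) (auto simp: r)
  qed
  moreover obtain b :: 'a where "b \<in> Basis" using nonempty_Basis by blast
  then have "b \<in> sphere 0 1" by simp
  ultimately show ?thesis using ps w0[of b] by auto
qed

section \<open>Roots described by the monotonicity of M as a function of A\<close>

definition root_const :: "nat \<Rightarrow> real \<Rightarrow> real" where
  "root_const N p = 2 * K_coeff N p / (p - 1)"

text \<open>The value of \<open>M\<close> for which \<open>X\<close> is a root, as a function of \<open>A = X powr (p - 1)\<close>.\<close>

definition root_param :: "nat \<Rightarrow> real \<Rightarrow> real \<Rightarrow> real" where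
  "root_param N p A = (root_const N p - A) / ((2 / (p - 1)) powr (2 * p / (p + 1)) * A powr (1 / (p + 1)))"

lemma positive_root_iff:
  assumes p: "p > 1"
  shows "positive_root N p M X \<longleftrightarrow> X > 0 \<and> M = root_param N p (X powr (p - 1))"
proof (cases "X > 0")
  case X: True
  let ?b = "(2 / (p - 1)) powr (2 * p / (p + 1))"
  have b: "?b > 0" using p by simp
  have a: "(X powr (p - 1)) powr (1 / (p + 1)) = X powr ((p - 1) / (p + 1))" by (simp add: powr_powr)
  have xp: "X powr ((p - 1) / (p + 1)) > 0" using X by simp
  have "positive_root N p M X \<longleftrightarrow> M * (?b * X powr ((p - 1) / (p + 1))) = root_const N p - X powr (p - 1)"
    using X by (auto simp: positive_root_def Phi_def root_const_def mult.assoc)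
  also have "\<dots> \<longleftrightarrow> M = root_param N p (X powr (p - 1))"
    unfolding root_param_def a using b xp by (simp add: nonzero_eq_divide_eq)
  finally show ?thesis using X by simp
qed (simp add: positive_root_def)

lemma positive_root_of_param:
  "p > 1 \<Longrightarrow> A > 0 \<Longrightarrow> positive_root N p (root_param N p A) (A powr (1 / (p - 1)))"
  by (simp add: positive_root_iff powr_powr)

lemma root_Phi: "positive_root N p M X \<Longrightarrow> Phi p M X = root_const N p - X powr (p - 1)"
  by (simp add: positive_root_def root_const_def)

text \<open>The sign is that of - (A + c / p) with c = \<open>root_const N p\<close>. The critical
  point A = - c / p, called the fold, is positive exactly when c < 0; this separates the third case
  of the theorem from the first two.\<close>

lemma root_param_deriv:
  assumes p: "p > 1" and A: "A > 0"
  shows "(root_param N p has_real_derivative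
     - (A + root_const N p / p) * (p / ((p + 1) * (2 / (p - 1)) powr (2 * p / (p + 1)) * A powr (1 / (p + 1) + 1)))) (at A)"
proof -
  define b where "b = (2 / (p - 1)) powr (2 * p / (p + 1))"
  define r where "r = 1 / (p + 1)"
  define c where "c = root_const N p"
  have b: "b > 0" using p by (simp add: b_def)
  have f: "root_param N p = (\<lambda>A. (c - A) * A powr (- r) / b)"
    by (auto simp: fun_eq_iff root_param_def b_def r_def c_def powr_minus field_simps)
  have "((\<lambda>A. (c - A) * A powr (- r) / b) has_real_derivative
      ((- 1) * A powr (- r) + (- r * A powr (- r - 1)) * (c - A)) / b) (at A)"
  proof (intro DERIV_cdivide DERIV_mult)
    show "((\<lambda>A. c - A) has_real_derivative - 1) (at A)" by (auto intro!: derivative_eq_intros)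
    show "((\<lambda>A. A powr - r) has_real_derivative - r * A powr (- r - 1)) (at A)"
      by (rule has_real_derivative_powr[OF A])
  qed
  moreover have "((- 1) * A powr (- r) + (- r * A powr (- r - 1)) * (c - A)) / b =
      - (A + c / p) * (p / ((p + 1) * b * A powr (r + 1)))"
  proof -
    have m: "A powr (- r) = A powr (- r - 1) * A" using A powr_mult_base[of A "- r - 1"] by (simp add: mult.commute)
    have i: "A powr (r + 1) = 1 / A powr (- r - 1)" using powr_minus_divide[of A "- r - 1"] by (simp add: algebra_simps)
    have alg: "((- 1) * (w * A) + (- (1 / (p + 1)) * w) * (c - A)) / b = - (A + c / p) * (p / ((p + 1) * b * (1 / w)))"
      if "w > 0" for w
      using that b p by (simp add: divide_simps) (simp add: algebra_simps)
    show ?thesis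
      unfolding m i by (rule alg[folded r_def]) (use A in simp)
  qed
  ultimately show ?thesis unfolding f b_def[symmetric] r_def[symmetric] c_def[symmetric] by simp
qed

lemma continuous_root_param: "p > 1 \<Longrightarrow> S \<subseteq> {0<..} \<Longrightarrow> continuous_on S (root_param N p)"
  by (intro continuous_at_imp_continuous_on ballI DERIV_isCont[OF root_param_deriv]) auto

lemma root_param_strict_decreasing:
  assumes p: "p > 1" and A: "A > 0" "- root_const N p / p \<le> A" and AB: "A < B"
  shows "root_param N p B < root_param N p A"
proof (rule DERIV_neg_imp_decreasing_open[OF AB])
  fix x assume x: "A < x" "x < B"
  have "x + root_const N p / p > 0" using x A by simp
  then have "- (x + root_const N p / p) * (p / ((p + 1) * (2 / (p - 1)) powr (2 * p / (p + 1)) * x powr (1 / (p + 1) + 1))) < 0"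
    using p x A by (intro mult_neg_pos divide_pos_pos mult_pos_pos) auto
  then show "\<exists>y. (root_param N p has_real_derivative y) (at x) \<and> y < 0"
    using root_param_deriv[OF p, of x N] x A by (intro exI conjI) auto
qed (use A in \<open>intro continuous_root_param[OF p], auto\<close>)

lemma root_param_strict_increasing:
  assumes p: "p > 1" and A: "A > 0" and B: "B \<le> - root_const N p / p" and AB: "A < B"
  shows "root_param N p A < root_param N p B"
proof (rule DERIV_pos_imp_increasing_open[OF AB])
  fix x assume x: "A < x" "x < B"
  have "x + root_const N p / p < 0" using x B by simp
  then have "- (x + root_const N p / p) * (p / ((p + 1) * (2 / (p - 1)) powr (2 * p / (p + 1)) * x powr (1 / (p + 1) + 1))) > 0"
    using p x A by (intro mult_pos_pos divide_pos_pos) auto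
  then show "\<exists>y. (root_param N p has_real_derivative y) (at x) \<and> y > 0"
    using root_param_deriv[OF p, of x N] x A by (intro exI conjI) auto
qed (use A in \<open>intro continuous_root_param[OF p], auto\<close>)

text \<open>The value of \<open>X powr (p - 1)\<close> at a root \<open>X\<close> associated with \<open>k\<close>.\<close>

definition bif_level :: "nat \<Rightarrow> real \<Rightarrow> nat \<Rightarrow> real" where
  "bif_level N p k = ((p + 1) * lam N k - 2 * K_coeff N p) / (p * (p - 1))"

lemma root_const_minus_bif_level:
  "p > 1 \<Longrightarrow> root_const N p - bif_level N p k = (p + 1) / (p * (p - 1)) * (2 * K_coeff N p - lam N k)"
proof -
  assume p: "p > 1"
  have "root_const N p = (p * (2 * K_coeff N p)) / (p * (p - 1))" using p by (simp add: root_const_def)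
  then show ?thesis
    by (simp add: bif_level_def diff_divide_distrib[symmetric] algebra_simps)
qed

text \<open>At a root \<open>Phi\<close> equals c - X powr (p - 1), so M drops out of the condition
  and the level alone is prescribed.\<close>

lemma associated_iff:
  "p > 1 \<Longrightarrow> positive_root N p M X \<Longrightarrow> associated N p k M X \<longleftrightarrow> X powr (p - 1) = bif_level N p k"
  unfolding associated_def root_Phi root_const_minus_bif_level[symmetric] by auto

lemma bif_level_root:
  assumes p: "p > 1" and A: "bif_level N p k > 0"
  shows "positive_root N p (root_param N p (bif_level N p k)) (bif_level N p k powr (1 / (p - 1)))"
    and "associated N p k (root_param N p (bif_level N p k)) (bif_level N p k powr (1 / (p - 1)))"
  using positive_root_of_param[OF p A, of N] associated_iff[OF p positive_root_of_param[OF p A, of N]] p A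
  by (auto simp: powr_powr)

text \<open>For c >= 0 there is no positive fold and M is strictly decreasing in A on the whole
  half-line, so a root is unique.\<close>

lemma X_root_eq:
  assumes p: "p > 1" and c: "root_const N p \<ge> 0" and X: "positive_root N p M X"
  shows "X_root N p M = X"
  unfolding X_root_def
proof (rule the_equality)
  show "positive_root N p M X" by (rule X)
  fix Y assume Y: "positive_root N p M Y"
  have pos: "X > 0" "Y > 0" using X Y by (auto simp: positive_root_def)
  have M: "root_param N p (X powr (p - 1)) = root_param N p (Y powr (p - 1))"
    using X Y positive_root_iff[OF p] by metis
  have "- root_const N p / p \<le> 0" using c p by simp
  then have le: "- root_const N p / p \<le> X powr (p - 1)" "- root_const N p / p \<le> Y powr (p - 1)"
    using powr_ge_zero order_trans by blast+
  have "X powr (p - 1) = Y powr (p - 1)"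
    using root_param_strict_decreasing[OF p _ le(1), of "Y powr (p - 1)"]
      root_param_strict_decreasing[OF p _ le(2), of "X powr (p - 1)"] M pos
    by (cases "X powr (p - 1)" "Y powr (p - 1)" rule: linorder_cases) auto
  then have "(X powr (p - 1)) powr (1 / (p - 1)) = (Y powr (p - 1)) powr (1 / (p - 1))" by simp
  then show "Y = X" using p pos by (simp add: powr_powr)
qed

text \<open>At the fold or to its right any larger level belongs to a smaller M, so no root can
  exceed this one.\<close>

lemma X2_root_eq:
  assumes p: "p > 1" and A: "A > 0" "- root_const N p / p \<le> A"
  shows "X2_root N p (root_param N p A) = A powr (1 / (p - 1))"
  unfolding X2_root_def
proof (rule Greatest_equality)
  show "positive_root N p (root_param N p A) (A powr (1 / (p - 1)))" by (rule positive_root_of_param[OF p A(1)])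
  fix Y assume Y: "positive_root N p (root_param N p A) Y"
  have Y0: "Y > 0" and e: "root_param N p A = root_param N p (Y powr (p - 1))"
    using Y positive_root_iff[OF p] by auto
  have "Y powr (p - 1) \<le> A"
  proof (rule ccontr)
    assume "\<not> Y powr (p - 1) \<le> A"
    then have "root_param N p (Y powr (p - 1)) < root_param N p A"
      by (intro root_param_strict_decreasing[OF p A]) simp
    then show False using e by simp
  qed
  then have "(Y powr (p - 1)) powr (1 / (p - 1)) \<le> A powr (1 / (p - 1))" using p by (intro powr_mono2) auto
  then show "Y \<le> A powr (1 / (p - 1))" using p Y0 by (simp add: powr_powr)
qed

text \<open>A least root has to be exhibited. For c < 0 the parameter tends to - infinity as A tends
  to 0 and increases up to the fold, so the intermediate value theorem yields a root there, and
  smaller levels belong to smaller M.\<close>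

lemma X1_root_is_root:
  assumes p: "p > 1" and c: "root_const N p < 0" and M: "M < 0" "M \<le> root_param N p (- root_const N p / p)"
  shows "positive_root N p M (X1_root N p M)"
proof -
  define a where "a = - root_const N p / p"
  define b where "b = (2 / (p - 1)) powr (2 * p / (p + 1))"
  have a: "a > 0" using c p by (simp add: a_def divide_neg_pos)
  have b: "b > 0" using p by (simp add: b_def)
  \<comment> \<open>D solves D b M = c. If A0 powr (1 / (p + 1)) is at most D, then c <= A0 powr (1
    / (p + 1)) * b M since b M < 0, and the parameter at A0 is at most M.\<close>
  define D where "D = root_const N p / (b * M)"
  have D: "D > 0" using c b M(1) by (simp add: D_def divide_neg_neg mult_pos_neg)
  define A0 where "A0 = min a (D powr (p + 1))"
  have A0: "A0 > 0" "A0 \<le> a" using a D by (auto simp: A0_def)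
  have "A0 powr (1 / (p + 1)) \<le> (D powr (p + 1)) powr (1 / (p + 1))"
    using A0 p by (intro powr_mono2) (auto simp: A0_def)
  also have "\<dots> = D" using p D by (simp add: powr_powr)
  finally have AD: "A0 powr (1 / (p + 1)) \<le> D" .
  have M0: "root_param N p A0 \<le> M"
  proof -
    have bM: "b * M < 0" using b M(1) by (simp add: mult_pos_neg)
    have "root_const N p - A0 \<le> root_const N p" using A0 by simp
    also have "\<dots> = D * (b * M)" by (rule sym, rule nonzero_eq_divide_eq[THEN iffD1, OF _ D_def]) (use bM in auto)
    also have "\<dots> \<le> A0 powr (1 / (p + 1)) * (b * M)" using AD bM by (intro mult_right_mono_neg) auto
    finally show ?thesis unfolding root_param_def b_def[symmetric]
      using b A0 by (simp add: pos_divide_le_eq mult.commute mult.left_commute)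
  qed
  have ca: "continuous_on {A0..a} (root_param N p)"
    by (rule continuous_root_param[OF p]) (use A0 in auto)
  have Ma: "M \<le> root_param N p a" using M(2) by (simp add: a_def)
  obtain A where A: "A0 \<le> A" "A \<le> a" "root_param N p A = M"
    using IVT'[OF M0 Ma A0(2) ca] by blast
  have Apos: "A > 0" using A A0 by linarith
  have "X1_root N p M = A powr (1 / (p - 1))"
    unfolding X1_root_def
  proof (rule Least_equality)
    show "positive_root N p M (A powr (1 / (p - 1)))" using positive_root_of_param[OF p Apos, of N] A(3) by simp
    fix Y assume Y: "positive_root N p M Y"
    have Y0: "Y > 0" and e: "M = root_param N p (Y powr (p - 1))" using Y positive_root_iff[OF p] by auto
    have "A \<le> Y powr (p - 1)"
    proof (rule ccontr)
      assume "\<not> A \<le> Y powr (p - 1)"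
      then have "root_param N p (Y powr (p - 1)) < root_param N p A"
        using Y0 A(2) by (intro root_param_strict_increasing[OF p]) (auto simp: a_def)
      then show False using e A(3) by simp
    qed
    then have "A powr (1 / (p - 1)) \<le> (Y powr (p - 1)) powr (1 / (p - 1))"
      using p Apos by (intro powr_mono2) auto
    then show "A powr (1 / (p - 1)) \<le> Y" using p Y0 by (simp add: powr_powr)
  qed
  then show ?thesis using positive_root_of_param[OF p Apos, of N] A(3) by simp
qed

text \<open>At a = - c / p the numerator c - a is - (p + 1) a, so the value is - (p + 1) a powr (p /
  (p + 1)) / b. As a = m (2 / (p - 1))^2, the power of a splits into that of m and b, and b
  cancels.\<close>

lemma root_param_fold:
  assumes p: "p > 1" and K: "K_coeff N p < 0"
  shows "root_param N p (- root_const N p / p) = - mu_star N p"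
proof -
  define b where "b = (2 / (p - 1)) powr (2 * p / (p + 1))"
  define m where "m = (real N - (real N - 2) * p) / (2 * p)"
  define a where "a = - root_const N p / p"
  have c: "root_const N p < 0" using K p by (simp add: root_const_def divide_neg_pos)
  then have a: "a > 0" using p by (simp add: a_def divide_neg_pos)
  have KK: "(real N - (real N - 2) * p) = - K_coeff N p * (p - 1)" using p by (simp add: K_coeff_def)
  have am: "a = m * (2 / (p - 1)) powr 2"
  proof -
    have alg: "- (2 * k / x) / p = - k * x / (2 * p) * (4 / (x * x))" if "x \<noteq> 0" for k x
      using that p by (simp add: field_simps)
    have sq: "(2 / (p - 1)) powr 2 = 4 / ((p - 1) * (p - 1))"
      using p by (simp add: power2_eq_square)
    show ?thesis
      unfolding a_def m_def KK root_const_def sq using p by (intro alg) simp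
  qed
  have m: "m > 0" unfolding m_def KK using K p by (intro divide_pos_pos mult_pos_pos) auto
  have "a powr (p / (p + 1)) = m powr (p / (p + 1)) * ((2 / (p - 1)) powr 2) powr (p / (p + 1))"
    unfolding am using m p by (simp only: powr_mult)
  also have "((2 / (p - 1)) powr 2) powr (p / (p + 1)) = b" unfolding b_def powr_powr by simp
  finally have ap: "a powr (p / (p + 1)) = m powr (p / (p + 1)) * b" .
  have "a powr (p / (p + 1)) * a powr (1 / (p + 1)) = a powr 1"
    unfolding powr_add[symmetric] using p by (simp add: add_divide_distrib[symmetric])
  then have e: "(m powr (p / (p + 1)) * b) * a powr (1 / (p + 1)) = a" using a by (simp add: ap)
  have "root_const N p - a = - (p + 1) * a" using p by (simp add: a_def field_simps)
  then have "root_const N p - a = - (p + 1) * ((m powr (p / (p + 1)) * b) * a powr (1 / (p + 1)))"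
    unfolding e .
  then have "root_param N p a = - ((p + 1) * m powr (p / (p + 1)))"
    unfolding root_param_def b_def[symmetric] using a p by (simp add: b_def) (simp add: algebra_simps)
  then show ?thesis by (simp add: a_def mu_star_def m_def)
qed

text \<open>On two points gradient and Laplacian vanish, so a solution is any pair of roots for the
  same M. Pairs of distinct roots lie on opposite sides of the fold and can only shrink to a
  constant there.\<close>

lemma bifurcation_fold_dim1:
  assumes dim: "DIM('a::euclidean_space) = 1" and p: "p > 1" and c: "root_const 1 p < 0"
  shows "\<exists>\<epsilon>>0. \<exists>M (\<omega> :: real \<Rightarrow> 'a \<Rightarrow> real). bifurcation_curve p {-\<epsilon><..<\<epsilon>} M \<omega>
     (root_param 1 p (- root_const 1 p / p)) ((- root_const 1 p / p) powr (1 / (p - 1)))"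
proof -
  define a where "a = - root_const 1 p / p"
  define g where "g = root_param 1 p"
  define r where "r = 1 / (p - 1)"
  have a: "a > 0" using c p by (simp add: a_def divide_neg_pos)
  have r: "r > 0" using p by (simp add: r_def)
  have cg: "continuous_on S g" if "S \<subseteq> {0<..}" for S
    unfolding g_def by (rule continuous_root_param[OF p that])
  have inc: "g x < g y" if "0 < x" "x < y" "y \<le> a" for x y
    unfolding g_def using that by (intro root_param_strict_increasing[OF p]) (auto simp: a_def)
  have dec: "g y < g x" if "a \<le> x" "x < y" for x y
    unfolding g_def using that a by (intro root_param_strict_decreasing[OF p]) (auto simp: a_def)
  have inj: "inj_on g {a/2..a}"
  proof (rule inj_onI)
    fix x y assume xy: "x \<in> {a/2..a}" "y \<in> {a/2..a}" "g x = g y"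
    then have pos: "0 < x" "0 < y" "x \<le> a" "y \<le> a" using a by auto
    show "x = y"
    proof (cases x y rule: linorder_cases)
      case less
      then show ?thesis using inc[OF pos(1) less pos(4)] xy(3) by simp
    next
      case greater
      then show ?thesis using inc[OF pos(2) greater pos(3)] xy(3) by simp
    qed
  qed
  \<comment> \<open>The inverse of the increasing branch to the left of the fold. The endpoint a/2
    is an arbitrary positive choice; compactness makes the inverse continuous.\<close>
  define h where "h = inv_into {a/2..a} g"
  have ch: "continuous_on (g ` {a/2..a}) h"
    unfolding h_def
  proof (rule continuous_on_inv)
    show "continuous_on {a/2..a} g" by (rule cg) (use a in auto)
    show "\<forall>x\<in>{a/2..a}. inv_into {a/2..a} g (g x) = x" using inv_into_f_f[OF inj] by blast
  qed simp
  \<comment> \<open>Close to the fold the values on the right branch stay above g (a/2), so each of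
    them is also attained on the compact left piece.\<close>
  have "isCont g a" using cg[of "{0<..}"] a by (simp add: continuous_on_eq_continuous_at)
  moreover have "g (a/2) < g a" by (rule inc) (use a in auto)
  ultimately have "\<forall>\<^sub>F x in at a. g (a/2) < g x"
    unfolding isCont_def by (rule order_tendstoD(1))
  then obtain \<epsilon> where eps: "\<epsilon> > 0" and gx0: "\<And>x. x \<noteq> a \<Longrightarrow> dist x a < \<epsilon> \<Longrightarrow> g (a/2) < g x"
    unfolding eventually_at by blast
  have gx: "g (a/2) < g x" if "\<bar>x - a\<bar> < \<epsilon>" for x
    using gx0[of x] that \<open>g (a/2) < g a\<close> by (cases "x = a") (auto simp: dist_real_def)
  define I where "I = {-\<epsilon><..<\<epsilon>}"
  define A1 where "A1 s = a + \<bar>s\<bar>" for s :: real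
  define M where "M s = g (A1 s)" for s
  define A2 where "A2 s = h (M s)" for s
  have A1: "A1 s > 0" "A1 s \<ge> a" for s using a by (auto simp: A1_def)
  have MI: "M s \<in> g ` {a/2..a}" if s: "s \<in> I" for s
  proof -
    have "\<bar>A1 s - a\<bar> < \<epsilon>" using s by (simp add: A1_def I_def abs_less_iff)
    from gx[OF this] have 1: "g (a/2) \<le> M s" by (simp add: M_def)
    have 2: "M s \<le> g a" using dec[of a "A1 s"] by (cases "s = 0") (auto simp: M_def A1_def)
    have le: "a/2 \<le> a" using a by simp
    have cont: "continuous_on {a/2..a} g" by (rule cg) (use a in auto)
    obtain x where "a/2 \<le> x" "x \<le> a" "g x = M s" using IVT'[OF 1 2 le cont] by blast
    then show ?thesis by (intro image_eqI[of _ _ x]) auto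
  qed
  have A2: "A2 s \<in> {a/2..a}" "g (A2 s) = M s" if "s \<in> I" for s
    unfolding A2_def h_def using inv_into_into[OF MI[OF that]] f_inv_into_f[OF MI[OF that]] by auto
  have A2pos: "A2 s > 0" if "s \<in> I" for s using A2(1)[OF that] a by auto
  have cA1: "continuous_on I A1" unfolding A1_def[abs_def] by (intro continuous_intros)
  have cM: "continuous_on I M"
    unfolding M_def by (rule continuous_on_compose2[OF cg[of "{0<..}"] cA1]) (use A1 in auto)
  have cA2: "continuous_on I A2"
    unfolding A2_def by (rule continuous_on_compose2[OF ch cM]) (use MI in auto)
  have cX1: "continuous_on I (\<lambda>s. A1 s powr r)" 
  proof (intro continuous_intros cA1 ballI)
    show "A1 s \<noteq> 0" for s using A1(1)[of s] by simp
  qed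
  have cX2: "continuous_on I (\<lambda>s. A2 s powr r)" 
  proof (intro continuous_intros cA2 ballI)
    show "A2 s \<noteq> 0" if "s \<in> I" for s using A2pos[OF that] by simp
  qed
  obtain b :: 'a where B: "Basis = {b}" using dim card_1_singletonE by blast
  have b: "b \<bullet> b = 1" "norm b = 1" 
  proof -
    have "b \<in> Basis" unfolding B by (rule insertI1)
    then show "b \<bullet> b = 1" "norm b = 1" by (simp_all add: inner_Basis)
  qed
  have xb: "x = (x \<bullet> b) *\<^sub>R b" for x using euclidean_representation[of x] by (simp add: B)
  define \<omega> where "\<omega> s \<sigma> = (if \<sigma> \<bullet> b > 0 then A1 s powr r else A2 s powr r)" for s and \<sigma> :: 'a
  have re: "radial_ext (\<omega> s) x = (if x \<bullet> b > 0 then A1 s powr r else A2 s powr r)" if "x \<noteq> 0" for s x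
    using that by (simp add: radial_ext_def \<omega>_def zero_less_mult_iff)
  have lc: "\<exists>U. open U \<and> x \<in> U \<and> (\<forall>y\<in>U. radial_ext (\<omega> s) y = radial_ext (\<omega> s) x)" if x: "x \<noteq> 0" for s x
  proof (cases "x \<bullet> b > 0")
    case True
    have "radial_ext (\<omega> s) y = radial_ext (\<omega> s) x" if "0 < b \<bullet> y" for y
    proof -
      have "y \<noteq> 0" using that by auto
      then show ?thesis using that True x by (simp add: re inner_commute)
    qed
    then have "\<forall>y\<in>{y. b \<bullet> y > 0}. radial_ext (\<omega> s) y = radial_ext (\<omega> s) x" by blast
    moreover have "x \<in> {y. b \<bullet> y > 0}" using True by (simp add: inner_commute)
    ultimately show ?thesis using open_halfspace_gt[of 0 b] by blast
  next
    case False
    have "x \<bullet> b \<noteq> 0" using xb[of x] x by auto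
    then have neg: "x \<bullet> b < 0" using False by simp
    have "radial_ext (\<omega> s) y = radial_ext (\<omega> s) x" if "b \<bullet> y < 0" for y
    proof -
      have "y \<noteq> 0" using that by auto
      then show ?thesis using that neg x by (simp add: re inner_commute)
    qed
    then have "\<forall>y\<in>{y. b \<bullet> y < 0}. radial_ext (\<omega> s) y = radial_ext (\<omega> s) x" by blast
    moreover have "x \<in> {y. b \<bullet> y < 0}" using neg by (simp add: inner_commute)
    ultimately show ?thesis using open_halfspace_lt[of b 0] by blast
  qed
  have "bifurcation_curve p I M \<omega> (g a) (a powr r)"
    unfolding bifurcation_curve_def
  proof (intro conjI ballI)
    show "open I" "connected I" "0 \<in> I" using eps by (auto simp: I_def)
    then have I0: "0 \<in> I" by simp
    show "continuous_on I M" by (rule cM)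
    show "M 0 = g a" by (simp add: M_def A1_def)
    have "A2 0 = a" unfolding A2_def M_def A1_def h_def using inj a by (simp add: inv_into_f_f)
    then show "\<omega> 0 \<sigma> = a powr r" for \<sigma> by (simp add: \<omega>_def A1_def)
    fix s assume s: "s \<in> I"
    show "positive_solution p (M s) (\<omega> s)"
    proof (rule locally_constant_positive_solution[OF lc p, THEN iffD2], simp, rule ballI)
      fix \<sigma> :: 'a
      have "positive_root 1 p (M s) (A1 s powr r)"
        using positive_root_of_param[OF p A1(1), of 1] by (simp add: M_def g_def r_def)
      moreover have "positive_root 1 p (M s) (A2 s powr r)"
        using positive_root_of_param[OF p A2pos[OF s], of 1] A2(2)[OF s] by (simp add: g_def r_def)
      ultimately show "positive_root DIM('a) p (M s) (\<omega> s \<sigma>)" by (simp add: \<omega>_def dim)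
    qed
    show "uniform_limit (sphere 0 1) \<omega> (\<omega> s) (at s within I)"
    proof (rule uniform_limitI)
      fix e :: real assume e: "e > 0"
      have "((\<lambda>s. A1 s powr r) \<longlongrightarrow> A1 s powr r) (at s within I)" "((\<lambda>s. A2 s powr r) \<longlongrightarrow> A2 s powr r) (at s within I)"
        using cX1 cX2 s by (auto simp: continuous_on_def)
      from tendstoD[OF this(1) e] tendstoD[OF this(2) e]
      show "\<forall>\<^sub>F t in at s within I. \<forall>\<sigma>\<in>sphere 0 1. dist (\<omega> t \<sigma>) (\<omega> s \<sigma>) < e"
        by eventually_elim (simp add: \<omega>_def)
    qed
    have "sph_grad (\<omega> t) \<sigma> = 0" if "\<sigma> \<in> sphere 0 1" for t \<sigma>
      using locally_constant_calculus(2)[OF lc that] .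
    then show "uniform_limit (sphere 0 1) (\<lambda>t. sph_grad (\<omega> t)) (sph_grad (\<omega> s)) (at s within I)"
      by (intro uniform_limitI always_eventually) simp
  next
    fix s assume s: "s \<in> I - {0}"
    then have "A2 s \<le> a" "a < A1 s" "0 < A2 s" using A2(1)[of s] A2pos[of s] by (auto simp: A1_def)
    then have "A2 s powr r < A1 s powr r" using r by (intro powr_less_mono2) auto
    then have "\<omega> s b \<noteq> \<omega> s (- b)" using b by (simp add: \<omega>_def)
    moreover have "b \<in> sphere 0 1" "- b \<in> sphere 0 1" using b by auto
    ultimately show "\<not> \<omega> s constant_on sphere 0 1" unfolding constant_on_def by metis
  qed
  then show ?thesis using eps unfolding I_def a_def g_def r_def by blast
qed

text \<open>The index starts at 1 because for N = 1 the values at 0 and 1 are both 0.\<close>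

lemma lam_strict_mono: "N \<ge> 1 \<Longrightarrow> 1 \<le> j \<Longrightarrow> j < k \<Longrightarrow> lam N j < lam N k"
  unfolding lam_def by (intro mult_strict_mono) auto

lemma bif_level_strict_mono:
  "p > 1 \<Longrightarrow> N \<ge> 1 \<Longrightarrow> 1 \<le> j \<Longrightarrow> j < k \<Longrightarrow> bif_level N p j < bif_level N p k"
  using lam_strict_mono[of N j k] unfolding bif_level_def
  by (intro divide_strict_right_mono) auto

lemma lam_ge: "N \<ge> 3 \<Longrightarrow> real k \<le> lam N k"
  unfolding lam_def by (cases "k = 0") (auto simp: mult_le_cancel_left1)

text \<open>With lam N 1 = N - 1 the inequality becomes N + 1 <= p (N - 3). For N = 3 it never
  holds, in accordance with the infinite critical exponent.\<close>

lemma p_crit_iff: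
  assumes N: "N \<ge> 3" and p: "p > 1"
  shows "p_crit N \<le> ereal p \<longleftrightarrow> lam N 1 \<le> 2 * K_coeff N p"
    and "ereal p = p_crit N \<Longrightarrow> 2 * K_coeff N p = lam N 1"
proof -
  have "lam N 1 \<le> 2 * K_coeff N p \<longleftrightarrow> (real N - 1) * (p - 1) \<le> 2 * ((real N - 2) * p - real N)"
    using p by (simp add: lam_def K_coeff_def pos_le_divide_eq)
  also have "\<dots> \<longleftrightarrow> real N + 1 \<le> p * (real N - 3)" by (simp add: algebra_simps)
  finally have 1: "lam N 1 \<le> 2 * K_coeff N p \<longleftrightarrow> real N + 1 \<le> p * (real N - 3)" .
  show "p_crit N \<le> ereal p \<longleftrightarrow> lam N 1 \<le> 2 * K_coeff N p"
    unfolding 1 p_crit_def using N by (auto simp: pos_divide_le_eq)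
  assume e: "ereal p = p_crit N"
  then have N3: "N \<noteq> 3" by (auto simp: p_crit_def)
  then have "p = (real N + 1) / (real N - 3)" using e by (simp add: p_crit_def)
  then have "p * (real N - 3) = real N + 1" using N N3 by (simp add: eq_divide_eq)
  then have "2 * ((real N - 2) * p - real N) = (real N - 1) * (p - 1)" by (simp add: algebra_simps)
  then show "2 * K_coeff N p = lam N 1" using p by (simp add: lam_def K_coeff_def nonzero_divide_eq_eq)
qed

text \<open>This puts 2K below lam N 2 = 2N, so that only k = 1 can satisfy lam N k <= 2K.\<close>

lemma K_coeff_less:
  assumes N: "N \<ge> 3" and p: "p > 1"
  shows "K_coeff N p < real N - 2"
proof -
  have "(real N - 2) * p - real N < (real N - 2) * (p - 1)" by (simp add: algebra_simps)
  then show ?thesis using p by (simp only: K_coeff_def pos_divide_less_eq diff_gt_0_iff_gt)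
qed

lemma root_param_at_bot:
  assumes p: "p > 1"
  shows "filterlim (root_param N p) at_bot at_top"
  unfolding filterlim_at_bot eventually_at_top_linorder
proof
  fix Z :: real
  define b where "b = (2 / (p - 1)) powr (2 * p / (p + 1))"
  define r where "r = 1 / (p + 1)"
  define Y where "Y = 2 * b * (\<bar>Z\<bar> + 1)"
  have b: "b > 0" using p by (simp add: b_def)
  have r: "0 < r" "r < 1" using p by (auto simp: r_def)
  have Y: "Y > 0" using b by (simp add: Y_def)
  show "\<exists>A0. \<forall>A\<ge>A0. root_param N p A \<le> Z"
  proof (intro exI allI impI)
    \<comment> \<open>The thresholds in order: A is at least 1, so its powers are positive; c - A <=
      - A/2; and Y A powr r <= A, since A grows faster than A powr r with r < 1.\<close>
    fix A assume A: "max 1 (max (2 * root_const N p) (Y powr (1 / (1 - r)))) \<le> A"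
    then have A1: "1 \<le> A" "2 * root_const N p \<le> A" "Y powr (1 / (1 - r)) \<le> A" by auto
    have "Y = (Y powr (1 / (1 - r))) powr (1 - r)" using Y r by (simp add: powr_powr)
    also have "\<dots> \<le> A powr (1 - r)" using A1 r by (intro powr_mono2) auto
    finally have YA: "Y * A powr r \<le> A"
      using A1 by (simp add: powr_diff pos_le_divide_eq)
    have "root_const N p - A \<le> - (A / 2)" using A1 by simp
    also have "\<dots> \<le> - (Y * A powr r / 2)" using YA by simp
    also have "\<dots> = - (\<bar>Z\<bar> + 1) * (b * A powr r)" by (simp add: Y_def algebra_simps)
    also have "\<dots> \<le> Z * (b * A powr r)" using b by (intro mult_right_mono) auto
    finally show "root_param N p A \<le> Z"
      unfolding root_param_def b_def[symmetric] r_def[symmetric] using b A1 by (simp add: pos_divide_le_eq)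
  qed
qed

lemma bif_level_at_top:
  assumes p: "p > 1" and N: "N \<ge> 3"
  shows "filterlim (bif_level N p) at_top sequentially"
  unfolding filterlim_at_top
proof
  fix Z :: real
  have pp: "p * (p - 1) > 0" using p by simp
  have "\<forall>\<^sub>F k in sequentially. nat \<lceil>\<bar>Z * (p * (p - 1)) + 2 * K_coeff N p\<bar>\<rceil> \<le> k"
    by (rule eventually_ge_at_top)
  then show "\<forall>\<^sub>F k in sequentially. Z \<le> bif_level N p k"
  proof eventually_elim
    case (elim k)
    then have "\<bar>Z * (p * (p - 1)) + 2 * K_coeff N p\<bar> \<le> real k" by linarith
    also have "real k \<le> 1 * lam N k" using lam_ge[OF N] by simp
    also have "1 * lam N k \<le> (p + 1) * lam N k"
      using p order_trans[OF of_nat_0_le_iff lam_ge[OF N]] by (intro mult_right_mono) auto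
    finally have "Z * (p * (p - 1)) \<le> (p + 1) * lam N k - 2 * K_coeff N p" by linarith
    then show ?case using pp by (simp only: bif_level_def pos_le_divide_eq)
  qed
qed

lemma root_param_bif_level_sign:
  assumes p: "p > 1" and A: "bif_level N p k > 0"
  shows "root_param N p (bif_level N p k) < 0 \<longleftrightarrow> 2 * K_coeff N p < lam N k"
    and "root_param N p (bif_level N p k) \<ge> 0 \<longleftrightarrow> lam N k \<le> 2 * K_coeff N p"
proof -
  have "(2 / (p - 1)) powr (2 * p / (p + 1)) * bif_level N p k powr (1 / (p + 1)) > 0" using p A by simp
  then have "root_param N p (bif_level N p k) < 0 \<longleftrightarrow> root_const N p - bif_level N p k < 0"
    unfolding root_param_def by (simp add: divide_less_0_iff)
  also have "\<dots> \<longleftrightarrow> 2 * K_coeff N p < lam N k"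
    unfolding root_const_minus_bif_level[OF p] using p by (auto simp: mult_less_0_iff zero_less_mult_iff divide_less_0_iff zero_less_divide_iff)
  finally show 1: "root_param N p (bif_level N p k) < 0 \<longleftrightarrow> 2 * K_coeff N p < lam N k" .
  then show "root_param N p (bif_level N p k) \<ge> 0 \<longleftrightarrow> lam N k \<le> 2 * K_coeff N p" by linarith
qed

lemma Phi_sign: "p > 1 \<Longrightarrow> X > 0 \<Longrightarrow> M \<ge> 0 \<Longrightarrow> Phi p M X \<ge> 0"
  by (simp add: Phi_def)

section \<open>The three cases, read off the levels A = \<open>bif_level N p k\<close>\<close>

theorem theorem6p4:
  fixes p :: real and N :: nat
  assumes N: "N = DIM('a::euclidean_space)" and p: "p > 1"
  shows
    "(N \<ge> 3 \<and> p \<ge> real N / (real N - 2) \<longrightarrow>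
       (\<forall>k\<ge>1.
          (\<exists>M0\<ge>0. associated N p k M0 (X_root N p M0) \<and>
             (\<exists>I M (\<omega> :: real \<Rightarrow> 'a \<Rightarrow> real). bifurcation_curve p I M \<omega> M0 (X_root N p M0)))
          \<longleftrightarrow> ereal p \<ge> p_crit N \<and> k = 1) \<and>
       (ereal p = p_crit N \<longrightarrow>
          (\<forall>M0\<ge>0. associated N p 1 M0 (X_root N p M0) \<and>
             (\<exists>I M (\<omega> :: real \<Rightarrow> 'a \<Rightarrow> real). bifurcation_curve p I M \<omega> M0 (X_root N p M0))
             \<longrightarrow> M0 = 0)) \<and>
       (ereal p \<ge> p_crit N \<longrightarrow>
          (\<exists>M0\<ge>0. associated N p 1 M0 (X_root N p M0) \<and>
             (\<exists>\<epsilon>0>0. \<exists>M (\<omega> :: real \<Rightarrow> 'a \<Rightarrow> real).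
                bifurcation_curve p {-\<epsilon>0<..<\<epsilon>0} M \<omega> M0 (X_root N p M0))))) \<and>
     (N \<ge> 3 \<and> p \<ge> real N / (real N - 2) \<longrightarrow>
       (\<exists>Mk :: nat \<Rightarrow> real.
          (\<forall>k\<ge>1. (k = 1 \<longrightarrow> ereal p < p_crit N) \<longrightarrow>
             Mk k < 0 \<and> associated N p k (Mk k) (X_root N p (Mk k)) \<and>
             (\<exists>\<epsilon>0>0. \<exists>M (\<omega> :: real \<Rightarrow> 'a \<Rightarrow> real).
                bifurcation_curve p {-\<epsilon>0<..<\<epsilon>0} M \<omega> (Mk k) (X_root N p (Mk k)))) \<and>
          filterlim Mk at_bot sequentially)) \<and>
     (N = 1 \<or> N = 2 \<or> N \<ge> 3 \<and> p < real N / (real N - 2) \<longrightarrow>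
       \<not> (\<exists>M<0. M \<le> - mu_star N p \<and>
             2 * K_coeff N p / (p - 1) < Phi1 N p M \<and> Phi1 N p M < 0) \<and>
       (\<exists>Mk :: nat \<Rightarrow> real.
          inj_on Mk {1..} \<and>
          (\<forall>k\<ge>1. Mk k < 0 \<and> Mk k \<le> - mu_star N p \<and>
             Phi2 N p (Mk k) = (p + 1) / (p * (p - 1)) * (2 * K_coeff N p - lam N k)) \<and>
          (\<forall>k\<ge>1. (N = 1 \<longrightarrow> k = 1) \<longrightarrow>
             (\<exists>I M (\<omega> :: real \<Rightarrow> 'a \<Rightarrow> real). bifurcation_curve p I M \<omega> (Mk k) (X2_root N p (Mk k))))))"
proof (intro conjI impI)
  have N1: "N \<ge> 1" using N by simp
  have lam1: "lam N 1 = real N - 1" by (simp add: lam_def)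
  have lam2: "lam N k > 2 * (real N - 2)" if "k \<ge> 2" for k
  proof -
    have "2 * real N \<le> lam N k"
      unfolding lam_def using that by (intro mult_mono) auto
    then show ?thesis by simp
  qed
  have lam1_le: "lam N 1 \<le> lam N k" if "k \<ge> 1" for k
    using lam_strict_mono[OF N1, of 1 k] that by (cases "k = 1") auto
  have curve: "\<exists>\<epsilon>>0. \<exists>M (\<omega> :: real \<Rightarrow> 'a \<Rightarrow> real). bifurcation_curve p {-\<epsilon><..<\<epsilon>} M \<omega> M0 X"
    if "N \<ge> 2" "k \<ge> 1" "positive_root N p M0 X" "associated N p k M0 X" for k M0 X
    using bifurcation_at_eigenvalue[where 'a = 'a, of k p M0 X] that p unfolding N by blast
  have super: "0 \<le> root_const N p" "2 * K_coeff N p < 2 * (real N - 2)" "\<And>k. k \<ge> 1 \<Longrightarrow> 0 < bif_level N p k"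
    if h: "N \<ge> 3 \<and> p \<ge> real N / (real N - 2)"
  proof -
    have N2: "real N - 2 > 0" and "real N / (real N - 2) \<le> p" using h by auto
    then have "real N \<le> p * (real N - 2)" by (simp only: pos_divide_le_eq)
    then have "real N \<le> (real N - 2) * p" by (simp only: mult.commute)
    then show "0 \<le> root_const N p" using p by (simp add: root_const_def K_coeff_def)
    show K2: "2 * K_coeff N p < 2 * (real N - 2)" using K_coeff_less[of N p] h p by simp
    fix k :: nat assume "k \<ge> 1"
    then have l: "real N - 1 \<le> lam N k" using lam1_le lam1 by metis
    have "2 * (real N - 1) \<le> (p + 1) * lam N k" using p l N1 by (intro mult_mono) auto
    moreover have "2 * K_coeff N p < 2 * (real N - 1)" using K2 by simp
    ultimately have "2 * K_coeff N p < (p + 1) * lam N k" by (rule less_le_trans[rotated])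
    then show "0 < bif_level N p k" using p by (simp add: bif_level_def)
  qed
  define Mk where "Mk k = root_param N p (bif_level N p k)" for k
  have super_root: "positive_root N p (Mk k) (X_root N p (Mk k))" "associated N p k (Mk k) (X_root N p (Mk k))"
    if h: "N \<ge> 3 \<and> p \<ge> real N / (real N - 2)" and k: "k \<ge> 1" for k
  proof -
    note b = bif_level_root[OF p super(3)[OF h k]]
    have "X_root N p (Mk k) = bif_level N p k powr (1 / (p - 1))"
      unfolding Mk_def by (rule X_root_eq[OF p super(1)[OF h] b(1)])
    then show "positive_root N p (Mk k) (X_root N p (Mk k))" "associated N p k (Mk k) (X_root N p (Mk k))"
      using b by (simp_all add: Mk_def)
  qed
  have super_curve: "\<exists>\<epsilon>>0. \<exists>M (\<omega> :: real \<Rightarrow> 'a \<Rightarrow> real). bifurcation_curve p {-\<epsilon><..<\<epsilon>} M \<omega> (Mk k) (X_root N p (Mk k))"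
    if h: "N \<ge> 3 \<and> p \<ge> real N / (real N - 2)" and k: "k \<ge> 1" for k
    using curve[OF _ k super_root[OF h k]] h by simp
  {
    assume h: "N \<ge> 3 \<and> p \<ge> real N / (real N - 2)"
    then have N3: "N \<ge> 3" by simp
    note crit = p_crit_iff[OF N3 p]
    have Mk0: "Mk 1 \<ge> 0" if "p_crit N \<le> ereal p"
      unfolding Mk_def using root_param_bif_level_sign(2)[OF p super(3)[OF h, of 1]] crit(1) that by simp
    show "\<forall>k\<ge>1. (\<exists>M0\<ge>0. associated N p k M0 (X_root N p M0) \<and>
             (\<exists>I M (\<omega> :: real \<Rightarrow> 'a \<Rightarrow> real). bifurcation_curve p I M \<omega> M0 (X_root N p M0)))
          \<longleftrightarrow> ereal p \<ge> p_crit N \<and> k = 1"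
    proof (intro allI impI iffI)
      fix k :: nat assume k: "k \<ge> 1"
      assume "\<exists>M0\<ge>0. associated N p k M0 (X_root N p M0) \<and>
             (\<exists>I M (\<omega> :: real \<Rightarrow> 'a \<Rightarrow> real). bifurcation_curve p I M \<omega> M0 (X_root N p M0))"
      then obtain M0 I M and \<omega> :: "real \<Rightarrow> 'a \<Rightarrow> real" where M0: "M0 \<ge> 0"
        and as: "associated N p k M0 (X_root N p M0)" and bc: "bifurcation_curve p I M \<omega> M0 (X_root N p M0)" by blast
      have root: "positive_root N p M0 (X_root N p M0)" using bifurcation_curve_root[OF bc p] by (simp add: N)
      \<comment> \<open>The sign of M0 passes to \<open>Phi\<close>, and by association to 2K - lam
        N k; the size of 2K then leaves only k = 1.\<close>
      then have "Phi p M0 (X_root N p M0) \<ge> 0" using M0 p by (intro Phi_sign) (auto simp: positive_root_def)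
      then have "0 \<le> (p + 1) / (p * (p - 1)) * (2 * K_coeff N p - lam N k)" using as by (simp add: associated_def)
      moreover have "(p + 1) / (p * (p - 1)) > 0" using p by simp
      ultimately have le: "lam N k \<le> 2 * K_coeff N p"
        using zero_le_mult_iff[of "(p + 1) / (p * (p - 1))" "2 * K_coeff N p - lam N k"] by linarith
      then have "\<not> k \<ge> 2" using lam2[of k] super(2)[OF h] by force
      then have "k = 1" using k by simp
      then show "ereal p \<ge> p_crit N \<and> k = 1" using le crit(1) by simp
    next
      fix k :: nat assume "k \<ge> 1" and "ereal p \<ge> p_crit N \<and> k = 1"
      then show "\<exists>M0\<ge>0. associated N p k M0 (X_root N p M0) \<and>
             (\<exists>I M (\<omega> :: real \<Rightarrow> 'a \<Rightarrow> real). bifurcation_curve p I M \<omega> M0 (X_root N p M0))"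
        using Mk0 super_root(2)[OF h, of 1] super_curve[OF h, of 1] by blast
    qed
    show "\<forall>M0\<ge>0. associated N p 1 M0 (X_root N p M0) \<and>
             (\<exists>I M (\<omega> :: real \<Rightarrow> 'a \<Rightarrow> real). bifurcation_curve p I M \<omega> M0 (X_root N p M0)) \<longrightarrow> M0 = 0"
      if e: "ereal p = p_crit N"
    proof (intro allI impI)
      fix M0 :: real
      assume "associated N p 1 M0 (X_root N p M0) \<and>
             (\<exists>I M (\<omega> :: real \<Rightarrow> 'a \<Rightarrow> real). bifurcation_curve p I M \<omega> M0 (X_root N p M0))"
      then obtain I M and \<omega> :: "real \<Rightarrow> 'a \<Rightarrow> real" where
        as: "associated N p 1 M0 (X_root N p M0)" and bc: "bifurcation_curve p I M \<omega> M0 (X_root N p M0)" by blast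
      have "X_root N p M0 > 0" using bifurcation_curve_root[OF bc p] by (simp add: positive_root_def)
      moreover have "Phi p M0 (X_root N p M0) = 0" using as crit(2)[OF e] by (simp add: associated_def)
      ultimately show "M0 = 0" using p by (simp add: Phi_def)
    qed
    show "\<exists>M0\<ge>0. associated N p 1 M0 (X_root N p M0) \<and>
             (\<exists>\<epsilon>0>0. \<exists>M (\<omega> :: real \<Rightarrow> 'a \<Rightarrow> real).
                bifurcation_curve p {-\<epsilon>0<..<\<epsilon>0} M \<omega> M0 (X_root N p M0))"
      if "ereal p \<ge> p_crit N"
      using Mk0[OF that] super_root(2)[OF h, of 1] super_curve[OF h, of 1] by blast
    show "\<exists>Mk :: nat \<Rightarrow> real.
          (\<forall>k\<ge>1. (k = 1 \<longrightarrow> ereal p < p_crit N) \<longrightarrow>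
             Mk k < 0 \<and> associated N p k (Mk k) (X_root N p (Mk k)) \<and>
             (\<exists>\<epsilon>0>0. \<exists>M (\<omega> :: real \<Rightarrow> 'a \<Rightarrow> real).
                bifurcation_curve p {-\<epsilon>0<..<\<epsilon>0} M \<omega> (Mk k) (X_root N p (Mk k)))) \<and>
          filterlim Mk at_bot sequentially"
    proof (intro exI[of _ Mk] conjI allI impI)
      fix k :: nat assume k: "1 \<le> k" and c: "k = 1 \<longrightarrow> ereal p < p_crit N"
      have "2 * K_coeff N p < lam N k"
      proof (cases "k = 1")
        case True
        then show ?thesis using c crit(1) by (simp add: not_le[symmetric])
      next
        case False
        then show ?thesis using k lam2[of k] super(2)[OF h] by force
      qed
      then show "Mk k < 0"
        unfolding Mk_def using root_param_bif_level_sign(1)[OF p super(3)[OF h k]] by simp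
      show "associated N p k (Mk k) (X_root N p (Mk k))" by (rule super_root(2)[OF h k])
      show "\<exists>\<epsilon>0>0. \<exists>M (\<omega> :: real \<Rightarrow> 'a \<Rightarrow> real).
                bifurcation_curve p {-\<epsilon>0<..<\<epsilon>0} M \<omega> (Mk k) (X_root N p (Mk k))"
        by (rule super_curve[OF h k])
    next
      show "filterlim Mk at_bot sequentially"
        unfolding Mk_def[abs_def] by (rule filterlim_compose[OF root_param_at_bot[OF p] bif_level_at_top[OF p N3]])
    qed
  }
  assume h: "N = 1 \<or> N = 2 \<or> N \<ge> 3 \<and> p < real N / (real N - 2)"
  have "(real N - 2) * p < real N"
    using h
  proof (elim disjE conjE)
    assume "3 \<le> N" "p < real N / (real N - 2)"
    then have "real N - 2 > 0" "p < real N / (real N - 2)" by auto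
    then have "p * (real N - 2) < real N" by (simp only: pos_less_divide_eq)
    then show ?thesis by (simp only: mult.commute)
  qed (use p in auto)
  then have K: "K_coeff N p < 0" using p by (simp add: K_coeff_def divide_neg_pos)
  then have c: "root_const N p < 0" using p by (simp add: root_const_def divide_neg_pos)
  note fold = root_param_fold[OF p K]
  have lam0: "lam N k \<ge> 0" if "k \<ge> 1" for k
    using lam1_le[OF that] lam1 N1 by simp
  have cp: "- root_const N p / p = - 2 * K_coeff N p / (p * (p - 1))"
    using p by (simp add: root_const_def field_simps)
  \<comment> \<open>The fold is the level formula with eigenvalue 0. As lam N k >= 0, every level
    lies at or to the right of it, which is why the larger root X2 is the one that
    bifurcates.\<close>
  have fold_le: "- root_const N p / p \<le> bif_level N p k" if "k \<ge> 1" for k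
    unfolding cp bif_level_def using lam0[OF that] p by (intro divide_right_mono) auto
  have fold_pos: "0 < - root_const N p / p" using c p by (simp add: divide_neg_pos)
  have pos: "0 < bif_level N p k" if "k \<ge> 1" for k
    by (rule less_le_trans[OF fold_pos fold_le[OF that]])
  have X2: "X2_root N p (Mk k) = bif_level N p k powr (1 / (p - 1))" if "k \<ge> 1" for k
    unfolding Mk_def by (rule X2_root_eq[OF p pos[OF that] fold_le[OF that]])
  have sub_root: "positive_root N p (Mk k) (X2_root N p (Mk k))" "associated N p k (Mk k) (X2_root N p (Mk k))"
    if "k \<ge> 1" for k
    unfolding X2[OF that] unfolding Mk_def by (rule bif_level_root[OF p pos[OF that]])+
  show "\<not> (\<exists>M<0. M \<le> - mu_star N p \<and> 2 * K_coeff N p / (p - 1) < Phi1 N p M \<and> Phi1 N p M < 0)"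
  proof
    assume "\<exists>M<0. M \<le> - mu_star N p \<and> 2 * K_coeff N p / (p - 1) < Phi1 N p M \<and> Phi1 N p M < 0"
    then obtain M where M: "M < 0" "M \<le> - mu_star N p" "root_const N p < Phi1 N p M"
      unfolding root_const_def by blast
    have "positive_root N p M (X1_root N p M)" by (rule X1_root_is_root[OF p c M(1)]) (simp only: fold M(2))
    \<comment> \<open>At a root \<open>Phi\<close> is c minus a nonnegative power, so it never
      exceeds c = 2K / (p - 1).\<close>
    from root_Phi[OF this] have "Phi1 N p M \<le> root_const N p" by (simp add: Phi1_def)
    then show False using M(3) by simp
  qed
  show "\<exists>Mk :: nat \<Rightarrow> real.
          inj_on Mk {1..} \<and>
          (\<forall>k\<ge>1. Mk k < 0 \<and> Mk k \<le> - mu_star N p \<and>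
             Phi2 N p (Mk k) = (p + 1) / (p * (p - 1)) * (2 * K_coeff N p - lam N k)) \<and>
          (\<forall>k\<ge>1. (N = 1 \<longrightarrow> k = 1) \<longrightarrow>
             (\<exists>I M (\<omega> :: real \<Rightarrow> 'a \<Rightarrow> real). bifurcation_curve p I M \<omega> (Mk k) (X2_root N p (Mk k))))"
  proof (intro exI[of _ Mk] conjI allI impI)
    \<comment> \<open>The levels increase with k and M decreases to the right of the fold. Distinct
      k thus give distinct parameters, so the set of the M_k is infinite.\<close>
    have dec: "Mk k < Mk j" if "1 \<le> j" "j < k" for j k
      unfolding Mk_def
      by (rule root_param_strict_decreasing[OF p pos[OF that(1)] fold_le[OF that(1)] bif_level_strict_mono[OF p N1 that]])
    show "inj_on Mk {1..}"
    proof (rule inj_onI)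
      fix j k :: nat assume jk: "j \<in> {1..}" "k \<in> {1..}" "Mk j = Mk k"
      show "j = k"
        using dec[of j k] dec[of k j] jk by (cases j k rule: linorder_cases) auto
    qed
    fix k :: nat assume k: "1 \<le> k"
    show "Mk k < 0"
      unfolding Mk_def using root_param_bif_level_sign(1)[OF p pos[OF k]] K lam0[OF k] by simp
    show "Mk k \<le> - mu_star N p"
    proof (cases "- root_const N p / p = bif_level N p k")
      case True
      then show ?thesis unfolding Mk_def using fold by simp
    next
      case False
      then have lt: "- root_const N p / p < bif_level N p k" using fold_le[OF k] by simp
      from root_param_strict_decreasing[OF p fold_pos order_refl lt] show ?thesis unfolding Mk_def fold by simp
    qed
    show "Phi2 N p (Mk k) = (p + 1) / (p * (p - 1)) * (2 * K_coeff N p - lam N k)"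
      using sub_root(2)[OF k] by (simp add: Phi2_def associated_def)
    assume N1k: "N = 1 \<longrightarrow> k = 1"
    show "\<exists>I M (\<omega> :: real \<Rightarrow> 'a \<Rightarrow> real). bifurcation_curve p I M \<omega> (Mk k) (X2_root N p (Mk k))"
    proof (cases "N = 1")
      case False
      then have "N \<ge> 2" using N1 by simp
      from curve[OF this k sub_root[OF k]] show ?thesis by blast
    next
      case True
      then have k1: "k = 1" using N1k by simp
      \<comment> \<open>For N = 1 the first eigenvalue of the list is 0, so the first level is the
        fold itself.\<close>
      have "lam N k = 0" unfolding k1 lam1 using True by simp
      then have "bif_level N p k = - root_const N p / p"
        unfolding cp bif_level_def by simp
      then have "Mk k = root_param 1 p (- root_const 1 p / p)" "X2_root N p (Mk k) = (- root_const 1 p / p) powr (1 / (p - 1))"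
        using X2[OF k] True by (simp_all add: Mk_def)
      then show ?thesis
        using bifurcation_fold_dim1[where 'a = 'a, OF _ p] N True c by auto
    qed
  qed
qed

end
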